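(* Let $(M,g_M)$ be a Riemannian manifold and let $(E,\pi_M,M)$ be a differentiable vector bundle over $M$ endowed with a Euclidean structure (bundle metric) $g_E$ and a metric connection $K_E\colon TE\to E$. Then the Sasaki metric $G_E^S$, defined for every $\nu\in TE$ by $$G_E^S(\nu)=g_M(D\pi_M(\nu))+g_E(K_E(\nu)),$$ is strongly concordant with $g_E$.
   Context: For metrics, the same symbol denotes the bilinear form and the associated quadratic form: $g_E(e)=g_E(e,e)$, etc. $\pi_E\colon TE\to E$ is the tangent bundle projection of $E$ and $\pi_M\colon E\to M$ (also $TM\to M$) the bundle projection; $M$ is identified with the zero section of $E$, so that $TM\subset TE$ and $D\pi_M(\nu)\in TM\subset TE$ for $\nu\in TE$. The vertical lift at $e\in E$ of $\eta$ in the fiber $\pi_M^{-1}(\{\pi_M(e)\})$ is $\mathrm{Vert}_e(\eta)=\frac{d}{dt}(e+t\eta)|_{t=0}\in T_eE$. A connection is a map $K_E\colon TE\to E$ that is a bundle morphism from $(TE,\pi_E,E)$ to $(E,\pi_M,M)$ covering $\pi_M\colon E\to M$, and a bundle morphism from $(TE,D\pi_M,TM)$ to $(E,\pi_M,M)$ covering $\pi_M\colon TM\to M$, and satisfies $K_E\circ\mathrm{Vert}_e=\mathrm{id}$ on $\pi_M^{-1}(\{\pi_M(e)\})$ for every $e\in E$. It is metric if $Dg_E(\nu)=2g_E(K_E(\nu),\pi_E(\nu))$ for every $\nu\in TE$, where $Dg_E$ is the derivative of the quadratic form $g_E\colon E\to\mathbb{R}$. A Riemannian metric $G_E$ on the manifold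 $E$ is strongly concordant with $g_E$ if: (a) for every $\nu\in TE$, $G_E(D\pi_M(\nu))\le G_E(\nu)$; (b) there exists $\kappa>0$ such that for every $\nu\in TE$, $(\kappa^{-1}Dg_E(\nu))^2\le4\,g_E(\pi_E(\nu))\,G_E(\nu)$, and for every $e\in E$, $G_E(\mathrm{Vert}_e(e))\le\kappa^2g_E(e)$. *)

theory Defs
  imports "HOL-Analysis.Analysis"
begin

section \<open>Model spaces and smooth maps between them\<close>

text \<open>Model spaces of charts and fibres. The class \<^class>\<open>euclidean_space\<close> excludes dimension
  zero, which would exclude zero-dimensional manifolds and bundles of rank zero.\<close>

class finite_dim_inner = real_inner +
  assumes finitely_spanned: "\<exists>B. finite B \<and> (\<forall>x. \<exists>u. x = (\<Sum>b\<in>B. u b *\<^sub>R b))"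

lemma finite_span_UNIV: "\<exists>B :: 'a::finite_dim_inner set. finite B \<and> span B = UNIV"
proof -
  obtain B :: "'a set" where B: "finite B" "\<forall>x. \<exists>u. x = (\<Sum>b\<in>B. u b *\<^sub>R b)"
    using finitely_spanned by blast
  then have "span B = UNIV" unfolding span_finite[OF B(1)] by (simp add: image_def set_eq_iff)
  then show ?thesis using B(1) by blast
qed

instance prod :: (finite_dim_inner, finite_dim_inner) finite_dim_inner
proof
  obtain B :: "'a set" where B: "finite B" "span B = UNIV"
    using finite_span_UNIV by blast
  obtain C :: "'b set" where C: "finite C" "span C = UNIV"
    using finite_span_UNIV by blast
  let ?S = "B \<times> {0} \<union> {0} \<times> C"
  have *: "x \<in> span ?S" for x
  proof -
    have "(fst x, 0) \<in> span (B \<times> {0::'b})" "(0, snd x) \<in> span ({0::'a} \<times> C)"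
      using B(2) C(2) by (simp_all add: span_Times_sing1 span_Times_sing2)
    then have "(fst x, 0) + (0, snd x) \<in> span ?S"
      by (meson span_add span_mono subsetD Un_upper1 Un_upper2)
    then show ?thesis by simp
  qed
  have fin: "finite ?S" using B(1) C(1) by simp
  then have "\<exists>u. x = (\<Sum>b\<in>?S. u b *\<^sub>R b)" for x
    using *[of x] unfolding span_finite[OF fin] by auto
  then show "\<exists>S :: ('a \<times> 'b) set. finite S \<and> (\<forall>x. \<exists>u. x = (\<Sum>b\<in>S. u b *\<^sub>R b))"
    using fin by blast
qed

instance euclidean_space \<subseteq> finite_dim_inner
proof
  have "\<exists>u. x = (\<Sum>b\<in>Basis. u b *\<^sub>R b)" for x :: 'a
    by (rule exI[of _ "inner x"]) (simp add: euclidean_representation)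
  then show "\<exists>B :: 'a set. finite B \<and> (\<forall>x. \<exists>u. x = (\<Sum>b\<in>B. u b *\<^sub>R b))"
    using finite_Basis by blast
qed

text \<open>Class \<open>C\<^sup>k\<close> through iterated directional derivatives; only used for open \<open>S\<close>.\<close>

primrec Ck_on :: "nat \<Rightarrow> ('a::real_normed_vector \<Rightarrow> 'b::real_normed_vector) \<Rightarrow> 'a set \<Rightarrow> bool"
  where
    "Ck_on 0 f S \<longleftrightarrow> continuous_on S f"
  | "Ck_on (Suc k) f S \<longleftrightarrow> (\<forall>x\<in>S. f differentiable (at x)) \<and>
       (\<forall>v. Ck_on k (\<lambda>x. frechet_derivative f (at x) v) S)"

definition smooth_on :: "('a::real_normed_vector \<Rightarrow> 'b::real_normed_vector) \<Rightarrow> 'a set \<Rightarrow> bool"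
  where "smooth_on f S \<longleftrightarrow> (\<forall>k. Ck_on k f S)"


section \<open>Smooth manifolds\<close>

text \<open>A manifold is given by an atlas, not necessarily maximal. A chart is its domain together
  with a coordinate map, whose values outside the domain are irrelevant.\<close>

type_synonym ('a, 'm) chart = "'a set \<times> ('a \<Rightarrow> 'm)"
type_synonym ('a, 'm) atlas = "('a, 'm) chart set"

definition space_of :: "('a, 'm) atlas \<Rightarrow> 'a set"
  where "space_of A = (\<Union>c\<in>A. fst c)"

definition charts_at :: "('a, 'm) atlas \<Rightarrow> 'a \<Rightarrow> ('a, 'm) chart set"
  where "charts_at A p = {c \<in> A. p \<in> fst c}"

definition param :: "('a, 'm) chart \<Rightarrow> 'm \<Rightarrow> 'a"
  where "param c = inv_into (fst c) (snd c)"

definition smooth_atlas :: "('a, 'm::finite_dim_inner) atlas \<Rightarrow> bool"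
  where "smooth_atlas A \<longleftrightarrow>
    (\<forall>c\<in>A. inj_on (snd c) (fst c) \<and> open (snd c ` fst c)) \<and>
    (\<forall>c\<in>A. \<forall>d\<in>A. open (snd c ` (fst c \<inter> fst d)) \<and>
       smooth_on (snd d \<circ> param c) (snd c ` (fst c \<inter> fst d)))"

definition open_of :: "('a, 'm::finite_dim_inner) atlas \<Rightarrow> 'a set \<Rightarrow> bool"
  where "open_of A S \<longleftrightarrow> S \<subseteq> space_of A \<and> (\<forall>c\<in>A. open (snd c ` (S \<inter> fst c)))"

definition manifold_topology :: "('a, 'm::finite_dim_inner) atlas \<Rightarrow> 'a topology"
  where "manifold_topology A = topology (open_of A)"

lemma istopology_open_of:
  assumes "smooth_atlas A"
  shows "istopology (open_of A)"
  unfolding istopology_def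
proof (intro conjI allI impI)
  fix S T assume S: "open_of A S" and T: "open_of A T"
  have "open (snd c ` (S \<inter> T \<inter> fst c))" if c: "c \<in> A" for c
  proof -
    have "inj_on (snd c) (fst c)" using assms c by (auto simp: smooth_atlas_def)
    then have "snd c ` ((S \<inter> fst c) \<inter> (T \<inter> fst c)) = snd c ` (S \<inter> fst c) \<inter> snd c ` (T \<inter> fst c)"
      by (intro inj_on_image_Int) auto
    moreover have "(S \<inter> fst c) \<inter> (T \<inter> fst c) = S \<inter> T \<inter> fst c" by blast
    ultimately show ?thesis using S T c by (auto simp: open_of_def)
  qed
  then show "open_of A (S \<inter> T)" using S by (auto simp: open_of_def)
next
  fix \<S> assume *: "\<forall>S\<in>\<S>. open_of A S"
  have "open (snd c ` (\<Union>\<S> \<inter> fst c))" if "c \<in> A" for c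
  proof -
    have "snd c ` (\<Union>\<S> \<inter> fst c) = (\<Union>S\<in>\<S>. snd c ` (S \<inter> fst c))" by blast
    then show ?thesis using * that by (auto simp: open_of_def)
  qed
  then show "open_of A (\<Union>\<S>)" using * by (auto simp: open_of_def)
qed

lemma openin_manifold_topology:
  "smooth_atlas A \<Longrightarrow> openin (manifold_topology A) S \<longleftrightarrow> open_of A S"
  by (simp add: manifold_topology_def istopology_open_of topology_inverse')

definition smooth_manifold :: "('a, 'm::finite_dim_inner) atlas \<Rightarrow> bool"
  where "smooth_manifold A \<longleftrightarrow> smooth_atlas A \<and>
    Hausdorff_space (manifold_topology A) \<and>
    second_countable (manifold_topology A)"

text \<open>Openness of the coordinate domain expresses continuity of \<open>f\<close>; the atlases are not
  maximal, so one cannot shrink charts to get \<open>f ` fst c \<subseteq> fst d\<close>.\<close>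

definition smooth_map ::
    "('a, 'm::finite_dim_inner) atlas \<Rightarrow> ('b, 'n::finite_dim_inner) atlas \<Rightarrow> ('a \<Rightarrow> 'b) \<Rightarrow> bool"
  where "smooth_map A B f \<longleftrightarrow> f ` space_of A \<subseteq> space_of B \<and>
    (\<forall>c\<in>A. \<forall>d\<in>B. open (snd c ` (fst c \<inter> f -` fst d)) \<and>
       smooth_on (snd d \<circ> f \<circ> param c) (snd c ` (fst c \<inter> f -` fst d)))"

definition diffeomorphism ::
    "('a, 'm::finite_dim_inner) atlas \<Rightarrow> ('b, 'n::finite_dim_inner) atlas \<Rightarrow> ('a \<Rightarrow> 'b) \<Rightarrow> bool"
  where "diffeomorphism A B f \<longleftrightarrow> bij_betw f (space_of A) (space_of B) \<and>
    smooth_map A B f \<and> smooth_map B A (inv_into (space_of A) f)"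

definition model_atlas :: "('m, 'm) atlas"
  where "model_atlas = {(UNIV, \<lambda>x. x)}"

definition restrict_atlas :: "('a, 'm) atlas \<Rightarrow> 'a set \<Rightarrow> ('a, 'm) atlas"
  where "restrict_atlas A W = (\<lambda>(U, \<phi>). (U \<inter> W, \<phi>)) ` A"

definition product_atlas ::
    "('a, 'm) atlas \<Rightarrow> ('b, 'n) atlas \<Rightarrow> ('a \<times> 'b, 'm \<times> 'n) atlas"
  where "product_atlas A B = (\<lambda>((U, \<phi>), (V, \<psi>)). (U \<times> V, map_prod \<phi> \<psi>)) ` (A \<times> B)"


section \<open>Tangent vectors and derivatives\<close>

text \<open>A tangent vector at \<open>p\<close> is the family of its coordinate representations in the charts at
  \<open>p\<close>, related by the derivatives of the transition maps (and \<open>0\<close>, as a dummy value, elsewhere).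
  The base point is stored as the first component, so that \<^const>\<open>fst\<close> is the projection of the
  tangent bundle.\<close>

type_synonym ('a, 'm) tangent = "'a \<times> (('a, 'm) chart \<Rightarrow> 'm)"

definition tangent_space :: "('a, 'm::finite_dim_inner) atlas \<Rightarrow> 'a \<Rightarrow> ('a, 'm) tangent set"
  where "tangent_space A p = {(q, w). q = p \<and> (\<forall>c. c \<notin> charts_at A p \<longrightarrow> w c = 0) \<and>
    (\<forall>c\<in>charts_at A p. \<forall>d\<in>charts_at A p.
       w d = frechet_derivative (snd d \<circ> param c) (at (snd c p)) (w c))}"

definition tangent_atlas ::
    "('a, 'm::finite_dim_inner) atlas \<Rightarrow> (('a, 'm) tangent, 'm \<times> 'm) atlas"
  where "tangent_atlas A =
    (\<lambda>c. (\<Union>p\<in>fst c. tangent_space A p, \<lambda>(p, w). (snd c p, w c))) ` A"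

text \<open>The derivative \<open>Df: TA \<rightarrow> TB\<close>. The choice of the chart \<open>c\<close> is immaterial.\<close>

definition tangent_map ::
    "('a, 'm::finite_dim_inner) atlas \<Rightarrow> ('b, 'n::finite_dim_inner) atlas \<Rightarrow> ('a \<Rightarrow> 'b)
      \<Rightarrow> ('a, 'm) tangent \<Rightarrow> ('b, 'n) tangent"
  where "tangent_map A B f v = (let p = fst v; c = (SOME c. c \<in> charts_at A p) in
    (f p, \<lambda>d. if d \<in> charts_at B (f p)
              then frechet_derivative (snd d \<circ> f \<circ> param c) (at (snd c p)) (snd v c) else 0))"

text \<open>The derivative of a real function as a function \<open>TA \<rightarrow> \<real>\<close>, i.e. the second component of
  \<open>Df: TA \<rightarrow> T\<real> = \<real> \<times> \<real>\<close>.\<close>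

definition derivative_fun ::
    "('a, 'm::finite_dim_inner) atlas \<Rightarrow> ('a \<Rightarrow> real) \<Rightarrow> ('a, 'm) tangent \<Rightarrow> real"
  where "derivative_fun A f v = snd (tangent_map A model_atlas f v) (UNIV, \<lambda>x. x)"

definition velocity ::
    "('a, 'm::finite_dim_inner) atlas \<Rightarrow> (real \<Rightarrow> 'a) \<Rightarrow> real \<Rightarrow> ('a, 'm) tangent"
  where "velocity A \<gamma> t = (\<gamma> t, \<lambda>d. if d \<in> charts_at A (\<gamma> t)
    then vector_derivative (snd d \<circ> \<gamma>) (at t) else 0)"


section \<open>Vector bundles\<close>

text \<open>Fields \<open>fibre_add\<close> and \<open>fibre_scale\<close> are the fibrewise operations; the value of
  \<open>fibre_add\<close> at two points of different fibres is irrelevant.\<close>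

record ('a, 'm, 'e, 'n) vbundle =
  base :: "('a, 'm) atlas"
  total :: "('e, 'n) atlas"
  proj :: "'e \<Rightarrow> 'a"
  fibre_add :: "'e \<Rightarrow> 'e \<Rightarrow> 'e"
  fibre_scale :: "real \<Rightarrow> 'e \<Rightarrow> 'e"
  zero_section :: "'a \<Rightarrow> 'e"

definition fibre :: "('a, 'm, 'e, 'n) vbundle \<Rightarrow> 'a \<Rightarrow> 'e set"
  where "fibre E p = {e \<in> space_of (total E). proj E e = p}"

definition real_vector_space_on ::
    "'e set \<Rightarrow> ('e \<Rightarrow> 'e \<Rightarrow> 'e) \<Rightarrow> (real \<Rightarrow> 'e \<Rightarrow> 'e) \<Rightarrow> 'e \<Rightarrow> bool"
  where "real_vector_space_on V pl sc z \<longleftrightarrow>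
    z \<in> V \<and> (\<forall>x\<in>V. \<forall>y\<in>V. pl x y \<in> V) \<and> (\<forall>r. \<forall>x\<in>V. sc r x \<in> V) \<and>
    (\<forall>x\<in>V. \<forall>y\<in>V. \<forall>u\<in>V. pl (pl x y) u = pl x (pl y u)) \<and>
    (\<forall>x\<in>V. \<forall>y\<in>V. pl x y = pl y x) \<and>
    (\<forall>x\<in>V. pl z x = x) \<and> (\<forall>x\<in>V. \<exists>y\<in>V. pl x y = z) \<and>
    (\<forall>r. \<forall>x\<in>V. \<forall>y\<in>V. sc r (pl x y) = pl (sc r x) (sc r y)) \<and>
    (\<forall>r s. \<forall>x\<in>V. sc (r + s) x = pl (sc r x) (sc s x)) \<and>
    (\<forall>r s. \<forall>x\<in>V. sc r (sc s x) = sc (r * s) x) \<and> (\<forall>x\<in>V. sc 1 x = x)"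

definition local_trivialization ::
    "('a, 'm::finite_dim_inner, 'e, 'n::finite_dim_inner) vbundle \<Rightarrow> 'a set
      \<Rightarrow> ('e \<Rightarrow> 'f::finite_dim_inner) \<Rightarrow> bool"
  where "local_trivialization E U \<tau> \<longleftrightarrow>
    openin (manifold_topology (base E)) U \<and>
    diffeomorphism
      (restrict_atlas (total E) {e \<in> space_of (total E). proj E e \<in> U})
      (product_atlas (restrict_atlas (base E) U) model_atlas)
      (\<lambda>e. (proj E e, \<tau> e)) \<and>
    (\<forall>p\<in>U. \<forall>x\<in>fibre E p. (\<forall>y\<in>fibre E p. \<tau> (fibre_add E x y) = \<tau> x + \<tau> y) \<and>
       (\<forall>r. \<tau> (fibre_scale E r x) = r *\<^sub>R \<tau> x))"

text \<open>The type argument is the typical fibre.\<close>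

definition vector_bundle ::
    "'f::finite_dim_inner itself
      \<Rightarrow> ('a, 'm::finite_dim_inner, 'e, 'n::finite_dim_inner) vbundle \<Rightarrow> bool"
  where "vector_bundle F E \<longleftrightarrow>
    smooth_manifold (base E) \<and> smooth_manifold (total E) \<and>
    smooth_map (total E) (base E) (proj E) \<and>
    (\<forall>p\<in>space_of (base E). real_vector_space_on (fibre E p) (fibre_add E) (fibre_scale E)
       (zero_section E p)) \<and>
    (\<forall>p\<in>space_of (base E). \<exists>U (\<tau> :: 'e \<Rightarrow> 'f). p \<in> U \<and> local_trivialization E U \<tau>)"

definition bundle_morphism ::
    "('a, 'm::finite_dim_inner, 'e, 'n::finite_dim_inner) vbundle
      \<Rightarrow> ('b, 'k::finite_dim_inner, 'd, 'l::finite_dim_inner) vbundle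
      \<Rightarrow> ('e \<Rightarrow> 'd) \<Rightarrow> ('a \<Rightarrow> 'b) \<Rightarrow> bool"
  where "bundle_morphism E E' F f \<longleftrightarrow>
    smooth_map (total E) (total E') F \<and> smooth_map (base E) (base E') f \<and>
    (\<forall>x\<in>space_of (total E). proj E' (F x) = f (proj E x)) \<and>
    (\<forall>p\<in>space_of (base E). \<forall>x\<in>fibre E p.
       (\<forall>y\<in>fibre E p. F (fibre_add E x y) = fibre_add E' (F x) (F y)) \<and>
       (\<forall>r. F (fibre_scale E r x) = fibre_scale E' r (F x)))"

definition tangent_bundle ::
    "('a, 'm::finite_dim_inner) atlas \<Rightarrow> ('a, 'm, ('a, 'm) tangent, 'm \<times> 'm) vbundle"
  where "tangent_bundle A = \<lparr>base = A, total = tangent_atlas A, proj = fst,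
    fibre_add = (\<lambda>v w. (fst v, \<lambda>c. snd v c + snd w c)),
    fibre_scale = (\<lambda>r v. (fst v, \<lambda>c. r *\<^sub>R snd v c)),
    zero_section = (\<lambda>p. (p, \<lambda>c. 0))\<rparr>"

text \<open>The second vector bundle structure on \<open>TE\<close>, with projection \<open>D\<pi>: TE \<rightarrow> TM\<close>. Its
  operations are the derivatives of the operations of \<open>E\<close>. For the addition, a map on the fibre
  product \<open>E \<times>\<^sub>M E\<close>, the derivative is taken along curves: \<open>(\<nu>\<^sub>1, \<nu>\<^sub>2)\<close> with
  \<open>D\<pi>(\<nu>\<^sub>1) = D\<pi>(\<nu>\<^sub>2)\<close> is the velocity of a curve \<open>(\<gamma>\<^sub>1, \<gamma>\<^sub>2)\<close> in \<open>E \<times>\<^sub>M E\<close>, and its image is the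
  velocity of \<open>\<gamma>\<^sub>1 + \<gamma>\<^sub>2\<close>.\<close>

definition tangent_add ::
    "('a, 'm, 'e, 'n::finite_dim_inner) vbundle
      \<Rightarrow> ('e, 'n) tangent \<Rightarrow> ('e, 'n) tangent \<Rightarrow> ('e, 'n) tangent"
  where "tangent_add E \<nu>\<^sub>1 \<nu>\<^sub>2 = (THE \<nu>. \<exists>\<gamma>\<^sub>1 \<gamma>\<^sub>2.
    smooth_map model_atlas (total E) \<gamma>\<^sub>1 \<and> smooth_map model_atlas (total E) \<gamma>\<^sub>2 \<and>
    (\<forall>t. proj E (\<gamma>\<^sub>1 t) = proj E (\<gamma>\<^sub>2 t)) \<and>
    velocity (total E) \<gamma>\<^sub>1 0 = \<nu>\<^sub>1 \<and> velocity (total E) \<gamma>\<^sub>2 0 = \<nu>\<^sub>2 \<and>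
    velocity (total E) (\<lambda>t. fibre_add E (\<gamma>\<^sub>1 t) (\<gamma>\<^sub>2 t)) 0 = \<nu>)"

definition tangent_proj ::
    "('a, 'm::finite_dim_inner, 'e, 'n::finite_dim_inner) vbundle
      \<Rightarrow> ('e, 'n) tangent \<Rightarrow> ('a, 'm) tangent"
  where "tangent_proj E = tangent_map (total E) (base E) (proj E)"

definition tangent_zero ::
    "('a, 'm::finite_dim_inner, 'e, 'n::finite_dim_inner) vbundle
      \<Rightarrow> ('a, 'm) tangent \<Rightarrow> ('e, 'n) tangent"
  where "tangent_zero E = tangent_map (base E) (total E) (zero_section E)"

definition tangent_lift ::
    "('a, 'm::finite_dim_inner, 'e, 'n::finite_dim_inner) vbundle
      \<Rightarrow> (('a, 'm) tangent, 'm \<times> 'm, ('e, 'n) tangent, 'n \<times> 'n) vbundle"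
  where "tangent_lift E = \<lparr>base = tangent_atlas (base E), total = tangent_atlas (total E),
    proj = tangent_proj E, fibre_add = tangent_add E,
    fibre_scale = (\<lambda>r. tangent_map (total E) (total E) (fibre_scale E r)),
    zero_section = tangent_zero E\<rparr>"


section \<open>Metrics and connections\<close>

definition smooth_section ::
    "('a, 'm::finite_dim_inner, 'e, 'n::finite_dim_inner) vbundle \<Rightarrow> 'a set \<Rightarrow> ('a \<Rightarrow> 'e) \<Rightarrow> bool"
  where "smooth_section E W s \<longleftrightarrow>
    smooth_map (restrict_atlas (base E) W) (total E) s \<and> (\<forall>p\<in>W. proj E (s p) = p)"

definition bundle_metric ::
    "('a, 'm::finite_dim_inner, 'e, 'n::finite_dim_inner) vbundle \<Rightarrow> ('e \<Rightarrow> 'e \<Rightarrow> real) \<Rightarrow> bool"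
  where "bundle_metric E g \<longleftrightarrow>
    (\<forall>p\<in>space_of (base E). \<forall>x\<in>fibre E p.
       (\<forall>y\<in>fibre E p. g x y = g y x) \<and>
       (\<forall>y\<in>fibre E p. \<forall>z\<in>fibre E p. g (fibre_add E x y) z = g x z + g y z) \<and>
       (\<forall>r. \<forall>y\<in>fibre E p. g (fibre_scale E r x) y = r * g x y) \<and>
       (x \<noteq> zero_section E p \<longrightarrow> 0 < g x x)) \<and>
    (\<forall>W s t. openin (manifold_topology (base E)) W \<longrightarrow>
       smooth_section E W s \<longrightarrow> smooth_section E W t \<longrightarrow>
       smooth_map (restrict_atlas (base E) W) model_atlas (\<lambda>p. g (s p) (t p)))"

definition riemannian_metric ::
    "('a, 'm::finite_dim_inner) atlas \<Rightarrow> (('a, 'm) tangent \<Rightarrow> ('a, 'm) tangent \<Rightarrow> real) \<Rightarrow> bool"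
  where "riemannian_metric A g \<longleftrightarrow> bundle_metric (tangent_bundle A) g"

definition riemannian_manifold ::
    "('a, 'm::finite_dim_inner) atlas \<Rightarrow> (('a, 'm) tangent \<Rightarrow> ('a, 'm) tangent \<Rightarrow> real) \<Rightarrow> bool"
  where "riemannian_manifold A g \<longleftrightarrow> smooth_manifold A \<and> riemannian_metric A g"

definition vert :: "('a, 'm, 'e, 'n::finite_dim_inner) vbundle \<Rightarrow> 'e \<Rightarrow> 'e \<Rightarrow> ('e, 'n) tangent"
  where "vert E e \<eta> = velocity (total E) (\<lambda>t. fibre_add E e (fibre_scale E t \<eta>)) 0"

definition connection ::
    "('a, 'm::finite_dim_inner, 'e, 'n::finite_dim_inner) vbundle
      \<Rightarrow> (('e, 'n) tangent \<Rightarrow> 'e) \<Rightarrow> bool"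
  where "connection E K \<longleftrightarrow>
    bundle_morphism (tangent_bundle (total E)) E K (proj E) \<and>
    bundle_morphism (tangent_lift E) E K fst \<and>
    (\<forall>e\<in>space_of (total E). \<forall>\<eta>\<in>fibre E (proj E e). K (vert E e \<eta>) = \<eta>)"

definition metric_connection ::
    "('a, 'm::finite_dim_inner, 'e, 'n::finite_dim_inner) vbundle
      \<Rightarrow> ('e \<Rightarrow> 'e \<Rightarrow> real) \<Rightarrow> (('e, 'n) tangent \<Rightarrow> 'e) \<Rightarrow> bool"
  where "metric_connection E g K \<longleftrightarrow> connection E K \<and>
    (\<forall>\<nu>\<in>space_of (tangent_atlas (total E)).
       derivative_fun (total E) (\<lambda>e. g e e) \<nu> = 2 * g (K \<nu>) (fst \<nu>))"

text \<open>The bilinear form whose quadratic form is \<open>\<nu> \<mapsto> g\<^sub>M(D\<pi>(\<nu>)) + g\<^sub>E(K(\<nu>))\<close>.\<close>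

definition sasaki_metric ::
    "('a, 'm::finite_dim_inner, 'e, 'n::finite_dim_inner) vbundle
      \<Rightarrow> (('a, 'm) tangent \<Rightarrow> ('a, 'm) tangent \<Rightarrow> real) \<Rightarrow> ('e \<Rightarrow> 'e \<Rightarrow> real)
      \<Rightarrow> (('e, 'n) tangent \<Rightarrow> 'e) \<Rightarrow> ('e, 'n) tangent \<Rightarrow> ('e, 'n) tangent \<Rightarrow> real"
  where "sasaki_metric E gM gE K \<nu> \<nu>' =
    gM (tangent_proj E \<nu>) (tangent_proj E \<nu>') + gE (K \<nu>) (K \<nu>')"

text \<open>In the first inequality \<open>D\<pi>(\<nu>) \<in> TM\<close> is regarded as an element of \<open>TE\<close> through the
  derivative of the zero section.\<close>

definition strongly_concordant ::
    "('a, 'm::finite_dim_inner, 'e, 'n::finite_dim_inner) vbundle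
      \<Rightarrow> ('e \<Rightarrow> 'e \<Rightarrow> real) \<Rightarrow> (('e, 'n) tangent \<Rightarrow> ('e, 'n) tangent \<Rightarrow> real) \<Rightarrow> bool"
  where "strongly_concordant E g G \<longleftrightarrow>
    riemannian_metric (total E) G \<and>
    (\<forall>\<nu>\<in>space_of (tangent_atlas (total E)).
       G (tangent_zero E (tangent_proj E \<nu>)) (tangent_zero E (tangent_proj E \<nu>)) \<le> G \<nu> \<nu>) \<and>
    (\<exists>\<kappa>>0.
       (\<forall>\<nu>\<in>space_of (tangent_atlas (total E)).
          (inverse \<kappa> * derivative_fun (total E) (\<lambda>e. g e e) \<nu>)\<^sup>2
            \<le> 4 * g (fst \<nu>) (fst \<nu>) * G \<nu> \<nu>) \<and>
       (\<forall>e\<in>space_of (total E). G (vert E e e) (vert E e e) \<le> \<kappa>\<^sup>2 * g e e))"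

end

theory Submission
  imports Defs
begin

text \<open>The horizontal inequality and the two inequalities for \<open>Dg\<^sub>E\<close> and \<open>Vert\<^sub>e(e)\<close>, with
  \<open>\<kappa> = 1\<close>, are pointwise: a connection kills the image of \<open>TM\<close> in \<open>TE\<close>, Cauchy-Schwarz
  bounds \<open>Dg\<^sub>E(\<nu>)\<^sup>2 = 4 g\<^sub>E(K\<nu>, e)\<^sup>2\<close>, and \<open>D\<pi>(Vert\<^sub>e(e)) = 0\<close> while \<open>K(Vert\<^sub>e(e)) = e\<close>.
  The rest is that the Sasaki metric is Riemannian. It is definite because the kernel of \<open>D\<pi>\<close>
  consists of vertical lifts, from which \<open>K\<close> recovers the lifted vector. It is smooth because a
  bundle metric, whose smoothness is only given along smooth sections, is a combination with smooth
  coefficients of its values on a smooth local frame; this applies to \<open>g\<^sub>M\<close> along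
  \<open>D\<pi> \<circ> s\<close> and to \<open>g\<^sub>E\<close> along \<open>K \<circ> s\<close>, which are not sections.\<close>

section \<open>Calculus of smooth maps\<close>

text \<open>Two encodings shape the work. Smoothness is defined through derivatives in fixed
  directions, whereas the chain rule and the derivative of a map applied to a vector field produce
  derivatives in directions that move with the point; expanding those directions in a finite
  orthonormal basis of the model space reduces the second kind to the first. Atlases are not
  maximal, so a chart cannot be shrunk to fit a given neighbourhood; smoothness is therefore recast
  at single points, with neighbourhoods chosen in coordinates.

  The geometric core is the derivative of a local trivialization. It splits a vector tangent to
  \<open>E\<close> into its image under \<open>D\<pi>\<close> and the derivative of the fibre
  coordinate. A vertical lift has components \<open>(0, \<tau> \<eta>)\<close>, and invertibility of
  the trivialization shows that every vector with vanishing first component is such a lift.\<close>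

text \<open>Gram-Schmidt: a new vector contributes its normalised residual against the set built so
  far, or nothing if the residual vanishes.\<close>

lemma orthonormal_set_spanning:
  fixes B :: "'a::real_inner set"
  assumes "finite B"
  shows "\<exists>C. finite C \<and> (\<forall>c\<in>C. \<forall>d\<in>C. c \<bullet> d = (if c = d then 1 else 0)) \<and> B \<subseteq> span C"
  using assms
proof (induction B rule: finite_induct)
  case empty
  show ?case by (rule exI[of _ "{}"]) simp
next
  case (insert a B)
  then obtain C where C: "finite C" "\<forall>c\<in>C. \<forall>d\<in>C. c \<bullet> d = (if c = d then 1 else 0)" "B \<subseteq> span C"
    by blast
  define r where "r = a - (\<Sum>c\<in>C. (a \<bullet> c) *\<^sub>R c)"
  have sum_span: "(\<Sum>c\<in>C. (a \<bullet> c) *\<^sub>R c) \<in> span C"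
    by (intro span_sum span_scale span_base)
  have orth: "r \<bullet> d = 0" if "d \<in> C" for d
  proof -
    have "(\<Sum>c\<in>C. (a \<bullet> c) * (c \<bullet> d)) = (\<Sum>c\<in>C. if c = d then a \<bullet> d else 0)"
      by (rule sum.cong) (use C(2) that in auto)
    also have "\<dots> = a \<bullet> d" using C(1) that by (simp add: sum.delta)
    finally show ?thesis by (simp add: r_def inner_diff_left inner_sum_left)
  qed
  show ?case
  proof (cases "r = 0")
    case True
    then have "a \<in> span C" using sum_span by (simp add: r_def)
    then show ?thesis using C by blast
  next
    case False
    define e where "e = r /\<^sub>R norm r"
    have e1: "e \<bullet> e = 1" using False by (simp add: e_def dot_square_norm power2_eq_square)
    have e0: "e \<bullet> d = 0" "d \<bullet> e = 0" if "d \<in> C" for d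
      using orth[OF that] by (simp_all add: e_def inner_commute)
    have "e \<notin> C" using e0 e1 by force
    have "r = norm r *\<^sub>R e" using False by (simp add: e_def)
    then have "r \<in> span (insert e C)" by (metis insertI1 span_base span_scale)
    moreover have "(\<Sum>c\<in>C. (a \<bullet> c) *\<^sub>R c) \<in> span (insert e C)"
      using sum_span by (meson span_mono subsetD subset_insertI)
    ultimately have "r + (\<Sum>c\<in>C. (a \<bullet> c) *\<^sub>R c) \<in> span (insert e C)"
      by (rule span_add)
    then have "a \<in> span (insert e C)" by (simp add: r_def)
    moreover have "B \<subseteq> span (insert e C)"
      using C(3) by (meson order_trans span_mono subset_insertI)
    ultimately show ?thesis
      using C(1,2) e0 e1 \<open>e \<notin> C\<close> by (intro exI[of _ "insert e C"]) auto
  qed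
qed

lemma orthonormal_basis_exists:
  "\<exists>B :: 'a::finite_dim_inner set. finite B \<and> (\<forall>x. (\<Sum>b\<in>B. (x \<bullet> b) *\<^sub>R b) = x)"
proof -
  obtain B0 :: "'a set" where B0: "finite B0" "span B0 = UNIV" using finite_span_UNIV by blast
  obtain B where B: "finite B" "\<forall>c\<in>B. \<forall>d\<in>B. c \<bullet> d = (if c = d then 1 else 0)"
      "B0 \<subseteq> span B"
    using orthonormal_set_spanning[OF B0(1)] by (elim exE conjE)
  have "x \<in> span B" for x
    using B0(2) B(3) by (metis UNIV_I span_mono span_span subsetD)
  moreover have "(\<Sum>b\<in>B. (x \<bullet> b) *\<^sub>R b) = x" if "x \<in> span B" for x
    using that
  proof (induction rule: span_induct_alt)
    case base
    show ?case by simp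
  next
    case (step r y z)
    have "(\<Sum>b\<in>B. (y \<bullet> b) *\<^sub>R b) = (\<Sum>b\<in>B. if y = b then b else 0)"
      by (rule sum.cong) (use B(2) step(1) in auto)
    also have "\<dots> = y" using B(1) step(1) by simp
    finally show ?case using step(2)
      by (simp add: inner_add_left scaleR_add_left sum.distrib flip: scaleR_scaleR scaleR_sum_right)
  qed
  ultimately show ?thesis using B(1) by blast
qed

text \<open>Characterised by finiteness and the expansion identity rather than by orthonormality, so
  that coordinates are immediately available; in dimension zero the empty set qualifies.\<close>

definition onb :: "'a::finite_dim_inner set"
  where "onb = (SOME B. finite B \<and> (\<forall>x. (\<Sum>b\<in>B. (x \<bullet> b) *\<^sub>R b) = x))"

lemma onb_expand:
  fixes x :: "'a::finite_dim_inner"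
  shows "(\<Sum>b\<in>onb. (x \<bullet> b) *\<^sub>R b) = x"
  using someI_ex[OF orthonormal_basis_exists[where 'a='a]] by (simp_all add: onb_def)

lemma linear_onb_expand:
  fixes x :: "'a::finite_dim_inner"
  assumes "linear f"
  shows "f x = (\<Sum>b\<in>onb. (x \<bullet> b) *\<^sub>R f b)"
proof -
  have "f x = f (\<Sum>b\<in>onb. (x \<bullet> b) *\<^sub>R b)" by (simp add: onb_expand)
  then show ?thesis by (simp add: assms linear_sum linear_cmul)
qed

section \<open>Frechet derivatives on open sets\<close>

lemma frechet_derivative_eqI: "(f has_derivative f') (at x) \<Longrightarrow> frechet_derivative f (at x) v = f' v"
  by (metis frechet_derivative_at)

lemma has_derivative_frechet:
  "f differentiable at x \<Longrightarrow> (f has_derivative frechet_derivative f (at x)) (at x)"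
  by (simp add: frechet_derivative_works)

lemma frechet_linear_onb_expand:
  fixes v :: "'a::finite_dim_inner"
  assumes "f differentiable at x"
  shows "frechet_derivative f (at x) v = (\<Sum>b\<in>onb. (v \<bullet> b) *\<^sub>R frechet_derivative f (at x) b)"
  using assms by (intro linear_onb_expand) (simp add: linear_frechet_derivative)

lemma differentiable_cong_open:
  assumes "open S" "x \<in> S" "\<And>y. y \<in> S \<Longrightarrow> f y = g y"
  shows "f differentiable (at x) \<longleftrightarrow> g differentiable (at x)"
  unfolding differentiable_def
  using has_derivative_transform_within_open[of _ _ x UNIV S] assms by metis

lemma frechet_derivative_cong_open:
  assumes "open S" "x \<in> S" "\<And>y. y \<in> S \<Longrightarrow> f y = g y"
  shows "frechet_derivative f (at x) = frechet_derivative g (at x)"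
proof -
  have "(f has_derivative D) (at x) \<longleftrightarrow> (g has_derivative D) (at x)" for D
    using has_derivative_transform_within_open[of _ _ x UNIV S] assms by metis
  then show ?thesis unfolding frechet_derivative_def by simp
qed

section \<open>Closure properties of the classes C^k\<close>

text \<open>A derivative at \<open>x\<close> depends on the values near \<open>x\<close>; openness
  of \<open>S\<close> ensures that these are values on \<open>S\<close>, so the agreement passes to
  all derivatives.\<close>

lemma Ck_on_cong:
  assumes "open S" "\<And>x. x \<in> S \<Longrightarrow> f x = g x"
  shows "Ck_on k f S \<longleftrightarrow> Ck_on k g S"
  using assms(2)
proof (induction k arbitrary: f g)
  case 0
  then show ?case by (simp cong: continuous_on_cong)
next
  case (Suc k)
  have "f differentiable (at x) \<longleftrightarrow> g differentiable (at x)" if "x \<in> S" for x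
    using differentiable_cong_open[OF assms(1) that, of f g] Suc.prems by blast
  moreover have "Ck_on k (\<lambda>x. frechet_derivative f (at x) v) S \<longleftrightarrow>
      Ck_on k (\<lambda>x. frechet_derivative g (at x) v) S" for v
    using frechet_derivative_cong_open[OF assms(1), of _ f g] Suc.prems by (intro Suc.IH) metis
  ultimately show ?case by simp
qed

lemma Ck_on_subset: "Ck_on k f S \<Longrightarrow> T \<subseteq> S \<Longrightarrow> Ck_on k f T"
  by (induction k arbitrary: f) (auto intro: continuous_on_subset)

lemma Ck_on_Suc_imp: "Ck_on (Suc k) f S \<Longrightarrow> Ck_on k f S"
proof (induction k arbitrary: f)
  case 0
  then show ?case
    by (auto simp: differentiable_imp_continuous_within intro!: continuous_at_imp_continuous_on)
next
  case (Suc k)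
  then show ?case by (metis Ck_on.simps(2))
qed

lemma Ck_on_local:
  assumes "open S" "\<And>x. x \<in> S \<Longrightarrow> \<exists>T. open T \<and> x \<in> T \<and> Ck_on k f T"
  shows "Ck_on k f S"
  using assms(2)
proof (induction k arbitrary: f)
  case 0
  then show ?case
    using assms(1) by (auto simp: continuous_on_eq_continuous_at) (meson continuous_on_eq_continuous_at)
next
  case (Suc k)
  have "f differentiable (at x)" if "x \<in> S" for x
    using Suc.prems[OF that] by auto
  moreover have "Ck_on k (\<lambda>x. frechet_derivative f (at x) v) S" for v
    using Suc.prems by (intro Suc.IH) fastforce
  ultimately show ?case by simp
qed

lemma Ck_on_const: "Ck_on k (\<lambda>x. c) S"
  by (induction k arbitrary: c) auto

lemma Ck_on_linear:
  assumes "bounded_linear h" "open S" "Ck_on k f S"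
  shows "Ck_on k (\<lambda>x. h (f x)) S"
  using assms(3)
proof (induction k arbitrary: f)
  case 0
  then show ?case using assms(1) by (auto intro: bounded_linear.continuous_on)
next
  case (Suc k)
  have *: "((\<lambda>x. h (f x)) has_derivative (\<lambda>v. h (frechet_derivative f (at x) v))) (at x)"
    if "x \<in> S" for x
    using Suc.prems that
    by (intro bounded_linear.has_derivative[OF assms(1)] has_derivative_frechet) auto
  have "Ck_on k (\<lambda>x. frechet_derivative (\<lambda>x. h (f x)) (at x) v) S" for v
    using Suc.IH[of "\<lambda>x. frechet_derivative f (at x) v"] Suc.prems
    by (subst Ck_on_cong[OF assms(2) frechet_derivative_eqI[OF *]]) auto
  then show ?case using * by (auto simp: differentiable_def)
qed

lemma Ck_on_add:
  assumes "open S" "Ck_on k f S" "Ck_on k g S"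
  shows "Ck_on k (\<lambda>x. f x + g x) S"
  using assms(2,3)
proof (induction k arbitrary: f g)
  case 0
  then show ?case by (auto intro: continuous_on_add)
next
  case (Suc k)
  have *: "((\<lambda>x. f x + g x) has_derivative
      (\<lambda>v. frechet_derivative f (at x) v + frechet_derivative g (at x) v)) (at x)"
    if "x \<in> S" for x
    using Suc.prems that by (intro has_derivative_add has_derivative_frechet) auto
  have "Ck_on k (\<lambda>x. frechet_derivative (\<lambda>x. f x + g x) (at x) v) S" for v
    using Suc.IH[of "\<lambda>x. frechet_derivative f (at x) v" "\<lambda>x. frechet_derivative g (at x) v"]
      Suc.prems
    by (subst Ck_on_cong[OF assms(1) frechet_derivative_eqI[OF *]]) auto
  then show ?case using * by (auto simp: differentiable_def)
qed

lemma Ck_on_scaleR: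
  assumes "open S" "Ck_on k f S" "Ck_on k g S"
  shows "Ck_on k (\<lambda>x. f x *\<^sub>R g x) S"
  using assms(2,3)
proof (induction k arbitrary: f g)
  case 0
  then show ?case by (auto intro: continuous_on_scaleR)
next
  case (Suc k)
  have *: "((\<lambda>x. f x *\<^sub>R g x) has_derivative
      (\<lambda>v. f x *\<^sub>R frechet_derivative g (at x) v + frechet_derivative f (at x) v *\<^sub>R g x)) (at x)"
    if "x \<in> S" for x
    using Suc.prems that by (intro has_derivative_scaleR has_derivative_frechet) auto
  have "Ck_on k (\<lambda>x. frechet_derivative (\<lambda>x. f x *\<^sub>R g x) (at x) v) S" for v
  proof (subst Ck_on_cong[OF assms(1) frechet_derivative_eqI[OF *]])
    \<comment> \<open>The product rule leaves one factor undifferentiated in each term; that factor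
      is of class k+1 and is lowered to class k by \<open>Ck_on_Suc_imp\<close>.\<close>
    show "Ck_on k (\<lambda>x. f x *\<^sub>R frechet_derivative g (at x) v
        + frechet_derivative f (at x) v *\<^sub>R g x) S"
      using Suc.prems Suc.prems[THEN Ck_on_Suc_imp]
      by (intro Ck_on_add[OF assms(1)] Suc.IH) auto
  qed auto
  then show ?case using * by (auto simp: differentiable_def)
qed

lemma Ck_on_sum:
  assumes "open S" "\<And>i. i \<in> I \<Longrightarrow> Ck_on k (f i) S"
  shows "Ck_on k (\<lambda>x. \<Sum>i\<in>I. f i x) S"
  using assms(2)
  by (induction I rule: infinite_finite_induct) (auto intro: Ck_on_const Ck_on_add[OF assms(1)])

lemma Ck_on_Pair:
  assumes "open S" "Ck_on k f S" "Ck_on k g S"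
  shows "Ck_on k (\<lambda>x. (f x, g x)) S"
proof -
  have "Ck_on k (\<lambda>x. (f x, 0) + (0, g x)) S"
    by (intro Ck_on_add[OF assms(1)]
      Ck_on_linear[OF _ assms(1,2), of "\<lambda>u. (u, 0)"] Ck_on_linear[OF _ assms(1,3), of "\<lambda>u. (0, u)"]
      bounded_linear_Pair bounded_linear_ident bounded_linear_zero)
  then show ?thesis by simp
qed

text \<open>By the chain rule the derivative is \<open>Dg\<close> at \<open>f x\<close> applied to a
  vector that varies with \<open>x\<close>, while the hypothesis on \<open>g\<close> concerns fixed
  directions only. Expanding the vector over \<open>onb\<close> yields a finite sum of scalar
  coefficients times directional derivatives of \<open>g\<close> composed with \<open>f\<close>, to
  which the product rule and the induction hypothesis apply. This is why the middle space is
  finite-dimensional.\<close>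

lemma Ck_on_compose:
  fixes f :: "'a::real_normed_vector \<Rightarrow> 'b::finite_dim_inner"
  assumes "open S" "open T" "f ` S \<subseteq> T" "Ck_on k f S" "Ck_on k g T"
  shows "Ck_on k (\<lambda>x. g (f x)) S"
  using assms(4,5)
proof (induction k arbitrary: g)
  case 0
  then show ?case using assms(3) by (auto intro: continuous_on_compose2)
next
  case (Suc k)
  have "((\<lambda>x. g (f x)) has_derivative
      (\<lambda>v. frechet_derivative g (at (f x)) (frechet_derivative f (at x) v))) (at x)"
    if "x \<in> S" for x
    using Suc.prems that assms(3)
    by (intro has_derivative_compose[where f=f and g=g] has_derivative_frechet) auto
  then have *: "((\<lambda>x. g (f x)) has_derivative
      (\<lambda>v. \<Sum>b\<in>onb. (frechet_derivative f (at x) v \<bullet> b) *\<^sub>R frechet_derivative g (at (f x)) b)) (at x)"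
    if "x \<in> S" for x
    using that Suc.prems assms(3)
    by (subst frechet_linear_onb_expand[symmetric]) auto
  have "Ck_on k (\<lambda>x. frechet_derivative (\<lambda>x. g (f x)) (at x) v) S" for v
  proof (subst Ck_on_cong[OF assms(1) frechet_derivative_eqI[OF *]])
    have 1: "Ck_on k (\<lambda>x. frechet_derivative f (at x) v \<bullet> b) S" for b
      using Suc.prems by (intro Ck_on_linear[OF bounded_linear_inner_left assms(1)]) auto
    have 2: "Ck_on k (\<lambda>x. frechet_derivative g (at (f x)) b) S" for b
      using Suc.prems Ck_on_Suc_imp[OF Suc.prems(1)]
      by (intro Suc.IH[of "\<lambda>y. frechet_derivative g (at y) b"]) simp_all
    show "Ck_on k (\<lambda>x. \<Sum>b\<in>onb.
        (frechet_derivative f (at x) v \<bullet> b) *\<^sub>R frechet_derivative g (at (f x)) b) S"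
      by (intro Ck_on_sum[OF assms(1)] Ck_on_scaleR[OF assms(1)] 1 2)
  qed auto
  then show ?case using * by (auto simp: differentiable_def)
qed

section \<open>Smooth functions on open subsets of a model space\<close>

lemma smooth_on_differentiable: "smooth_on f S \<Longrightarrow> x \<in> S \<Longrightarrow> f differentiable at x"
  unfolding smooth_on_def by (metis Ck_on.simps(2))

lemma smooth_on_continuous: "smooth_on f S \<Longrightarrow> continuous_on S f"
  unfolding smooth_on_def by (metis Ck_on.simps(1))

lemma smooth_on_frechet_derivative:
  "smooth_on f S \<Longrightarrow> smooth_on (\<lambda>x. frechet_derivative f (at x) v) S"
  unfolding smooth_on_def by (metis Ck_on.simps(2))

lemma smooth_on_subset: "smooth_on f S \<Longrightarrow> T \<subseteq> S \<Longrightarrow> smooth_on f T"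
  unfolding smooth_on_def using Ck_on_subset by blast

lemma smooth_on_cong:
  "open S \<Longrightarrow> (\<And>x. x \<in> S \<Longrightarrow> f x = g x) \<Longrightarrow> smooth_on f S \<longleftrightarrow> smooth_on g S"
  unfolding smooth_on_def using Ck_on_cong[of S f g] by simp

lemma smooth_on_local:
  assumes "open S" "\<And>x. x \<in> S \<Longrightarrow> \<exists>T. open T \<and> x \<in> T \<and> smooth_on f T"
  shows "smooth_on f S"
  unfolding smooth_on_def
proof
  fix k
  show "Ck_on k f S"
    using assms(2) unfolding smooth_on_def by (intro Ck_on_local[OF assms(1)]) blast
qed

lemma smooth_on_const: "smooth_on (\<lambda>x. c) S"
  by (simp add: smooth_on_def Ck_on_const)

lemma smooth_on_linear:
  "bounded_linear h \<Longrightarrow> open S \<Longrightarrow> smooth_on f S \<Longrightarrow> smooth_on (\<lambda>x. h (f x)) S"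
  by (simp add: smooth_on_def Ck_on_linear)

lemma smooth_on_add:
  "open S \<Longrightarrow> smooth_on f S \<Longrightarrow> smooth_on g S \<Longrightarrow> smooth_on (\<lambda>x. f x + g x) S"
  by (simp add: smooth_on_def Ck_on_add)

lemma smooth_on_scaleR:
  "open S \<Longrightarrow> smooth_on f S \<Longrightarrow> smooth_on g S \<Longrightarrow> smooth_on (\<lambda>x. f x *\<^sub>R g x) S"
  by (simp add: smooth_on_def Ck_on_scaleR)

lemma smooth_on_sum:
  "open S \<Longrightarrow> (\<And>i. i \<in> I \<Longrightarrow> smooth_on (f i) S) \<Longrightarrow> smooth_on (\<lambda>x. \<Sum>i\<in>I. f i x) S"
  by (simp add: smooth_on_def Ck_on_sum)

lemma smooth_on_Pair:
  "open S \<Longrightarrow> smooth_on f S \<Longrightarrow> smooth_on g S \<Longrightarrow> smooth_on (\<lambda>x. (f x, g x)) S"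
  by (simp add: smooth_on_def Ck_on_Pair)

lemma smooth_on_compose:
  fixes f :: "'a::real_normed_vector \<Rightarrow> 'b::finite_dim_inner"
  shows "open S \<Longrightarrow> open T \<Longrightarrow> f ` S \<subseteq> T \<Longrightarrow> smooth_on f S \<Longrightarrow> smooth_on g T \<Longrightarrow>
    smooth_on (\<lambda>x. g (f x)) S"
  by (simp add: smooth_on_def Ck_on_compose)

text \<open>The direction \<open>u x\<close> may vary with the point, as happens when a derivative
  is applied to a vector field in coordinates; the expansion over \<open>onb\<close> makes it a
  combination of fixed directions.\<close>

lemma smooth_on_frechet_derivative_apply:
  fixes f :: "'a::finite_dim_inner \<Rightarrow> 'b::real_normed_vector"
  assumes "open S" "smooth_on f S" "smooth_on u S"
  shows "smooth_on (\<lambda>x. frechet_derivative f (at x) (u x)) S"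
proof (subst smooth_on_cong[OF assms(1) frechet_linear_onb_expand])
  show "smooth_on (\<lambda>x. \<Sum>b\<in>onb. (u x \<bullet> b) *\<^sub>R frechet_derivative f (at x) b) S"
    using assms by (intro smooth_on_sum smooth_on_scaleR smooth_on_frechet_derivative
      smooth_on_linear[OF bounded_linear_inner_left])
qed (use assms smooth_on_differentiable in auto)

section \<open>Pointwise smoothness\<close>

text \<open>Most lemmas on charts only need injectivity, which, unlike \<^const>\<open>smooth_atlas\<close>, passes
  trivially to restrictions, products and tangent atlases.\<close>

definition inj_atlas :: "('a, 'm) atlas \<Rightarrow> bool"
  where "inj_atlas A \<longleftrightarrow> (\<forall>c\<in>A. inj_on (snd c) (fst c))"

text \<open>Asking only for some neighbourhood inside the coordinate domain, instead of openness of
  the whole domain as in \<open>smooth_map\<close>, lets neighbourhoods be intersected and shrunk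
  freely.\<close>

definition smooth_at ::
    "('a, 'm::finite_dim_inner) atlas \<Rightarrow> ('b, 'n::finite_dim_inner) atlas \<Rightarrow> ('a \<Rightarrow> 'b) \<Rightarrow> 'a \<Rightarrow> bool"
  where "smooth_at A B f p \<longleftrightarrow> p \<in> space_of A \<and> f p \<in> space_of B \<and>
    (\<forall>c\<in>charts_at A p. \<forall>d\<in>charts_at B (f p). \<exists>S. open S \<and> snd c p \<in> S \<and>
       S \<subseteq> snd c ` (fst c \<inter> f -` fst d) \<and> smooth_on (snd d \<circ> f \<circ> param c) S)"

lemma charts_atD: "c \<in> charts_at A p \<Longrightarrow> c \<in> A" "c \<in> charts_at A p \<Longrightarrow> p \<in> fst c"
  by (simp_all add: charts_at_def)

lemma charts_atI: "c \<in> A \<Longrightarrow> p \<in> fst c \<Longrightarrow> c \<in> charts_at A p"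
  by (simp add: charts_at_def)

lemma space_of_charts_at: "p \<in> space_of A \<longleftrightarrow> charts_at A p \<noteq> {}"
  unfolding space_of_def charts_at_def by blast

lemma charts_at_space: "c \<in> charts_at A p \<Longrightarrow> p \<in> space_of A"
  by (auto simp: space_of_charts_at)

lemma smooth_atlas_inj: "smooth_atlas A \<Longrightarrow> inj_atlas A"
  by (simp add: smooth_atlas_def inj_atlas_def)

lemma smooth_atlas_open: "smooth_atlas A \<Longrightarrow> c \<in> A \<Longrightarrow> open (snd c ` fst c)"
  by (simp add: smooth_atlas_def)

lemma open_of_chart: "open_of A V \<Longrightarrow> c \<in> A \<Longrightarrow> open (snd c ` (V \<inter> fst c))"
  by (simp add: open_of_def)

lemma param_coord: "inj_atlas A \<Longrightarrow> c \<in> A \<Longrightarrow> q \<in> fst c \<Longrightarrow> param c (snd c q) = q"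
  by (simp add: inj_atlas_def param_def)

lemma coord_inj:
  "inj_atlas A \<Longrightarrow> c \<in> A \<Longrightarrow> q \<in> fst c \<Longrightarrow> r \<in> fst c \<Longrightarrow> snd c q = snd c r \<Longrightarrow> q = r"
  by (metis param_coord)

lemma param_coord_at: "inj_atlas A \<Longrightarrow> c \<in> charts_at A p \<Longrightarrow> param c (snd c p) = p"
  by (simp add: charts_at_def param_coord)

lemma smooth_map_smooth_at: "smooth_map A B f \<Longrightarrow> p \<in> space_of A \<Longrightarrow> smooth_at A B f p"
  unfolding smooth_map_def smooth_at_def charts_at_def by fast

text \<open>Both openness of a coordinate domain and smoothness on it are local, so the
  neighbourhoods at the single points glue.\<close>

lemma smooth_map_iff_smooth_at: "smooth_map A B f \<longleftrightarrow> (\<forall>p\<in>space_of A. smooth_at A B f p)"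
proof
  assume *: "\<forall>p\<in>space_of A. smooth_at A B f p"
  have "open (snd c ` (fst c \<inter> f -` fst d)) \<and>
      smooth_on (snd d \<circ> f \<circ> param c) (snd c ` (fst c \<inter> f -` fst d))"
    if cd: "c \<in> A" "d \<in> B" for c d
  proof -
    let ?T = "snd c ` (fst c \<inter> f -` fst d)"
    have loc: "\<exists>S. open S \<and> x \<in> S \<and> S \<subseteq> ?T \<and> smooth_on (snd d \<circ> f \<circ> param c) S"
      if x: "x \<in> ?T" for x
    proof -
      obtain p where p: "p \<in> fst c" "f p \<in> fst d" "x = snd c p" using x by blast
      have cd': "c \<in> charts_at A p" "d \<in> charts_at B (f p)" using cd p by (simp_all add: charts_at_def)
      have "smooth_at A B f p" using * charts_at_space[OF cd'(1)] by simp
      then show ?thesis using cd' unfolding p(3) smooth_at_def by simp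
    qed
    have "open ?T" unfolding open_subopen[of ?T] using loc by meson
    moreover from this have "smooth_on (snd d \<circ> f \<circ> param c) ?T"
      by (rule smooth_on_local) (use loc in meson)
    ultimately show ?thesis ..
  qed
  then show "smooth_map A B f"
    using * by (auto simp: smooth_map_def smooth_at_def)
qed (simp add: smooth_map_smooth_at)

text \<open>Working form of the definition: injectivity of the chart turns membership in an image
  set into statements about \<open>param c x\<close>, which is how coordinate expressions are
  computed.\<close>

lemma smooth_atE:
  assumes "smooth_at A B f p" "inj_atlas A" "c \<in> charts_at A p" "d \<in> charts_at B (f p)"
  obtains S where "open S" "snd c p \<in> S" "smooth_on (snd d \<circ> f \<circ> param c) S"
    "\<And>x. x \<in> S \<Longrightarrow> param c x \<in> fst c \<and> snd c (param c x) = x \<and> f (param c x) \<in> fst d"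
proof -
  obtain S where S: "open S" "snd c p \<in> S" "S \<subseteq> snd c ` (fst c \<inter> f -` fst d)"
      "smooth_on (snd d \<circ> f \<circ> param c) S"
    using assms unfolding smooth_at_def by blast
  have "param c x \<in> fst c \<and> snd c (param c x) = x \<and> f (param c x) \<in> fst d"
    if x: "x \<in> S" for x
  proof -
    obtain q where "q \<in> fst c" "f q \<in> fst d" "x = snd c q" using S(3) x by blast
    then show ?thesis using param_coord[OF assms(2) charts_atD(1)[OF assms(3)]] by simp
  qed
  then show ?thesis using that S by blast
qed

lemma smooth_atI:
  assumes "p \<in> space_of A" "f p \<in> space_of B"
    and "\<And>c d. c \<in> charts_at A p \<Longrightarrow> d \<in> charts_at B (f p) \<Longrightarrow>
      \<exists>S. open S \<and> snd c p \<in> S \<and> smooth_on (snd d \<circ> f \<circ> param c) S \<and>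
        (\<forall>x\<in>S. param c x \<in> fst c \<and> snd c (param c x) = x \<and> f (param c x) \<in> fst d)"
  shows "smooth_at A B f p"
proof -
  have "S \<subseteq> snd c ` (fst c \<inter> f -` fst d)"
    if "\<forall>x\<in>S. param c x \<in> fst c \<and> snd c (param c x) = x \<and> f (param c x) \<in> fst d" for S c d
    using that by force
  then show ?thesis using assms unfolding smooth_at_def by meson
qed

lemma smooth_at_space: "smooth_at A B f p \<Longrightarrow> p \<in> space_of A"
  "smooth_at A B f p \<Longrightarrow> f p \<in> space_of B"
  by (simp_all add: smooth_at_def)

lemma open_preimage:
  assumes "smooth_on \<phi> S" "open S" "open T"
  shows "open {x \<in> S. \<phi> x \<in> T}"
proof -
  have "open (S \<inter> \<phi> -` T)"
    using continuous_on_open_vimage[OF assms(2)] smooth_on_continuous[OF assms(1)] assms(3)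
    by (metis Int_commute)
  moreover have "S \<inter> \<phi> -` T = {x \<in> S. \<phi> x \<in> T}" by blast
  ultimately show ?thesis by simp
qed

lemma smooth_at_compose:
  assumes f: "smooth_at A B f p" and g: "smooth_at B C g (f p)"
    and A: "inj_atlas A" and B: "inj_atlas B"
  shows "smooth_at A C (\<lambda>q. g (f q)) p"
proof (rule smooth_atI)
  fix c e assume c: "c \<in> charts_at A p" and e: "e \<in> charts_at C (g (f p))"
  obtain d where d: "d \<in> charts_at B (f p)" using smooth_at_space(2)[OF f] by (auto simp: space_of_charts_at)
  obtain S where S: "open S" "snd c p \<in> S" "smooth_on (snd d \<circ> f \<circ> param c) S"
      "\<And>x. x \<in> S \<Longrightarrow> param c x \<in> fst c \<and> snd c (param c x) = x \<and> f (param c x) \<in> fst d"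
    using smooth_atE[OF f A c d] by blast
  obtain T where T: "open T" "snd d (f p) \<in> T" "smooth_on (snd e \<circ> g \<circ> param d) T"
      "\<And>x. x \<in> T \<Longrightarrow> param d x \<in> fst d \<and> snd d (param d x) = x \<and> g (param d x) \<in> fst e"
    using smooth_atE[OF g B d e] by blast
  \<comment> \<open>The points near \<open>p\<close> whose image lies where \<open>g\<close> is
    controlled; there the intermediate chart \<open>d\<close> cancels.\<close>
  define R where "R = {x \<in> S. (snd d \<circ> f \<circ> param c) x \<in> T}"
  have R: "open R" unfolding R_def by (rule open_preimage[OF S(3,1) T(1)])
  have "param c (snd c p) = p" by (rule param_coord_at[OF A c])
  then have "snd c p \<in> R" using S(2) T(2) by (simp add: R_def)
  have eq: "param d (snd d (f (param c x))) = f (param c x)" if "x \<in> R" for x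
    using param_coord[OF B charts_atD(1)[OF d]] S(4) that by (simp add: R_def)
  have "smooth_on (\<lambda>x. (snd e \<circ> g \<circ> param d) ((snd d \<circ> f \<circ> param c) x)) R"
    by (rule smooth_on_compose[OF R T(1) _ smooth_on_subset[OF S(3)] T(3)]) (auto simp: R_def)
  then have "smooth_on (snd e \<circ> (\<lambda>q. g (f q)) \<circ> param c) R"
    by (subst smooth_on_cong[OF R, of _ "\<lambda>x. (snd e \<circ> g \<circ> param d) ((snd d \<circ> f \<circ> param c) x)"])
      (simp_all add: eq)
  moreover have "\<forall>x\<in>R. param c x \<in> fst c \<and> snd c (param c x) = x \<and> g (f (param c x)) \<in> fst e"
  proof
    fix x assume x: "x \<in> R"
    then have "x \<in> S" "snd d (f (param c x)) \<in> T" by (simp_all add: R_def)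
    then show "param c x \<in> fst c \<and> snd c (param c x) = x \<and> g (f (param c x)) \<in> fst e"
      using S(4) T(4) eq[OF x] by metis
  qed
  ultimately show "\<exists>S. open S \<and> snd c p \<in> S \<and> smooth_on (snd e \<circ> (\<lambda>q. g (f q)) \<circ> param c) S \<and>
      (\<forall>x\<in>S. param c x \<in> fst c \<and> snd c (param c x) = x \<and> g (f (param c x)) \<in> fst e)"
    using R \<open>snd c p \<in> R\<close> by blast
qed (use smooth_at_space[OF f] smooth_at_space[OF g] in auto)

lemma smooth_at_cong:
  assumes f: "smooth_at A B f p" and A: "inj_atlas A" and V: "open_of A V" "p \<in> V"
    and eq: "\<And>q. q \<in> V \<Longrightarrow> f q = g q"
  shows "smooth_at A B g p"
proof (rule smooth_atI)
  fix c d assume c: "c \<in> charts_at A p" and d: "d \<in> charts_at B (g p)"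
  have "d \<in> charts_at B (f p)" using d eq[OF V(2)] by simp
  from smooth_atE[OF f A c this] obtain S where
    S: "open S" "snd c p \<in> S" "smooth_on (snd d \<circ> f \<circ> param c) S"
      "\<And>x. x \<in> S \<Longrightarrow> param c x \<in> fst c \<and> snd c (param c x) = x \<and> f (param c x) \<in> fst d"
    by blast
  let ?R = "S \<inter> snd c ` (V \<inter> fst c)"
  have R: "open ?R" using S(1) open_of_chart[OF V(1) charts_atD(1)[OF c]] by blast
  have *: "param c x \<in> V" if "x \<in> ?R" for x
    using that param_coord[OF A charts_atD(1)[OF c]] by auto
  have "smooth_on (snd d \<circ> g \<circ> param c) ?R"
    using smooth_on_subset[OF S(3), of ?R] smooth_on_cong[OF R, of "snd d \<circ> f \<circ> param c" "snd d \<circ> g \<circ> param c"]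
      * eq by auto
  moreover have "snd c p \<in> ?R" using S(2) V(2) charts_atD(2)[OF c] by blast
  moreover have "\<forall>x\<in>?R. param c x \<in> fst c \<and> snd c (param c x) = x \<and> g (param c x) \<in> fst d"
    using S(4) eq * by (metis IntD1)
  ultimately show "\<exists>S. open S \<and> snd c p \<in> S \<and> smooth_on (snd d \<circ> g \<circ> param c) S \<and>
      (\<forall>x\<in>S. param c x \<in> fst c \<and> snd c (param c x) = x \<and> g (param c x) \<in> fst d)"
    using R by blast
qed (use smooth_at_space[OF f] eq[OF V(2)] in auto)

lemma smooth_at_ident: "smooth_atlas A \<Longrightarrow> p \<in> space_of A \<Longrightarrow> smooth_at A A (\<lambda>x. x) p"
  unfolding smooth_at_def charts_at_def
proof (intro conjI ballI)
  fix c d assume *: "smooth_atlas A" "c \<in> {c \<in> A. p \<in> fst c}" "d \<in> {c \<in> A. p \<in> fst c}"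
  then show "\<exists>S. open S \<and> snd c p \<in> S \<and> S \<subseteq> snd c ` (fst c \<inter> (\<lambda>x. x) -` fst d) \<and>
      smooth_on (snd d \<circ> (\<lambda>x. x) \<circ> param c) S"
    by (intro exI[of _ "snd c ` (fst c \<inter> fst d)"]) (auto simp: smooth_atlas_def comp_def)
qed auto

lemma open_of_vimage:
  assumes f: "smooth_map A B f" and A: "inj_atlas A" and B: "inj_atlas B" and U: "open_of B U"
  shows "open_of A {x \<in> space_of A. f x \<in> U}"
  unfolding open_of_def
proof (intro conjI ballI)
  fix c assume c: "c \<in> A"
  let ?V = "{x \<in> space_of A. f x \<in> U} \<inter> fst c"
  show "open (snd c ` ?V)"
  proof (subst open_subopen, intro ballI)
    fix y assume "y \<in> snd c ` ?V"
    then obtain q where q: "q \<in> fst c" "f q \<in> U" "y = snd c q" "q \<in> space_of A" by blast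
    then have cq: "c \<in> charts_at A q" using c by (simp add: charts_at_def)
    have "f q \<in> space_of B" using U q(2) by (auto simp: open_of_def)
    then obtain d where d: "d \<in> charts_at B (f q)" by (auto simp: space_of_charts_at)
    obtain S where S: "open S" "snd c q \<in> S" "smooth_on (snd d \<circ> f \<circ> param c) S"
      "\<And>x. x \<in> S \<Longrightarrow> param c x \<in> fst c \<and> snd c (param c x) = x \<and> f (param c x) \<in> fst d"
      using smooth_atE[OF smooth_map_smooth_at[OF f q(4)] A cq d] by blast
    \<comment> \<open>Membership of \<open>f q\<close> in \<open>U\<close> is tested on coordinates;
      injectivity of \<open>d\<close> later recovers it, since the image point and its witness in
      \<open>U\<close> both lie in \<open>fst d\<close>.\<close>
    let ?T = "{x \<in> S. (snd d \<circ> f \<circ> param c) x \<in> snd d ` (U \<inter> fst d)}"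
    have "open ?T" by (intro open_preimage S open_of_chart[OF U] charts_atD(1)[OF d])
    moreover have "y \<in> ?T"
      using S(2) q charts_atD(2)[OF d] param_coord[OF A c] by auto
    moreover have "?T \<subseteq> snd c ` ?V"
    proof
      fix x assume x: "x \<in> ?T"
      then obtain u where "u \<in> U" "u \<in> fst d" "snd d (f (param c x)) = snd d u" by auto
      moreover have "f (param c x) \<in> fst d" using S(4) x by blast
      ultimately have "f (param c x) \<in> U" using coord_inj[OF B charts_atD(1)[OF d]] by metis
      then show "x \<in> snd c ` ?V"
        using S(4) x charts_at_space[OF charts_atI[OF c]] by force
    qed
    ultimately show "\<exists>T. open T \<and> y \<in> T \<and> T \<subseteq> snd c ` ?V" by blast
  qed
qed auto

section \<open>Restriction of an atlas to a subset\<close>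

lemma space_of_restrict_atlas: "space_of (restrict_atlas A W) = space_of A \<inter> W"
  by (auto simp: space_of_def restrict_atlas_def)

lemma charts_at_restrict_atlas:
  "p \<in> W \<Longrightarrow> charts_at (restrict_atlas A W) p = (\<lambda>c. (fst c \<inter> W, snd c)) ` charts_at A p"
  by (force simp: charts_at_def restrict_atlas_def)

lemma inj_restrict_atlas: "inj_atlas A \<Longrightarrow> inj_atlas (restrict_atlas A W)"
  by (auto simp: inj_atlas_def restrict_atlas_def intro!: inj_on_subset[OF _ Int_lower1])

text \<open>The inverse chosen by \<open>inv_into\<close> depends on the set it ranges over, so the
  restricted chart has formally another parametrization; injectivity makes the two agree on the
  smaller image.\<close>

lemma param_restrict:
  assumes "inj_atlas A" "c \<in> A" "x \<in> snd c ` (fst c \<inter> W)"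
  shows "param (fst c \<inter> W, snd c) x = param c x"
proof -
  obtain q where q: "q \<in> fst c" "q \<in> W" "x = snd c q" using assms(3) by blast
  have "inj_on (snd c) (fst c \<inter> W)" using assms by (auto simp: inj_atlas_def intro: inj_on_subset)
  then show ?thesis using q param_coord[OF assms(1,2) q(1)] by (simp add: param_def)
qed

text \<open>Smoothness at \<open>p\<close> only sees a neighbourhood of \<open>p\<close>. Sections
  over \<open>W\<close> live on the restricted atlas; this moves them to the full one, where
  compositions are formed, and back.\<close>

lemma smooth_at_restrict_source:
  fixes B :: "('b, 'n::finite_dim_inner) atlas"
  assumes A: "inj_atlas A" and W: "open_of A W" "p \<in> W"
  shows "smooth_at (restrict_atlas A W) B f p \<longleftrightarrow> smooth_at A B f p"
proof -
  have "(\<exists>S. open S \<and> snd c p \<in> S \<and> S \<subseteq> snd c ` (fst c \<inter> W \<inter> f -` fst d) \<and>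
       smooth_on (snd d \<circ> f \<circ> param (fst c \<inter> W, snd c)) S) \<longleftrightarrow>
     (\<exists>S. open S \<and> snd c p \<in> S \<and> S \<subseteq> snd c ` (fst c \<inter> f -` fst d) \<and>
       smooth_on (snd d \<circ> f \<circ> param c) S)" (is "?l \<longleftrightarrow> ?r")
    if c: "c \<in> charts_at A p" for c and d :: "('b, 'n) chart"
  proof
    assume ?l
    then obtain S where S: "open S" "snd c p \<in> S" "S \<subseteq> snd c ` (fst c \<inter> W \<inter> f -` fst d)"
      "smooth_on (snd d \<circ> f \<circ> param (fst c \<inter> W, snd c)) S" by blast
    have "param (fst c \<inter> W, snd c) x = param c x" if x: "x \<in> S" for x
      using S(3) x by (intro param_restrict[OF A charts_atD(1)[OF c]]) blast
    then have "smooth_on (snd d \<circ> f \<circ> param c) S"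
      using S(4) smooth_on_cong[OF S(1), of "snd d \<circ> f \<circ> param (fst c \<inter> W, snd c)" "snd d \<circ> f \<circ> param c"]
      by simp
    moreover have "S \<subseteq> snd c ` (fst c \<inter> f -` fst d)" using S(3) by blast
    ultimately show ?r using S(1,2) by blast
  next
    assume ?r
    then obtain S where S: "open S" "snd c p \<in> S" "S \<subseteq> snd c ` (fst c \<inter> f -` fst d)"
      "smooth_on (snd d \<circ> f \<circ> param c) S" by blast
    let ?R = "S \<inter> snd c ` (W \<inter> fst c)"
    have R: "open ?R" using S(1) open_of_chart[OF W(1) charts_atD(1)[OF c]] by blast
    have "smooth_on (snd d \<circ> f \<circ> param (fst c \<inter> W, snd c)) ?R"
      using smooth_on_subset[OF S(4), of ?R]
        smooth_on_cong[OF R, of "snd d \<circ> f \<circ> param (fst c \<inter> W, snd c)" "snd d \<circ> f \<circ> param c"]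
        param_restrict[OF A charts_atD(1)[OF c], of _ W] by (simp add: Int_commute)
    moreover have "?R \<subseteq> snd c ` (fst c \<inter> W \<inter> f -` fst d)"
    proof
      fix x assume x: "x \<in> ?R"
      then obtain q r where "q \<in> fst c" "f q \<in> fst d" "x = snd c q" "r \<in> W" "r \<in> fst c" "x = snd c r"
        using S(3) by blast
      moreover then have "q = r" using coord_inj[OF A charts_atD(1)[OF c]] by metis
      ultimately show "x \<in> snd c ` (fst c \<inter> W \<inter> f -` fst d)" by blast
    qed
    moreover have "snd c p \<in> ?R" using S(2) W(2) charts_atD(2)[OF c] by blast
    ultimately show ?l using R by blast
  qed
  then show ?thesis
    using W(2) by (simp add: smooth_at_def charts_at_restrict_atlas space_of_restrict_atlas)
qed

lemma smooth_at_into_restrict: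
  assumes f: "smooth_at A B f p" and A: "inj_atlas A" and B: "inj_atlas B"
    and W: "open_of B W" "f p \<in> W"
  shows "smooth_at A (restrict_atlas B W) f p"
proof (rule smooth_atI)
  fix c d' assume c: "c \<in> charts_at A p" and "d' \<in> charts_at (restrict_atlas B W) (f p)"
  then obtain d where d: "d \<in> charts_at B (f p)" and d': "d' = (fst d \<inter> W, snd d)"
    using W(2) by (auto simp: charts_at_restrict_atlas)
  obtain S where S: "open S" "snd c p \<in> S" "smooth_on (snd d \<circ> f \<circ> param c) S"
      "\<And>x. x \<in> S \<Longrightarrow> param c x \<in> fst c \<and> snd c (param c x) = x \<and> f (param c x) \<in> fst d"
    using smooth_atE[OF f A c d] by blast
  \<comment> \<open>Near \<open>p\<close> the values must stay in \<open>W\<close>; this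
    neighbourhood is the preimage of the coordinate image of \<open>W\<close>.\<close>
  let ?T = "{x \<in> S. (snd d \<circ> f \<circ> param c) x \<in> snd d ` (W \<inter> fst d)}"
  have "open ?T" by (intro open_preimage S open_of_chart[OF W(1)] charts_atD(1)[OF d])
  moreover have "snd c p \<in> ?T"
    using S(2) W(2) charts_atD[OF d] charts_atD[OF c] param_coord_at[OF A c] by auto
  moreover have "smooth_on (snd d' \<circ> f \<circ> param c) ?T"
    using smooth_on_subset[OF S(3)] by (auto simp: d')
  moreover have "param c x \<in> fst c \<and> snd c (param c x) = x \<and> f (param c x) \<in> fst d'"
    if x: "x \<in> ?T" for x
  proof -
    obtain u where u: "u \<in> W" "u \<in> fst d" "snd d (f (param c x)) = snd d u" using x by auto
    moreover have *: "param c x \<in> fst c \<and> snd c (param c x) = x \<and> f (param c x) \<in> fst d"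
      using S(4) x by blast
    ultimately have "f (param c x) \<in> W" using coord_inj[OF B charts_atD(1)[OF d]] by metis
    with * show ?thesis by (simp add: d')
  qed
  ultimately show "\<exists>S. open S \<and> snd c p \<in> S \<and> smooth_on (snd d' \<circ> f \<circ> param c) S \<and>
      (\<forall>x\<in>S. param c x \<in> fst c \<and> snd c (param c x) = x \<and> f (param c x) \<in> fst d')"
    by (intro exI[of _ ?T] conjI ballI) simp_all
qed (use smooth_at_space[OF f] W in \<open>auto simp: space_of_restrict_atlas\<close>)

lemma smooth_at_from_restrict_target:
  assumes "smooth_at A (restrict_atlas B W) f p"
  shows "smooth_at A B f p"
  unfolding smooth_at_def
proof (intro conjI ballI)
  fix c d assume c: "c \<in> charts_at A p" and d: "d \<in> charts_at B (f p)"
  have "f p \<in> W" using smooth_at_space(2)[OF assms] by (simp add: space_of_restrict_atlas)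
  then have "(fst d \<inter> W, snd d) \<in> charts_at (restrict_atlas B W) (f p)"
    using d by (simp add: charts_at_restrict_atlas)
  with assms c have "\<exists>S. open S \<and> snd c p \<in> S \<and> S \<subseteq> snd c ` (fst c \<inter> f -` fst (fst d \<inter> W, snd d)) \<and>
      smooth_on (snd (fst d \<inter> W, snd d) \<circ> f \<circ> param c) S"
    unfolding smooth_at_def by blast
  then obtain S where "open S" "snd c p \<in> S" "S \<subseteq> snd c ` (fst c \<inter> f -` (fst d \<inter> W))"
      "smooth_on (snd d \<circ> f \<circ> param c) S"
    by (simp only: fst_conv snd_conv) blast
  then show "\<exists>S. open S \<and> snd c p \<in> S \<and> S \<subseteq> snd c ` (fst c \<inter> f -` fst d) \<and>
      smooth_on (snd d \<circ> f \<circ> param c) S"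
    by blast
qed (use smooth_at_space[OF assms] in \<open>auto simp: space_of_restrict_atlas\<close>)

section \<open>Maps into a model space\<close>

lemma charts_at_model_atlas: "charts_at model_atlas x = {(UNIV, \<lambda>x. x)}"
  by (auto simp: charts_at_def model_atlas_def)

lemma space_of_model_atlas: "space_of model_atlas = UNIV"
  by (auto simp: space_of_def model_atlas_def)

lemma inj_model_atlas: "inj_atlas model_atlas"
  by (simp add: inj_atlas_def model_atlas_def)

lemma smooth_at_modelE:
  assumes "smooth_at A model_atlas f p" "inj_atlas A" "c \<in> charts_at A p"
  obtains S where "open S" "snd c p \<in> S" "smooth_on (f \<circ> param c) S"
    "\<And>x. x \<in> S \<Longrightarrow> param c x \<in> fst c \<and> snd c (param c x) = x"
  using smooth_atE[OF assms, of "(UNIV, \<lambda>x. x)"] by (auto simp: charts_at_model_atlas comp_def)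

lemma smooth_at_modelI:
  assumes "p \<in> space_of A"
    and "\<And>c. c \<in> charts_at A p \<Longrightarrow>
      \<exists>S. open S \<and> snd c p \<in> S \<and> smooth_on (f \<circ> param c) S \<and>
        (\<forall>x\<in>S. param c x \<in> fst c \<and> snd c (param c x) = x)"
  shows "smooth_at A model_atlas f p"
  using assms by (intro smooth_atI) (auto simp: charts_at_model_atlas space_of_model_atlas comp_def)

lemma smooth_at_model_linear:
  assumes f: "smooth_at A model_atlas f p" and A: "inj_atlas A" and h: "bounded_linear h"
  shows "smooth_at A model_atlas (\<lambda>q. h (f q)) p"
proof (rule smooth_at_modelI)
  fix c assume "c \<in> charts_at A p"
  from smooth_at_modelE[OF f A this] obtain S where S: "open S" "snd c p \<in> S"
    "smooth_on (f \<circ> param c) S" "\<And>x. x \<in> S \<Longrightarrow> param c x \<in> fst c \<and> snd c (param c x) = x" by blast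
  then show "\<exists>S. open S \<and> snd c p \<in> S \<and> smooth_on ((\<lambda>q. h (f q)) \<circ> param c) S \<and>
      (\<forall>x\<in>S. param c x \<in> fst c \<and> snd c (param c x) = x)"
    using smooth_on_linear[OF h S(1,3)] by (intro exI[of _ S]) (simp add: comp_def)
qed (rule smooth_at_space[OF f])

lemma smooth_at_model_scaleR:
  assumes f: "smooth_at A model_atlas f p" and g: "smooth_at A model_atlas g p" and A: "inj_atlas A"
  shows "smooth_at A model_atlas (\<lambda>q. f q *\<^sub>R g q) p"
proof (rule smooth_at_modelI)
  fix c assume c: "c \<in> charts_at A p"
  obtain S where S: "open S" "snd c p \<in> S"
    "smooth_on (f \<circ> param c) S" "\<And>x. x \<in> S \<Longrightarrow> param c x \<in> fst c \<and> snd c (param c x) = x"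
    using smooth_at_modelE[OF f A c] by blast
  obtain T where T: "open T" "snd c p \<in> T"
    "smooth_on (g \<circ> param c) T" "\<And>x. x \<in> T \<Longrightarrow> param c x \<in> fst c \<and> snd c (param c x) = x"
    using smooth_at_modelE[OF g A c] by blast
  have R: "open (S \<inter> T)" using S T by blast
  have "smooth_on ((\<lambda>q. f q *\<^sub>R g q) \<circ> param c) (S \<inter> T)"
    using smooth_on_scaleR[OF R smooth_on_subset[OF S(3)] smooth_on_subset[OF T(3)]]
    by (simp add: comp_def)
  then show "\<exists>S. open S \<and> snd c p \<in> S \<and> smooth_on ((\<lambda>q. f q *\<^sub>R g q) \<circ> param c) S \<and>
      (\<forall>x\<in>S. param c x \<in> fst c \<and> snd c (param c x) = x)"
    using R S T by (intro exI[of _ "S \<inter> T"]) simp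
qed (rule smooth_at_space[OF f])

lemma smooth_at_model_const:
  assumes A: "smooth_atlas A" and p: "p \<in> space_of A"
  shows "smooth_at A model_atlas (\<lambda>q. u) p"
proof (rule smooth_at_modelI[OF p])
  fix c assume "c \<in> charts_at A p"
  \<comment> \<open>The identity map only supplies a neighbourhood of \<open>snd c p\<close> on
    which \<open>param c\<close> inverts the chart.\<close>
  from smooth_atE[OF smooth_at_ident[OF A p] smooth_atlas_inj[OF A] this this]
  show "\<exists>S. open S \<and> snd c p \<in> S \<and> smooth_on ((\<lambda>q. u) \<circ> param c) S \<and>
      (\<forall>x\<in>S. param c x \<in> fst c \<and> snd c (param c x) = x)"
    by (metis (no_types, lifting) comp_apply smooth_on_cong smooth_on_const)
qed

lemma smooth_at_model_add:
  assumes f: "smooth_at A model_atlas f p" and g: "smooth_at A model_atlas g p" and A: "inj_atlas A"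
  shows "smooth_at A model_atlas (\<lambda>q. f q + g q) p"
proof (rule smooth_at_modelI)
  fix c assume c: "c \<in> charts_at A p"
  obtain S where S: "open S" "snd c p \<in> S"
    "smooth_on (f \<circ> param c) S" "\<And>x. x \<in> S \<Longrightarrow> param c x \<in> fst c \<and> snd c (param c x) = x"
    using smooth_at_modelE[OF f A c] by blast
  obtain T where T: "open T" "snd c p \<in> T"
    "smooth_on (g \<circ> param c) T" "\<And>x. x \<in> T \<Longrightarrow> param c x \<in> fst c \<and> snd c (param c x) = x"
    using smooth_at_modelE[OF g A c] by blast
  have R: "open (S \<inter> T)" using S T by blast
  have "smooth_on ((\<lambda>q. f q + g q) \<circ> param c) (S \<inter> T)"
    using smooth_on_add[OF R smooth_on_subset[OF S(3)] smooth_on_subset[OF T(3)]]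
    by (simp add: comp_def)
  then show "\<exists>S. open S \<and> snd c p \<in> S \<and> smooth_on ((\<lambda>q. f q + g q) \<circ> param c) S \<and>
      (\<forall>x\<in>S. param c x \<in> fst c \<and> snd c (param c x) = x)"
    using R S T by (intro exI[of _ "S \<inter> T"]) simp
qed (rule smooth_at_space[OF f])

lemma smooth_at_model_sum:
  assumes "smooth_atlas A" "p \<in> space_of A" "\<And>i. i \<in> I \<Longrightarrow> smooth_at A model_atlas (f i) p"
  shows "smooth_at A model_atlas (\<lambda>q. \<Sum>i\<in>I. f i q) p"
  using assms(3)
  by (induction I rule: infinite_finite_induct)
    (simp_all add: smooth_at_model_const smooth_at_model_add smooth_atlas_inj assms(1,2))

section \<open>Products with a model space\<close>

lemma charts_at_product_model_atlas:
  "charts_at (product_atlas B model_atlas) (p, u) =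
    (\<lambda>d. (fst d \<times> UNIV, map_prod (snd d) (\<lambda>x. x))) ` charts_at B p"
  by (force simp: charts_at_def product_atlas_def model_atlas_def)

lemma space_of_product_model_atlas:
  "space_of (product_atlas B model_atlas) = space_of B \<times> UNIV"
  by (force simp: space_of_def product_atlas_def model_atlas_def)

lemma inj_product_model_atlas: "inj_atlas B \<Longrightarrow> inj_atlas (product_atlas B model_atlas)"
  by (auto simp: inj_atlas_def product_atlas_def model_atlas_def inj_on_def)

lemma smooth_at_into_product_model:
  assumes f: "smooth_at A B f p" and A: "inj_atlas A"
  shows "smooth_at A (product_atlas B model_atlas) (\<lambda>q. (f q, u)) p"
proof (rule smooth_atI)
  fix c d' assume c: "c \<in> charts_at A p"
    and "d' \<in> charts_at (product_atlas B model_atlas) (f p, u)"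
  then obtain d where d: "d \<in> charts_at B (f p)"
    and d': "d' = (fst d \<times> UNIV, map_prod (snd d) (\<lambda>x. x))"
    unfolding charts_at_product_model_atlas by blast
  obtain S where S: "open S" "snd c p \<in> S" "smooth_on (snd d \<circ> f \<circ> param c) S"
      "\<And>x. x \<in> S \<Longrightarrow> param c x \<in> fst c \<and> snd c (param c x) = x \<and> f (param c x) \<in> fst d"
    using smooth_atE[OF f A c d] by blast
  have "smooth_on (snd d' \<circ> (\<lambda>q. (f q, u)) \<circ> param c) S"
    using smooth_on_Pair[OF S(1,3) smooth_on_const] by (simp add: d' comp_def)
  then show "\<exists>S. open S \<and> snd c p \<in> S \<and> smooth_on (snd d' \<circ> (\<lambda>q. (f q, u)) \<circ> param c) S \<and>
      (\<forall>x\<in>S. param c x \<in> fst c \<and> snd c (param c x) = x \<and> (f (param c x), u) \<in> fst d')"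
    using S by (intro exI[of _ S]) (simp add: d')
qed (use smooth_at_space[OF f] in \<open>auto simp: space_of_product_model_atlas\<close>)

lemma smooth_at_snd_of_product_model:
  assumes f: "smooth_at A (product_atlas B model_atlas) f p" and A: "inj_atlas A"
  shows "smooth_at A model_atlas (\<lambda>q. snd (f q)) p"
proof (rule smooth_at_modelI)
  fix c assume c: "c \<in> charts_at A p"
  have "charts_at (product_atlas B model_atlas) (f p) \<noteq> {}"
    using smooth_at_space(2)[OF f] by (simp add: space_of_charts_at)
  then obtain e where d: "e \<in> charts_at (product_atlas B model_atlas) (f p)" by blast
  then obtain d where e: "e = (fst d \<times> UNIV, map_prod (snd d) (\<lambda>x. x))"
    using charts_at_product_model_atlas[of B "fst (f p)" "snd (f p)"] by auto
  obtain S where S: "open S" "snd c p \<in> S" "smooth_on (snd e \<circ> f \<circ> param c) S"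
      "\<And>x. x \<in> S \<Longrightarrow> param c x \<in> fst c \<and> snd c (param c x) = x \<and> f (param c x) \<in> fst e"
    using smooth_atE[OF f A c d] by blast
  show "\<exists>S. open S \<and> snd c p \<in> S \<and> smooth_on ((\<lambda>q. snd (f q)) \<circ> param c) S \<and>
      (\<forall>x\<in>S. param c x \<in> fst c \<and> snd c (param c x) = x)"
    using smooth_on_linear[OF bounded_linear_snd S(1,3)] S by (intro exI[of _ S]) (simp add: e comp_def)
qed (rule smooth_at_space[OF f])

section \<open>The chain rule in charts\<close>

lemma smooth_at_differentiable:
  assumes "smooth_at A B f p" "c \<in> charts_at A p" "d \<in> charts_at B (f p)"
  shows "(snd d \<circ> f \<circ> param c) differentiable at (snd c p)"
  using assms smooth_on_differentiable unfolding smooth_at_def by metis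

text \<open>The intermediate chart cancels only near the point, so the composite of the coordinate
  expressions is compared with the coordinate expression of the composite on an open set. With the
  identity for \<open>f\<close> or \<open>g\<close> this becomes the transformation law of tangent
  vectors under a change of chart.\<close>

lemma smooth_at_frechet_chain:
  assumes f: "smooth_at A B f p" and g: "smooth_at B C g (f p)"
    and A: "inj_atlas A" and B: "inj_atlas B"
    and c: "c \<in> charts_at A p" and d: "d \<in> charts_at B (f p)" and e: "e \<in> charts_at C (g (f p))"
  shows "frechet_derivative (snd e \<circ> (\<lambda>q. g (f q)) \<circ> param c) (at (snd c p)) v =
    frechet_derivative (snd e \<circ> g \<circ> param d) (at (snd d (f p)))
      (frechet_derivative (snd d \<circ> f \<circ> param c) (at (snd c p)) v)"
proof -
  let ?F = "snd d \<circ> f \<circ> param c" and ?G = "snd e \<circ> g \<circ> param d"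
  obtain S where S: "open S" "snd c p \<in> S" "smooth_on ?F S"
      "\<And>x. x \<in> S \<Longrightarrow> param c x \<in> fst c \<and> snd c (param c x) = x \<and> f (param c x) \<in> fst d"
    using smooth_atE[OF f A c d] by blast
  have "?F (snd c p) = snd d (f p)" using param_coord_at[OF A c] by simp
  moreover have "(?F has_derivative frechet_derivative ?F (at (snd c p))) (at (snd c p))"
    "(?G has_derivative frechet_derivative ?G (at (snd d (f p)))) (at (snd d (f p)))"
    using smooth_at_differentiable[OF f c d] smooth_at_differentiable[OF g d e]
    by (simp_all add: has_derivative_frechet)
  ultimately have "((\<lambda>x. ?G (?F x)) has_derivative (\<lambda>v. frechet_derivative ?G (at (snd d (f p)))
      (frechet_derivative ?F (at (snd c p)) v))) (at (snd c p))"
    using has_derivative_compose by metis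
  then have "(snd e \<circ> (\<lambda>q. g (f q)) \<circ> param c has_derivative
      (\<lambda>v. frechet_derivative ?G (at (snd d (f p))) (frechet_derivative ?F (at (snd c p)) v)))
      (at (snd c p))"
    by (rule has_derivative_transform_within_open[OF _ S(1,2)])
      (use S(4) param_coord[OF B charts_atD(1)[OF d]] in simp)
  then show ?thesis by (rule frechet_derivative_eqI)
qed

section \<open>Derivatives between tangent spaces\<close>

lemma tangent_space_iff:
  "\<nu> \<in> tangent_space A p \<longleftrightarrow> fst \<nu> = p \<and> (\<forall>c. c \<notin> charts_at A p \<longrightarrow> snd \<nu> c = 0) \<and>
    (\<forall>c\<in>charts_at A p. \<forall>d\<in>charts_at A p.
       snd \<nu> d = frechet_derivative (snd d \<circ> param c) (at (snd c p)) (snd \<nu> c))"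
  unfolding tangent_space_def by (simp only: mem_Collect_eq case_prod_unfold)

lemma tangent_spaceD:
  assumes "\<nu> \<in> tangent_space A p"
  shows "fst \<nu> = p" "c \<notin> charts_at A p \<Longrightarrow> snd \<nu> c = 0"
    and "c \<in> charts_at A p \<Longrightarrow> d \<in> charts_at A p \<Longrightarrow>
      snd \<nu> d = frechet_derivative (snd d \<circ> param c) (at (snd c p)) (snd \<nu> c)"
  using assms unfolding tangent_space_iff by meson+

text \<open>One representative determines the whole family: the transition derivatives give the
  others, and the dummy value settles the charts that miss \<open>p\<close>.\<close>

lemma tangent_space_ext:
  assumes "\<nu> \<in> tangent_space A p" "\<nu>' \<in> tangent_space A p" "c \<in> charts_at A p" "snd \<nu> c = snd \<nu>' c"
  shows "\<nu> = \<nu>'"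
proof (intro prod_eqI ext)
  fix d show "snd \<nu> d = snd \<nu>' d"
    using tangent_spaceD(2)[OF assms(1), of d] tangent_spaceD(2)[OF assms(2), of d]
      tangent_spaceD(3)[OF assms(1,3), of d] tangent_spaceD(3)[OF assms(2,3), of d] assms(4)
    by metis
qed (simp add: tangent_spaceD(1)[OF assms(1)] tangent_spaceD(1)[OF assms(2)])

text \<open>Frees \<open>tangent_map\<close> from its arbitrary choice of chart:
  \<open>\<nu>\<close> transforms from \<open>k\<close> to the chosen chart by the transition
  derivative, which the chain rule absorbs.\<close>

lemma tangent_map_coord:
  assumes A: "smooth_atlas A" and f: "smooth_at A B f p" and \<nu>: "\<nu> \<in> tangent_space A p"
    and k: "k \<in> charts_at A p" and d: "d \<in> charts_at B (f p)"
  shows "snd (tangent_map A B f \<nu>) d =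
    frechet_derivative (snd d \<circ> f \<circ> param k) (at (snd k p)) (snd \<nu> k)"
proof -
  define c where "c = (SOME c. c \<in> charts_at A p)"
  have c: "c \<in> charts_at A p" using k unfolding c_def by (rule someI)
  have "snd (tangent_map A B f \<nu>) d = frechet_derivative (snd d \<circ> f \<circ> param c) (at (snd c p)) (snd \<nu> c)"
    using d tangent_spaceD(1)[OF \<nu>] by (simp add: tangent_map_def c_def Let_def)
  also have "snd \<nu> c = frechet_derivative (snd c \<circ> (\<lambda>x. x) \<circ> param k) (at (snd k p)) (snd \<nu> k)"
    using tangent_spaceD(3)[OF \<nu> k c] by (simp add: comp_def)
  finally show ?thesis
    using smooth_at_frechet_chain[OF smooth_at_ident[OF A] f _ _ k c d] A
    by (simp add: comp_def smooth_atlas_inj charts_at_space[OF k])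
qed

lemma tangent_map_outside:
  "d \<notin> charts_at B (f (fst \<nu>)) \<Longrightarrow> snd (tangent_map A B f \<nu>) d = 0"
  by (simp add: tangent_map_def Let_def)

lemma fst_tangent_map: "fst (tangent_map A B f \<nu>) = f (fst \<nu>)"
  by (simp add: tangent_map_def Let_def)

lemma tangent_map_in_tangent_space:
  assumes A: "smooth_atlas A" and B: "smooth_atlas B" and f: "smooth_at A B f p"
    and \<nu>: "\<nu> \<in> tangent_space A p"
  shows "tangent_map A B f \<nu> \<in> tangent_space B (f p)"
proof -
  obtain k where k: "k \<in> charts_at A p" using smooth_at_space(1)[OF f] by (auto simp: space_of_charts_at)
  have "snd (tangent_map A B f \<nu>) d = frechet_derivative (snd d \<circ> param c) (at (snd c (f p)))
      (snd (tangent_map A B f \<nu>) c)" if cd: "c \<in> charts_at B (f p)" "d \<in> charts_at B (f p)" for c d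
    using smooth_at_frechet_chain[OF f smooth_at_ident[OF B smooth_at_space(2)[OF f]]
        smooth_atlas_inj[OF A] smooth_atlas_inj[OF B] k cd, of "snd \<nu> k"]
      tangent_map_coord[OF A f \<nu> k cd(1)] tangent_map_coord[OF A f \<nu> k cd(2)]
    by (simp only: comp_def)
  moreover have "fst (tangent_map A B f \<nu>) = f p" "f (fst \<nu>) = f p"
    using tangent_spaceD(1)[OF \<nu>] by (simp_all add: fst_tangent_map)
  ultimately show ?thesis
    using tangent_map_outside[of _ B f \<nu> A] unfolding tangent_space_iff by metis
qed

lemma tangent_map_compose:
  assumes A: "smooth_atlas A" and B: "smooth_atlas B" and f: "smooth_at A B f p"
    and g: "smooth_at B C g (f p)" and \<nu>: "\<nu> \<in> tangent_space A p"
  shows "tangent_map A C (\<lambda>q. g (f q)) \<nu> = tangent_map B C g (tangent_map A B f \<nu>)"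
proof (intro prod_eqI ext)
  obtain k where k: "k \<in> charts_at A p" using smooth_at_space(1)[OF f] by (auto simp: space_of_charts_at)
  obtain d where d: "d \<in> charts_at B (f p)" using smooth_at_space(2)[OF f] by (auto simp: space_of_charts_at)
  fix e
  show "snd (tangent_map A C (\<lambda>q. g (f q)) \<nu>) e = snd (tangent_map B C g (tangent_map A B f \<nu>)) e"
  proof (cases "e \<in> charts_at C (g (f p))")
    case True
    note inj = smooth_atlas_inj[OF A] smooth_atlas_inj[OF B]
    show ?thesis
      using tangent_map_coord[OF A smooth_at_compose[OF f g inj] \<nu> k True]
        tangent_map_coord[OF B g tangent_map_in_tangent_space[OF A B f \<nu>] d True]
        tangent_map_coord[OF A f \<nu> k d] smooth_at_frechet_chain[OF f g inj k d True] by simp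
  next
    case False
    then show ?thesis
      using tangent_spaceD(1)[OF \<nu>] by (simp add: tangent_map_outside fst_tangent_map)
  qed
qed (simp add: fst_tangent_map)

text \<open>The maps may differ off the manifold. This is harmless because coordinates run through
  the open image of a chart, all of whose points come from the manifold.\<close>

lemma tangent_map_cong:
  fixes B :: "('b, 'n::finite_dim_inner) atlas"
  assumes A: "smooth_atlas A" and eq: "\<And>q. q \<in> space_of A \<Longrightarrow> f q = g q" and p: "fst \<nu> \<in> space_of A"
  shows "tangent_map A B f \<nu> = tangent_map A B g \<nu>"
proof -
  define c where "c = (SOME c. c \<in> charts_at A (fst \<nu>))"
  have c: "c \<in> charts_at A (fst \<nu>)"
    using p someI_ex unfolding c_def space_of_charts_at by fast
  have "frechet_derivative (\<psi> \<circ> f \<circ> param c) (at (snd c (fst \<nu>))) =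
      frechet_derivative (\<psi> \<circ> g \<circ> param c) (at (snd c (fst \<nu>)))" for \<psi> :: "'b \<Rightarrow> 'n"
  proof (rule frechet_derivative_cong_open)
    show "open (snd c ` fst c)" using smooth_atlas_open[OF A charts_atD(1)[OF c]] .
    fix y assume "y \<in> snd c ` fst c"
    then have "param c y \<in> space_of A"
      using param_coord[OF smooth_atlas_inj[OF A] charts_atD(1)[OF c]] charts_atD(1)[OF c]
      by (auto simp: space_of_def)
    then show "(\<psi> \<circ> f \<circ> param c) y = (\<psi> \<circ> g \<circ> param c) y" using eq by simp
  qed (use charts_atD[OF c] in blast)
  then show ?thesis using eq[OF p] by (simp add: tangent_map_def Let_def c_def fun_eq_iff)
qed

lemma tangent_map_linear:
  assumes f: "smooth_at A B f p" and "fst \<nu> = p" "fst \<nu>' = p"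
  shows "tangent_map A B f (fibre_add (tangent_bundle A) \<nu> \<nu>') =
      fibre_add (tangent_bundle B) (tangent_map A B f \<nu>) (tangent_map A B f \<nu>')"
    and "tangent_map A B f (fibre_scale (tangent_bundle A) r \<nu>) =
      fibre_scale (tangent_bundle B) r (tangent_map A B f \<nu>)"
proof -
  define c where "c = (SOME c. c \<in> charts_at A p)"
  have c: "c \<in> charts_at A p"
    using smooth_at_space(1)[OF f] someI_ex unfolding c_def space_of_charts_at by fast
  have lin: "linear (frechet_derivative (snd d \<circ> f \<circ> param c) (at (snd c p)))"
    if "d \<in> charts_at B (f p)" for d
    using smooth_at_differentiable[OF f c that] by (rule linear_frechet_derivative)
  show "tangent_map A B f (fibre_add (tangent_bundle A) \<nu> \<nu>') =
      fibre_add (tangent_bundle B) (tangent_map A B f \<nu>) (tangent_map A B f \<nu>')"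
    "tangent_map A B f (fibre_scale (tangent_bundle A) r \<nu>) =
      fibre_scale (tangent_bundle B) r (tangent_map A B f \<nu>)"
    using assms(2,3) lin
    by (auto simp: tangent_map_def tangent_bundle_def Let_def c_def[symmetric] fun_eq_iff
      linear_add linear_cmul)
qed

section \<open>Smooth maps into tangent bundles\<close>

lemma smooth_at_coord:
  assumes A: "smooth_atlas A" and c: "c \<in> charts_at A p"
  shows "smooth_at A model_atlas (snd c) p"
proof (rule smooth_at_modelI)
  fix k assume k: "k \<in> charts_at A p"
  note id = smooth_at_ident[OF A charts_at_space[OF c]]
  obtain S where S: "open S" "snd k p \<in> S" "smooth_on (snd c \<circ> (\<lambda>x. x) \<circ> param k) S"
      "\<And>x. x \<in> S \<Longrightarrow> param k x \<in> fst k \<and> snd k (param k x) = x \<and> param k x \<in> fst c"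
    using smooth_atE[OF id smooth_atlas_inj[OF A] k c] by blast
  then show "\<exists>S. open S \<and> snd k p \<in> S \<and> smooth_on (snd c \<circ> param k) S \<and>
      (\<forall>x\<in>S. param k x \<in> fst k \<and> snd k (param k x) = x)"
    by (intro exI[of _ S]) (simp add: comp_def)
qed (rule charts_at_space[OF c])

lemma smooth_at_model_model:
  assumes "open S" "y \<in> S" "smooth_on G S"
  shows "smooth_at model_atlas model_atlas G y"
proof (rule smooth_at_modelI)
  fix c assume "c \<in> charts_at (model_atlas :: ('a, 'a) atlas) y"
  then have c: "c = (UNIV, \<lambda>x. x)" by (simp add: charts_at_model_atlas)
  have "param c x = x" for x using param_coord[OF inj_model_atlas, of c x]
    by (simp add: c model_atlas_def)
  then show "\<exists>S. open S \<and> snd c y \<in> S \<and> smooth_on (G \<circ> param c) S \<and>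
      (\<forall>x\<in>S. param c x \<in> fst c \<and> snd c (param c x) = x)"
    using assms by (intro exI[of _ S]) (simp add: c comp_def)
qed (simp add: space_of_model_atlas)

section \<open>Charts of the tangent bundle\<close>

definition tangent_chart :: "('a, 'm::finite_dim_inner) atlas \<Rightarrow> ('a, 'm) chart \<Rightarrow> (('a, 'm) tangent, 'm \<times> 'm) chart"
  where "tangent_chart A c = (\<Union>p\<in>fst c. tangent_space A p, \<lambda>(p, w). (snd c p, w c))"

lemma tangent_atlas_image: "tangent_atlas A = tangent_chart A ` A"
  by (simp add: tangent_atlas_def tangent_chart_def)

lemma mem_fst_tangent_chart:
  "v \<in> fst (tangent_chart A c) \<longleftrightarrow> fst v \<in> fst c \<and> v \<in> tangent_space A (fst v)"
  unfolding tangent_chart_def by (auto dest: tangent_spaceD(1))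

lemma snd_tangent_chart: "snd (tangent_chart A c) v = (snd c (fst v), snd v c)"
  by (simp add: tangent_chart_def case_prod_unfold)

lemma space_of_tangent_atlas:
  "v \<in> space_of (tangent_atlas A) \<longleftrightarrow> fst v \<in> space_of A \<and> v \<in> tangent_space A (fst v)"
  unfolding space_of_def tangent_atlas_image by (auto simp: mem_fst_tangent_chart simp del: fst_conv)

lemma inj_tangent_atlas:
  assumes A: "inj_atlas A"
  shows "inj_atlas (tangent_atlas A)"
  unfolding inj_atlas_def tangent_atlas_image
proof (intro ballI inj_onI)
  fix c' v w assume c': "c' \<in> tangent_chart A ` A" and vw: "v \<in> fst c'" "w \<in> fst c'" "snd c' v = snd c' w"
  then obtain c where c: "c \<in> A" "c' = tangent_chart A c" by blast
  have v: "fst v \<in> fst c" "v \<in> tangent_space A (fst v)" and w: "fst w \<in> fst c" "w \<in> tangent_space A (fst w)"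
    using vw by (simp_all add: c mem_fst_tangent_chart)
  have eq: "snd c (fst v) = snd c (fst w)" "snd v c = snd w c"
    using vw(3) by (simp_all add: c snd_tangent_chart)
  have "fst v = fst w" using coord_inj[OF A c(1) v(1) w(1) eq(1)] .
  then show "v = w"
    using tangent_space_ext[OF v(2) _ charts_atI[OF c(1) v(1)] eq(2)] w(2) by simp
qed

lemma charts_at_tangent_atlas:
  assumes "v \<in> tangent_space A p"
  shows "charts_at (tangent_atlas A) v = tangent_chart A ` charts_at A p"
proof -
  have "v \<in> fst (tangent_chart A c) \<longleftrightarrow> p \<in> fst c" for c
    using assms tangent_spaceD(1)[OF assms] by (simp add: mem_fst_tangent_chart)
  then show ?thesis unfolding charts_at_def tangent_atlas_image by blast
qed

text \<open>A tangent chart reads \<open>s\<close> as a pair of base coordinates and vector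
  components, so smoothness can be checked on the two separately.\<close>

lemma smooth_at_into_tangent_atlas:
  assumes A: "smooth_atlas A" and B: "inj_atlas B" and V: "open_of B V" "p \<in> V"
    and s: "\<And>q. q \<in> V \<Longrightarrow> s q \<in> tangent_space A (f q)"
    and f: "smooth_at B A f p"
    and comp: "\<And>d. d \<in> charts_at A (f p) \<Longrightarrow> smooth_at B model_atlas (\<lambda>q. snd (s q) d) p"
  shows "smooth_at B (tangent_atlas A) s p"
proof (rule smooth_atI)
  fix k d' assume k: "k \<in> charts_at B p" and "d' \<in> charts_at (tangent_atlas A) (s p)"
  then obtain d where d: "d \<in> charts_at A (f p)" and d': "d' = tangent_chart A d"
    unfolding charts_at_tangent_atlas[OF s[OF V(2)]] by blast
  obtain S where S: "open S" "snd k p \<in> S" "smooth_on (snd d \<circ> f \<circ> param k) S"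
      "\<And>x. x \<in> S \<Longrightarrow> param k x \<in> fst k \<and> snd k (param k x) = x \<and> f (param k x) \<in> fst d"
    using smooth_atE[OF f B k d] by blast
  obtain T where T: "open T" "snd k p \<in> T" "smooth_on ((\<lambda>q. snd (s q) d) \<circ> param k) T"
      "\<And>x. x \<in> T \<Longrightarrow> param k x \<in> fst k \<and> snd k (param k x) = x"
    using smooth_at_modelE[OF comp[OF d] B k] by blast
  \<comment> \<open>The third factor keeps the points in \<open>V\<close>, where the values of
    \<open>s\<close> are known to be tangent vectors.\<close>
  let ?R = "S \<inter> T \<inter> snd k ` (V \<inter> fst k)"
  have R: "open ?R" using S(1) T(1) open_of_chart[OF V(1) charts_atD(1)[OF k]] by blast
  have mem: "s (param k x) \<in> tangent_space A (f (param k x))" "f (param k x) = fst (s (param k x))"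
    if x: "x \<in> ?R" for x
  proof -
    obtain q where "q \<in> V" "q \<in> fst k" "x = snd k q" using x by blast
    then have "param k x \<in> V" using param_coord[OF B charts_atD(1)[OF k]] by simp
    then show "s (param k x) \<in> tangent_space A (f (param k x))" by (rule s)
    then show "f (param k x) = fst (s (param k x))" by (simp add: tangent_spaceD(1))
  qed
  have "smooth_on (\<lambda>x. ((snd d \<circ> f \<circ> param k) x, ((\<lambda>q. snd (s q) d) \<circ> param k) x)) ?R"
    by (intro smooth_on_Pair R smooth_on_subset[OF S(3)] smooth_on_subset[OF T(3)]) blast+
  then have "smooth_on (snd d' \<circ> s \<circ> param k) ?R"
    by (subst smooth_on_cong[OF R]) (use mem(2) in \<open>auto simp: d' snd_tangent_chart\<close>)
  moreover have "snd k p \<in> ?R" using S(2) T(2) V(2) charts_atD(2)[OF k] by blast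
  moreover have "param k x \<in> fst k \<and> snd k (param k x) = x \<and> s (param k x) \<in> fst d'" if x: "x \<in> ?R" for x
  proof -
    have "param k x \<in> fst k \<and> snd k (param k x) = x \<and> f (param k x) \<in> fst d"
      using S(4) x by blast
    then show ?thesis using mem[OF x] by (simp add: d' mem_fst_tangent_chart)
  qed
  ultimately show "\<exists>S. open S \<and> snd k p \<in> S \<and> smooth_on (snd d' \<circ> s \<circ> param k) S \<and>
      (\<forall>x\<in>S. param k x \<in> fst k \<and> snd k (param k x) = x \<and> s (param k x) \<in> fst d')"
    using R by (intro exI[of _ ?R] conjI ballI) simp_all
next
  show "s p \<in> space_of (tangent_atlas A)"
    using s[OF V(2)] smooth_at_space(2)[OF f] tangent_spaceD(1)[OF s[OF V(2)]]
    by (simp add: space_of_tangent_atlas)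
qed (rule smooth_at_space[OF f])

lemma smooth_at_tangent_coord:
  assumes s: "smooth_at B (tangent_atlas A) s p" and B: "inj_atlas B" and d: "d \<in> charts_at A (fst (s p))"
  shows "smooth_at B model_atlas (\<lambda>q. snd (s q) d) p"
proof (rule smooth_at_modelI)
  fix k assume k: "k \<in> charts_at B p"
  define d' where "d' = tangent_chart A d"
  have "s p \<in> tangent_space A (fst (s p))"
    using smooth_at_space(2)[OF s] by (simp add: space_of_tangent_atlas)
  then have "d' \<in> charts_at (tangent_atlas A) (s p)"
    using d unfolding d'_def by (subst charts_at_tangent_atlas) auto
  from smooth_atE[OF s B k this] obtain S where S: "open S" "snd k p \<in> S" "smooth_on (snd d' \<circ> s \<circ> param k) S"
      "\<And>x. x \<in> S \<Longrightarrow> param k x \<in> fst k \<and> snd k (param k x) = x \<and> s (param k x) \<in> fst d'"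
    by blast
  have "smooth_on (\<lambda>x. snd ((snd d' \<circ> s \<circ> param k) x)) S"
    by (rule smooth_on_linear[OF bounded_linear_snd S(1,3)])
  then have "smooth_on ((\<lambda>q. snd (s q) d) \<circ> param k) S"
    by (simp add: d'_def snd_tangent_chart comp_def)
  then show "\<exists>S. open S \<and> snd k p \<in> S \<and> smooth_on ((\<lambda>q. snd (s q) d) \<circ> param k) S \<and>
      (\<forall>x\<in>S. param k x \<in> fst k \<and> snd k (param k x) = x)"
    using S by (intro exI[of _ S]) simp
qed (rule smooth_at_space[OF s])

text \<open>\<open>Df \<circ> s\<close> is a vector field along \<open>f\<close>, not a section over
  the target. In coordinates it is the derivative of the expression of \<open>f\<close> applied to
  the moving representative of \<open>s\<close>, hence smooth by
  \<open>smooth_on_frechet_derivative_apply\<close>.\<close>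

lemma smooth_at_tangent_map_coord:
  assumes A: "smooth_atlas A" and f: "smooth_map A B f"
    and s: "smooth_at A (tangent_atlas A) s p"
    and V: "open_of A V" "p \<in> V" "\<And>q. q \<in> V \<Longrightarrow> s q \<in> tangent_space A q"
    and c: "c \<in> charts_at B (f p)"
  shows "smooth_at A model_atlas (\<lambda>q. snd (tangent_map A B f (s q)) c) p"
proof (rule smooth_at_modelI)
  fix k assume k: "k \<in> charts_at A p"
  note inj = smooth_atlas_inj[OF A]
  have "k \<in> charts_at A (fst (s p))" using k tangent_spaceD(1)[OF V(3)[OF V(2)]] by simp
  note sk = smooth_at_tangent_coord[OF s inj this]
  obtain S where S: "open S" "snd k p \<in> S" "smooth_on (snd c \<circ> f \<circ> param k) S"
      "\<And>x. x \<in> S \<Longrightarrow> param k x \<in> fst k \<and> snd k (param k x) = x \<and> f (param k x) \<in> fst c"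
    using smooth_atE[OF smooth_map_smooth_at[OF f smooth_at_space(1)[OF s]] inj k c] by blast
  obtain T where T: "open T" "snd k p \<in> T" "smooth_on ((\<lambda>q. snd (s q) k) \<circ> param k) T"
      "\<And>x. x \<in> T \<Longrightarrow> param k x \<in> fst k \<and> snd k (param k x) = x"
    using smooth_at_modelE[OF sk inj k] by blast
  let ?R = "S \<inter> T \<inter> snd k ` (V \<inter> fst k)"
  have R: "open ?R" using S(1) T(1) open_of_chart[OF V(1) charts_atD(1)[OF k]] by blast
  have eq: "snd (tangent_map A B f (s (param k x))) c =
      frechet_derivative (snd c \<circ> f \<circ> param k) (at x) (snd (s (param k x)) k)"
    if x: "x \<in> ?R" for x
  proof -
    obtain q where q: "q \<in> V" "q \<in> fst k" "x = snd k q" using x by blast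
    have pq: "param k x = q" using q param_coord[OF inj charts_atD(1)[OF k]] by simp
    have kq: "k \<in> charts_at A q" using charts_atI[OF charts_atD(1)[OF k] q(2)] .
    have "f (param k x) \<in> fst c" using S(4) x by blast
    then have "c \<in> charts_at B (f q)" using charts_atI[OF charts_atD(1)[OF c]] pq by simp
    from tangent_map_coord[OF A smooth_map_smooth_at[OF f charts_at_space[OF kq]] V(3)[OF q(1)] kq this]
    show ?thesis using pq unfolding q(3) by (simp only:)
  qed
  have "smooth_on (\<lambda>x. frechet_derivative (snd c \<circ> f \<circ> param k) (at x) (((\<lambda>q. snd (s q) k) \<circ> param k) x)) ?R"
    by (intro smooth_on_frechet_derivative_apply R smooth_on_subset[OF S(3)] smooth_on_subset[OF T(3)]) blast+
  then have "smooth_on ((\<lambda>q. snd (tangent_map A B f (s q)) c) \<circ> param k) ?R"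
    by (subst smooth_on_cong[OF R]) (use eq in simp_all)
  moreover have "snd k p \<in> ?R" using S(2) T(2) V(2) charts_atD(2)[OF k] by blast
  moreover have "param k x \<in> fst k \<and> snd k (param k x) = x" if x: "x \<in> ?R" for x
    using T(4) x by blast
  ultimately show "\<exists>S. open S \<and> snd k p \<in> S \<and>
      smooth_on ((\<lambda>q. snd (tangent_map A B f (s q)) c) \<circ> param k) S \<and>
      (\<forall>x\<in>S. param k x \<in> fst k \<and> snd k (param k x) = x)"
    using R by (intro exI[of _ ?R] conjI ballI) simp_all
qed (rule smooth_at_space[OF s])

section \<open>Local frames\<close>

text \<open>\<open>\<rho> p u\<close> is the element of the fibre at \<open>p\<close> with coordinates \<open>u\<close>, and \<open>\<tau>\<close> reads off the
  coordinates.\<close>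

definition local_frame ::
    "('a, 'm::finite_dim_inner, 'e, 'n::finite_dim_inner) vbundle \<Rightarrow> 'a set
      \<Rightarrow> ('e \<Rightarrow> 'f::finite_dim_inner) \<Rightarrow> ('a \<Rightarrow> 'f \<Rightarrow> 'e) \<Rightarrow> bool"
  where "local_frame E U \<tau> \<rho> \<longleftrightarrow> open_of (base E) U \<and> (\<forall>u. smooth_section E U (\<lambda>p. \<rho> p u)) \<and>
    (\<forall>p\<in>U. (\<forall>x\<in>fibre E p. \<rho> p (\<tau> x) = x) \<and> (\<forall>u. \<rho> p u \<in> fibre E p) \<and> (\<forall>u. \<tau> (\<rho> p u) = u) \<and>
      (\<forall>u v. \<rho> p (u + v) = fibre_add E (\<rho> p u) (\<rho> p v)) \<and>
      (\<forall>r u. \<rho> p (r *\<^sub>R u) = fibre_scale E r (\<rho> p u)))"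

lemma local_frameD:
  assumes "local_frame E U \<tau> \<rho>"
  shows "open_of (base E) U" "smooth_section E U (\<lambda>p. \<rho> p u)"
    and "p \<in> U \<Longrightarrow> x \<in> fibre E p \<Longrightarrow> \<rho> p (\<tau> x) = x"
    and "p \<in> U \<Longrightarrow> \<rho> p u \<in> fibre E p"
    and "p \<in> U \<Longrightarrow> \<tau> (\<rho> p u) = u"
    and "p \<in> U \<Longrightarrow> \<rho> p (u + v) = fibre_add E (\<rho> p u) (\<rho> p v)"
    and "p \<in> U \<Longrightarrow> \<rho> p (r *\<^sub>R u) = fibre_scale E r (\<rho> p u)"
  using assms unfolding local_frame_def by (simp_all only:)

lemma bundle_metricD:
  assumes "bundle_metric E g" "p \<in> space_of (base E)" "x \<in> fibre E p"
  shows "y \<in> fibre E p \<Longrightarrow> g x y = g y x"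
    and "y \<in> fibre E p \<Longrightarrow> z \<in> fibre E p \<Longrightarrow> g (fibre_add E x y) z = g x z + g y z"
    and "y \<in> fibre E p \<Longrightarrow> g (fibre_scale E r x) y = r * g x y"
    and "x \<noteq> zero_section E p \<Longrightarrow> 0 < g x x"
  using assms unfolding bundle_metric_def by blast+

lemma bundle_metric_smooth:
  assumes "bundle_metric E g" "smooth_atlas (base E)" "open_of (base E) W"
    "smooth_section E W s" "smooth_section E W t"
  shows "smooth_map (restrict_atlas (base E) W) model_atlas (\<lambda>p. g (s p) (t p))"
  using assms(1) openin_manifold_topology[OF assms(2), of W] assms(3,4,5) unfolding bundle_metric_def by simp

text \<open>Bilinear expansion with the Gram matrix of the frame as coefficients. Linearity is given
  in the first argument, so the second argument is expanded after exchanging the two by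
  symmetry.\<close>

lemma bundle_metric_frame_expand:
  fixes \<tau> :: "'e \<Rightarrow> 'f::finite_dim_inner"
  assumes g: "bundle_metric E g" and fr: "local_frame E U \<tau> \<rho>" and p: "p \<in> U"
    and x: "x \<in> fibre E p" and y: "y \<in> fibre E p"
  shows "g x y = (\<Sum>b\<in>onb. (\<tau> x \<bullet> b) *\<^sub>R (\<Sum>c\<in>onb. (\<tau> y \<bullet> c) *\<^sub>R g (\<rho> p b) (\<rho> p c)))"
proof -
  have pb: "p \<in> space_of (base E)" using local_frameD(1)[OF fr] p by (auto simp: open_of_def)
  note mem = local_frameD(4)[OF fr p]
  have lin: "linear (\<lambda>u. g (\<rho> p u) z)" if z: "z \<in> fibre E p" for z
    using bundle_metricD(2,3)[OF g pb mem] mem z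
    by (intro linearI) (simp_all add: local_frameD(6,7)[OF fr p])
  have half: "g w z = (\<Sum>b\<in>onb. (\<tau> w \<bullet> b) *\<^sub>R g (\<rho> p b) z)"
    if w: "w \<in> fibre E p" and z: "z \<in> fibre E p" for w z
    using linear_onb_expand[OF lin[OF z], of "\<tau> w"] local_frameD(3)[OF fr p w] by simp
  have "g (\<rho> p b) y = (\<Sum>c\<in>onb. (\<tau> y \<bullet> c) *\<^sub>R g (\<rho> p b) (\<rho> p c))" for b
  proof -
    have "g (\<rho> p b) y = g y (\<rho> p b)" by (rule bundle_metricD(1)[OF g pb mem y])
    also have "\<dots> = (\<Sum>c\<in>onb. (\<tau> y \<bullet> c) *\<^sub>R g (\<rho> p c) (\<rho> p b))" by (rule half[OF y mem])
    also have "\<dots> = (\<Sum>c\<in>onb. (\<tau> y \<bullet> c) *\<^sub>R g (\<rho> p b) (\<rho> p c))"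
      by (rule sum.cong[OF refl]) (simp add: bundle_metricD(1)[OF g pb mem mem, of b])
    finally show ?thesis .
  qed
  then show ?thesis using half[OF x y] by simp
qed

text \<open>Here \<open>a\<close> and \<open>b\<close> lie over \<open>h\<close>, so they need not
  be sections of \<open>E\<close>. The smoothness of \<open>g\<close> is applied to the frame
  sections alone: it makes the Gram entries smooth on the base, and composition with
  \<open>h\<close> pulls them back to \<open>A\<close>.\<close>

lemma smooth_at_bundle_metric:
  assumes A: "smooth_atlas A" and B: "smooth_atlas (base E)"
    and g: "bundle_metric E g" and fr: "local_frame E U \<tau> \<rho>"
    and V: "open_of A V" "e \<in> V"
    and h: "smooth_at A (base E) h e" "\<And>q. q \<in> V \<Longrightarrow> h q \<in> U"
    and a: "\<And>q. q \<in> V \<Longrightarrow> a q \<in> fibre E (h q)" "smooth_at A model_atlas (\<lambda>q. \<tau> (a q)) e"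
    and b: "\<And>q. q \<in> V \<Longrightarrow> b q \<in> fibre E (h q)" "smooth_at A model_atlas (\<lambda>q. \<tau> (b q)) e"
  shows "smooth_at A model_atlas (\<lambda>q. g (a q) (b q)) e"
proof -
  note inj = smooth_atlas_inj[OF A]
  have e: "e \<in> space_of A" by (rule smooth_at_space(1)[OF h(1)])
  have U: "open_of (base E) U" by (rule local_frameD(1)[OF fr])
  have gram: "smooth_at A model_atlas (\<lambda>q. g (\<rho> (h q) u) (\<rho> (h q) v)) e" for u v
  proof -
    have "smooth_map (restrict_atlas (base E) U) model_atlas (\<lambda>p. g (\<rho> p u) (\<rho> p v))"
      by (rule bundle_metric_smooth[OF g B U local_frameD(2)[OF fr] local_frameD(2)[OF fr]])
    then have "smooth_at (restrict_atlas (base E) U) model_atlas (\<lambda>p. g (\<rho> p u) (\<rho> p v)) (h e)"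
      using h(2)[OF V(2)] smooth_at_space(2)[OF h(1)]
      by (intro smooth_map_smooth_at) (simp_all add: space_of_restrict_atlas)
    then have "smooth_at (base E) model_atlas (\<lambda>p. g (\<rho> p u) (\<rho> p v)) (h e)"
      using smooth_at_restrict_source[OF smooth_atlas_inj[OF B] U h(2)[OF V(2)]] by blast
    from smooth_at_compose[OF h(1) this inj smooth_atlas_inj[OF B]] show ?thesis .
  qed
  have "smooth_at A model_atlas (\<lambda>q. \<Sum>u\<in>onb. (\<tau> (a q) \<bullet> u) *\<^sub>R
      (\<Sum>v\<in>onb. (\<tau> (b q) \<bullet> v) *\<^sub>R g (\<rho> (h q) u) (\<rho> (h q) v))) e"
    by (intro smooth_at_model_sum[OF A e] smooth_at_model_scaleR inj gram
      smooth_at_model_linear[OF a(2) inj bounded_linear_inner_left]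
      smooth_at_model_linear[OF b(2) inj bounded_linear_inner_left])
  then show ?thesis
    by (rule smooth_at_cong[OF _ inj V])
      (rule bundle_metric_frame_expand[OF g fr h(2) a(1) b(1), symmetric])
qed

section \<open>Coordinate frames of the tangent bundle\<close>

text \<open>The vector field with constant components \<open>u\<close> in the chart
  \<open>c\<close>, that is, a constant combination of the coordinate vector fields.\<close>

definition coord_field ::
    "('a, 'm::finite_dim_inner) atlas \<Rightarrow> ('a, 'm) chart \<Rightarrow> 'a \<Rightarrow> 'm \<Rightarrow> ('a, 'm) tangent"
  where "coord_field A c p u = (p, \<lambda>d. if d \<in> charts_at A p
    then frechet_derivative (snd d \<circ> param c) (at (snd c p)) u else 0)"

lemma open_of_chart_domain: "smooth_atlas A \<Longrightarrow> c \<in> A \<Longrightarrow> open_of A (fst c)"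
  by (auto simp: open_of_def smooth_atlas_def space_of_def Int_commute)

lemma open_of_Int: "smooth_atlas A \<Longrightarrow> open_of A S \<Longrightarrow> open_of A T \<Longrightarrow> open_of A (S \<inter> T)"
  using istopology_open_of unfolding istopology_def by metis

lemma transition_differentiable:
  assumes A: "smooth_atlas A" and c: "c \<in> charts_at A p" and d: "d \<in> charts_at A p"
  shows "(snd d \<circ> param c) differentiable at (snd c p)"
  using smooth_at_differentiable[OF smooth_at_ident[OF A charts_at_space[OF c]] c d]
  by (simp add: comp_def)

lemma transition_chain:
  assumes A: "smooth_atlas A" and c: "c \<in> charts_at A p" and d: "d \<in> charts_at A p"
    and k: "k \<in> charts_at A p"
  shows "frechet_derivative (snd d \<circ> param c) (at (snd c p)) v =
    frechet_derivative (snd d \<circ> param k) (at (snd k p))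
      (frechet_derivative (snd k \<circ> param c) (at (snd c p)) v)"
proof -
  note id = smooth_at_ident[OF A charts_at_space[OF c]] and inj = smooth_atlas_inj[OF A]
  show ?thesis using smooth_at_frechet_chain[OF id id inj inj c k d, of v] by (simp only: comp_def)
qed

lemma coord_field_tangent:
  assumes A: "smooth_atlas A" and c: "c \<in> charts_at A p"
  shows "coord_field A c p u \<in> tangent_space A p"
  unfolding tangent_space_iff coord_field_def fst_conv snd_conv
proof (intro conjI allI impI ballI)
  fix k d assume kd: "k \<in> charts_at A p" "d \<in> charts_at A p"
  show "(if d \<in> charts_at A p then frechet_derivative (snd d \<circ> param c) (at (snd c p)) u else 0) =
    frechet_derivative (snd d \<circ> param k) (at (snd k p))
      (if k \<in> charts_at A p then frechet_derivative (snd k \<circ> param c) (at (snd c p)) u else 0)"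
    unfolding if_P[OF kd(1)] if_P[OF kd(2)] by (rule transition_chain[OF A c kd(2,1)])
qed simp_all

lemma coord_field_coord:
  assumes A: "smooth_atlas A" and c: "c \<in> charts_at A p"
  shows "snd (coord_field A c p u) c = u"
proof -
  have "frechet_derivative (snd c \<circ> param c) (at (snd c p)) = frechet_derivative (\<lambda>x. x) (at (snd c p))"
  proof (rule frechet_derivative_cong_open)
    show "open (snd c ` fst c)" by (rule smooth_atlas_open[OF A charts_atD(1)[OF c]])
    show "snd c p \<in> snd c ` fst c" using charts_atD(2)[OF c] by blast
    show "(snd c \<circ> param c) y = y" if "y \<in> snd c ` fst c" for y
      using that param_coord[OF smooth_atlas_inj[OF A] charts_atD(1)[OF c]] by auto
  qed
  then show ?thesis using c by (simp add: coord_field_def)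
qed

lemma fibre_tangent_bundle:
  "p \<in> space_of A \<Longrightarrow> fibre (tangent_bundle A) p = tangent_space A p"
  unfolding fibre_def tangent_bundle_def by (auto simp: space_of_tangent_atlas dest: tangent_spaceD(1))

lemma smooth_section_coord_field:
  assumes A: "smooth_atlas A" and c: "c \<in> A"
  shows "smooth_section (tangent_bundle A) (fst c) (\<lambda>p. coord_field A c p u)"
proof -
  note inj = smooth_atlas_inj[OF A]
  note V = open_of_chart_domain[OF A c]
  have "smooth_at A (tangent_atlas A) (\<lambda>p. coord_field A c p u) p" if p: "p \<in> fst c" for p
  proof (rule smooth_at_into_tangent_atlas[OF A inj V p, where f="\<lambda>q. q"])
    show "coord_field A c q u \<in> tangent_space A q" if q: "q \<in> fst c" for q
      by (rule coord_field_tangent[OF A charts_atI[OF c q]])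
    show "smooth_at A A (\<lambda>q. q) p"
      by (rule smooth_at_ident[OF A charts_at_space[OF charts_atI[OF c p]]])
    fix d assume d: "d \<in> charts_at A p"
    \<comment> \<open>Seen in another chart \<open>d\<close>, the field is the derivative of the
      transition map in the fixed direction \<open>u\<close>, evaluated at the coordinates of the
      point.\<close>
    let ?G = "\<lambda>y. frechet_derivative (snd d \<circ> param c) (at y) u"
    have "open (snd c ` (fst c \<inter> fst d))" "smooth_on (snd d \<circ> param c) (snd c ` (fst c \<inter> fst d))"
      using A c charts_atD(1)[OF d] unfolding smooth_atlas_def by blast+
    then have "smooth_at model_atlas model_atlas ?G (snd c p)"
      using p charts_atD(2)[OF d] by (intro smooth_at_model_model smooth_on_frechet_derivative) auto
    from smooth_at_compose[OF smooth_at_coord[OF A charts_atI[OF c p]] this inj inj_model_atlas]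
    have "smooth_at A model_atlas (\<lambda>q. ?G (snd c q)) p" .
    then show "smooth_at A model_atlas (\<lambda>q. snd (coord_field A c q u) d) p"
    proof (rule smooth_at_cong[OF _ inj])
      show "open_of A (fst c \<inter> fst d)"
        by (intro open_of_Int A V open_of_chart_domain charts_atD(1)[OF d])
      show "p \<in> fst c \<inter> fst d" using p charts_atD(2)[OF d] by simp
      show "?G (snd c q) = snd (coord_field A c q u) d" if "q \<in> fst c \<inter> fst d" for q
        using that charts_atI[OF charts_atD(1)[OF d]] by (simp add: coord_field_def)
    qed
  qed
  then have "smooth_at (restrict_atlas A (fst c)) (tangent_atlas A) (\<lambda>p. coord_field A c p u) p"
    if "p \<in> fst c" for p
    using smooth_at_restrict_source[OF inj V that] that by blast
  then show ?thesis
    unfolding smooth_section_def smooth_map_iff_smooth_at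
    by (simp add: tangent_bundle_def space_of_restrict_atlas coord_field_def)
qed

lemma local_frame_coord_field:
  assumes A: "smooth_atlas A" and c: "c \<in> A"
  shows "local_frame (tangent_bundle A) (fst c) (\<lambda>v. snd v c) (coord_field A c)"
  unfolding local_frame_def
proof (intro conjI allI ballI)
  show "open_of (base (tangent_bundle A)) (fst c)"
    using open_of_chart_domain[OF A c] by (simp add: tangent_bundle_def)
  show "smooth_section (tangent_bundle A) (fst c) (\<lambda>p. coord_field A c p u)" for u
    by (rule smooth_section_coord_field[OF A c])
  fix p assume p: "p \<in> fst c"
  note cp = charts_atI[OF c p]
  note fib = fibre_tangent_bundle[OF charts_at_space[OF cp]]
  show mem: "coord_field A c p u \<in> fibre (tangent_bundle A) p" for u
    unfolding fib by (rule coord_field_tangent[OF A cp])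
  show "snd (coord_field A c p u) c = u" for u
    by (rule coord_field_coord[OF A cp])
  show "coord_field A c p (snd x c) = x" if "x \<in> fibre (tangent_bundle A) p" for x
    using tangent_space_ext[OF coord_field_tangent[OF A cp] _ cp coord_field_coord[OF A cp]] that
    unfolding fib by blast
  have lin: "linear (frechet_derivative (\<psi> \<circ> param c) (at (snd c p)))"
    if "(V, \<psi>) \<in> charts_at A p" for V \<psi>
    using transition_differentiable[OF A cp that] by (simp add: linear_frechet_derivative)
  show "coord_field A c p (u + v) =
      fibre_add (tangent_bundle A) (coord_field A c p u) (coord_field A c p v)" for u v
    using lin by (simp add: coord_field_def tangent_bundle_def fun_eq_iff linear_add)
  show "coord_field A c p (r *\<^sub>R u) = fibre_scale (tangent_bundle A) r (coord_field A c p u)" for r u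
    using lin by (simp add: coord_field_def tangent_bundle_def fun_eq_iff linear_cmul)
qed

section \<open>Frames from local trivializations\<close>

lemma real_vector_space_onD:
  assumes "real_vector_space_on V pl sc z"
  shows "z \<in> V" "x \<in> V \<Longrightarrow> y \<in> V \<Longrightarrow> pl x y \<in> V" "x \<in> V \<Longrightarrow> sc r x \<in> V"
    and "x \<in> V \<Longrightarrow> pl x z = x" "x \<in> V \<Longrightarrow> sc 0 x = z" "sc r z = z"
proof -
  show z: "z \<in> V" and pl: "x \<in> V \<Longrightarrow> y \<in> V \<Longrightarrow> pl x y \<in> V"
    and sc: "x \<in> V \<Longrightarrow> sc r x \<in> V" for x y r
    using assms unfolding real_vector_space_on_def by simp_all
  have com: "\<forall>x\<in>V. \<forall>y\<in>V. pl x y = pl y x"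
    using assms unfolding real_vector_space_on_def by (elim conjE)
  have neut: "\<forall>x\<in>V. pl z x = x"
    using assms unfolding real_vector_space_on_def by (elim conjE)
  show neut': "x \<in> V \<Longrightarrow> pl x z = x" for x
    using com neut z by metis
  show zero: "sc 0 x = z" if x: "x \<in> V" for x
  proof -
    let ?w = "sc 0 x"
    have w: "?w \<in> V" by (rule sc[OF x])
    have "\<forall>r s. \<forall>x\<in>V. sc (r + s) x = pl (sc r x) (sc s x)"
      using assms unfolding real_vector_space_on_def by simp
    \<comment> \<open>From 0 + 0 = 0, the multiple by zero is idempotent under addition; adding an
      additive inverse leaves the neutral element.\<close>
    then have ww: "pl ?w ?w = ?w" using x by (metis add_0)
    have inv: "\<forall>x\<in>V. \<exists>y\<in>V. pl x y = z"
      using assms unfolding real_vector_space_on_def by (elim conjE)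
    obtain y where y: "y \<in> V" "pl ?w y = z" using bspec[OF inv w] by (elim bexE)
    have assoc: "\<forall>x\<in>V. \<forall>y\<in>V. \<forall>u\<in>V. pl (pl x y) u = pl x (pl y u)"
      using assms unfolding real_vector_space_on_def by (elim conjE)
    have "pl (pl ?w ?w) y = pl ?w (pl ?w y)" using assoc w y(1) by simp
    then show ?thesis using ww y neut'[OF w] by simp
  qed
  have "\<forall>r s. \<forall>x\<in>V. sc r (sc s x) = sc (r * s) x"
    using assms unfolding real_vector_space_on_def by (elim conjE)
  then have "sc r (sc 0 z) = sc (r * 0) z" using z by blast
  then show "sc r z = z" using zero[OF z] by simp
qed

text \<open>Unlike \<^const>\<open>local_frame\<close>, this records joint smoothness in base point and coordinates.\<close>

definition smooth_frame ::
    "('a, 'm::finite_dim_inner, 'e, 'n::finite_dim_inner) vbundle \<Rightarrow> 'a set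
      \<Rightarrow> ('e \<Rightarrow> 'f::finite_dim_inner) \<Rightarrow> ('a \<Rightarrow> 'f \<Rightarrow> 'e) \<Rightarrow> bool"
  where "smooth_frame E U \<tau> \<rho> \<longleftrightarrow> local_frame E U \<tau> \<rho> \<and>
    (\<forall>e\<in>space_of (total E). proj E e \<in> U \<longrightarrow>
      smooth_at (total E) (product_atlas (restrict_atlas (base E) U) model_atlas)
        (\<lambda>e. (proj E e, \<tau> e)) e) \<and>
    (\<forall>p\<in>U. \<forall>u. smooth_at (product_atlas (restrict_atlas (base E) U) model_atlas) (total E)
      (\<lambda>z. \<rho> (fst z) (snd z)) (p, u))"

lemma vector_bundleD:
  assumes "vector_bundle TYPE('f::finite_dim_inner) E"
  shows "smooth_atlas (base E)" "smooth_atlas (total E)" "smooth_map (total E) (base E) (proj E)"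
    and "p \<in> space_of (base E) \<Longrightarrow>
      real_vector_space_on (fibre E p) (fibre_add E) (fibre_scale E) (zero_section E p)"
    and "p \<in> space_of (base E) \<Longrightarrow> \<exists>U (\<tau> :: _ \<Rightarrow> 'f). p \<in> U \<and> local_trivialization E U \<tau>"
  using assms unfolding vector_bundle_def smooth_manifold_def by simp_all

text \<open>The frame is the inverse of the trivialization, read as a function of base point and
  coordinates. It is fibrewise linear because \<open>\<tau>\<close> is and \<open>\<rho> p\<close>
  inverts \<open>\<tau>\<close> on the fibre at \<open>p\<close>.\<close>

lemma smooth_frame_of_trivialization:
  fixes E :: "('a, 'm::finite_dim_inner, 'e, 'n::finite_dim_inner) vbundle"
    and \<tau> :: "'e \<Rightarrow> 'f::finite_dim_inner"
  assumes E: "vector_bundle TYPE('f) E" and triv: "local_trivialization E U \<tau>"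
  shows "\<exists>\<rho>. smooth_frame E U \<tau> \<rho>"
proof -
  let ?B = "base E" and ?T = "total E"
  let ?P = "product_atlas (restrict_atlas ?B U) (model_atlas :: ('f, 'f) atlas)"
  define D where "D = {e \<in> space_of ?T. proj E e \<in> U}"
  define \<Psi> where "\<Psi> = (\<lambda>e. (proj E e, \<tau> e))"
  \<comment> \<open>\<open>D\<close> is the space of the restricted total atlas, so this is exactly
    the inverse whose smoothness is part of \<open>diffeomorphism\<close>.\<close>
  define \<Phi> where "\<Phi> = inv_into D \<Psi>"
  define \<rho> where "\<rho> = (\<lambda>p u. \<Phi> (p, u))"
  note B = vector_bundleD(1)[OF E] and T = vector_bundleD(2)[OF E] and pr = vector_bundleD(3)[OF E]
  note Bi = smooth_atlas_inj[OF B] and Ti = smooth_atlas_inj[OF T]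
  have U: "open_of ?B U" using triv by (simp add: local_trivialization_def openin_manifold_topology[OF B])
  then have US: "U \<subseteq> space_of ?B" by (simp add: open_of_def)
  have D: "open_of ?T D" unfolding D_def by (rule open_of_vimage[OF pr Ti Bi U])
  have sD: "space_of (restrict_atlas ?T D) = D" by (auto simp: space_of_restrict_atlas D_def)
  have sP: "space_of ?P = U \<times> UNIV"
    using US by (auto simp: space_of_product_model_atlas space_of_restrict_atlas)
  have diff: "diffeomorphism (restrict_atlas ?T D) ?P \<Psi>"
    using triv by (simp add: local_trivialization_def D_def \<Psi>_def)
  have bij: "bij_betw \<Psi> D (U \<times> UNIV)" and sm: "smooth_map (restrict_atlas ?T D) ?P \<Psi>"
    and smi: "smooth_map ?P (restrict_atlas ?T D) \<Phi>"
    using diff by (simp_all add: diffeomorphism_def sD sP \<Phi>_def)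
  have Pi: "inj_atlas ?P" by (intro inj_product_model_atlas inj_restrict_atlas Bi)
  have PsiPhi: "\<Psi> (\<Phi> z) = z" and PhiD: "\<Phi> z \<in> D" if "z \<in> U \<times> UNIV" for z
    using that bij unfolding \<Phi>_def bij_betw_def by (metis f_inv_into_f, metis inv_into_into)
  have PhiPsi: "\<Phi> (\<Psi> e) = e" if "e \<in> D" for e
    using that bij unfolding \<Phi>_def bij_betw_def by (metis inv_into_f_f)
  have fibD: "fibre E p \<subseteq> D" if "p \<in> U" for p using that by (auto simp: fibre_def D_def)
  have sPhi: "smooth_at ?P ?T \<Phi> z" if "z \<in> U \<times> UNIV" for z
    by (rule smooth_at_from_restrict_target[OF smooth_map_smooth_at[OF smi]]) (simp only: sP that)
  have sPsi: "smooth_at ?T ?P \<Psi> e" if "e \<in> D" for e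
  proof -
    have "smooth_at (restrict_atlas ?T D) ?P \<Psi> e"
      by (rule smooth_map_smooth_at[OF sm]) (simp only: sD that)
    then show ?thesis using smooth_at_restrict_source[OF Ti D that] by blast
  qed
  have rho_mem: "\<rho> p u \<in> fibre E p" if p: "p \<in> U" for p u
    using PhiD[of "(p, u)"] PsiPhi[of "(p, u)"] p by (simp add: \<rho>_def fibre_def D_def \<Psi>_def)
  have tau_rho: "\<tau> (\<rho> p u) = u" if p: "p \<in> U" for p u
    using PsiPhi[of "(p, u)"] p by (simp add: \<rho>_def \<Psi>_def)
  have rho_tau: "\<rho> p (\<tau> x) = x" if p: "p \<in> U" and x: "x \<in> fibre E p" for p x
    using PhiPsi[of x] fibD[OF p] x by (auto simp: \<rho>_def \<Psi>_def fibre_def)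
  have "local_frame E U \<tau> \<rho>"
    unfolding local_frame_def
  proof (intro conjI allI ballI)
    show "open_of ?B U" by (rule U)
    fix u
    have "smooth_at (restrict_atlas ?B U) ?T (\<lambda>q. \<Phi> (q, u)) p" if p: "p \<in> U" for p
    proof -
      \<comment> \<open>Freezing \<open>u\<close> embeds \<open>U\<close> smoothly into the product;
        the identity is first restricted in its target and then in its source.\<close>
      have "smooth_at ?B ?B (\<lambda>q. q) p" using p US by (intro smooth_at_ident[OF B]) auto
      then have "smooth_at ?B (restrict_atlas ?B U) (\<lambda>q. q) p"
        by (rule smooth_at_into_restrict[where f="\<lambda>q. q", OF _ Bi Bi U p])
      then have "smooth_at (restrict_atlas ?B U) (restrict_atlas ?B U) (\<lambda>q. q) p"
        using smooth_at_restrict_source[OF Bi U p] by blast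
      then have "smooth_at (restrict_atlas ?B U) ?P (\<lambda>q. (q, u)) p"
        by (rule smooth_at_into_product_model[where f="\<lambda>q. q", OF _ inj_restrict_atlas[OF Bi]])
      moreover have "smooth_at ?P ?T \<Phi> (p, u)" using sPhi p by simp
      ultimately show ?thesis
        by (rule smooth_at_compose[where f="\<lambda>q. (q, u)", OF _ _ inj_restrict_atlas[OF Bi] Pi])
    qed
    then show "smooth_section E U (\<lambda>p. \<rho> p u)"
      using rho_mem unfolding smooth_section_def smooth_map_iff_smooth_at
      by (simp add: space_of_restrict_atlas \<rho>_def fibre_def)
  next
    fix p assume p: "p \<in> U"
    note vs = vector_bundleD(4)[OF E subsetD[OF US p]]
    have tr: "\<And>x y. x \<in> fibre E p \<Longrightarrow> y \<in> fibre E p \<Longrightarrow> \<tau> (fibre_add E x y) = \<tau> x + \<tau> y"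
      "\<And>x r. x \<in> fibre E p \<Longrightarrow> \<tau> (fibre_scale E r x) = r *\<^sub>R \<tau> x"
      using triv p unfolding local_trivialization_def by simp_all
    show "\<rho> p (u + v) = fibre_add E (\<rho> p u) (\<rho> p v)" for u v
      using rho_tau[OF p real_vector_space_onD(2)[OF vs rho_mem[OF p] rho_mem[OF p]], of u v]
      by (simp add: tr rho_mem p tau_rho)
    show "\<rho> p (r *\<^sub>R u) = fibre_scale E r (\<rho> p u)" for r u
      using rho_tau[OF p real_vector_space_onD(3)[OF vs rho_mem[OF p]], of r u]
      by (simp add: tr rho_mem p tau_rho)
  qed (use rho_mem tau_rho rho_tau in simp_all)
  then have "smooth_frame E U \<tau> \<rho>"
    using sPhi sPsi unfolding smooth_frame_def by (simp add: D_def \<Psi>_def \<rho>_def)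
  then show ?thesis by (intro exI[of _ \<rho>])
qed

section \<open>Vertical vectors\<close>

abbreviation triv_atlas :: "('a, 'm, 'e, 'n) vbundle \<Rightarrow> 'a set \<Rightarrow> ('a \<times> 'f, 'm \<times> 'f) atlas"
  where "triv_atlas E U \<equiv> product_atlas (restrict_atlas (base E) U) model_atlas"

definition triv_chart :: "('a, 'm) chart \<Rightarrow> 'a set \<Rightarrow> ('a \<times> 'f, 'm \<times> 'f) chart"
  where "triv_chart c U = ((fst c \<inter> U) \<times> UNIV, map_prod (snd c) (\<lambda>x. x))"

lemma triv_chart_in:
  "c \<in> charts_at (base E) p \<Longrightarrow> p \<in> U \<Longrightarrow> triv_chart c U \<in> charts_at (triv_atlas E U) (p, a)"
  by (auto simp: charts_at_product_model_atlas charts_at_restrict_atlas triv_chart_def image_image)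

lemma inj_triv_atlas: "smooth_atlas (base E) \<Longrightarrow> inj_atlas (triv_atlas E U)"
  by (intro inj_product_model_atlas inj_restrict_atlas smooth_atlas_inj)

lemma smooth_frameD:
  assumes "smooth_frame E U \<tau> \<rho>"
  shows "local_frame E U \<tau> \<rho>"
    and "e \<in> space_of (total E) \<Longrightarrow> proj E e \<in> U \<Longrightarrow>
      smooth_at (total E) (triv_atlas E U) (\<lambda>e. (proj E e, \<tau> e)) e"
    and "p \<in> U \<Longrightarrow> smooth_at (triv_atlas E U) (total E) (\<lambda>z. \<rho> (fst z) (snd z)) (p, u)"
  using assms unfolding smooth_frame_def by simp_all

lemma proj_in_base:
  assumes "vector_bundle TYPE('f::finite_dim_inner) E" "e \<in> space_of (total E)"
  shows "proj E e \<in> space_of (base E)" "e \<in> fibre E (proj E e)"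
  using smooth_at_space(2)[OF smooth_map_smooth_at[OF vector_bundleD(3)[OF assms(1)] assms(2)]] assms(2)
  by (simp_all add: fibre_def)

lemma smooth_frame_exists:
  fixes E :: "('a, 'm::finite_dim_inner, 'e, 'n::finite_dim_inner) vbundle"
  assumes E: "vector_bundle TYPE('f::finite_dim_inner) E" and p: "p \<in> space_of (base E)"
  shows "\<exists>U (\<tau> :: 'e \<Rightarrow> 'f) \<rho>. p \<in> U \<and> smooth_frame E U \<tau> \<rho>"
proof -
  obtain U and \<tau> :: "'e \<Rightarrow> 'f" where "p \<in> U" "local_trivialization E U \<tau>"
    using vector_bundleD(5)[OF E p] by (elim exE conjE)
  then show ?thesis using smooth_frame_of_trivialization[OF E] by meson
qed

lemma vertical_line_frame:
  assumes fr: "local_frame E U \<tau> \<rho>" and p: "p \<in> U" and e: "e \<in> fibre E p" and \<eta>: "\<eta> \<in> fibre E p"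
  shows "fibre_add E e (fibre_scale E t \<eta>) = \<rho> p (\<tau> e + t *\<^sub>R \<tau> \<eta>)"
  using local_frameD(6,7)[OF fr p] local_frameD(3)[OF fr p e] local_frameD(3)[OF fr p \<eta>] by simp

lemma fst_vert:
  assumes E: "vector_bundle TYPE('f::finite_dim_inner) E" and e: "e \<in> space_of (total E)"
    and \<eta>: "\<eta> \<in> fibre E (proj E e)"
  shows "fibre_add E e (fibre_scale E 0 \<eta>) = e" "fst (vert E e \<eta>) = e"
proof -
  note vs = vector_bundleD(4)[OF E proj_in_base(1)[OF E e]]
  show "fibre_add E e (fibre_scale E 0 \<eta>) = e"
    using real_vector_space_onD(4)[OF vs proj_in_base(2)[OF E e]] real_vector_space_onD(5)[OF vs \<eta>]
    by simp
  then show "fst (vert E e \<eta>) = e" by (simp add: vert_def velocity_def)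
qed

lemma vert_outside:
  assumes E: "vector_bundle TYPE('f::finite_dim_inner) E" and e: "e \<in> space_of (total E)"
    and \<eta>: "\<eta> \<in> fibre E (proj E e)" and k: "k \<notin> charts_at (total E) e"
  shows "snd (vert E e \<eta>) k = 0"
  using k fst_vert(1)[OF E e \<eta>] by (simp add: vert_def velocity_def)

text \<open>The curve through \<open>e\<close> in direction \<open>\<eta>\<close> has fixed base
  point and fibre coordinates \<open>\<tau> e + t *\<^sub>R \<tau> \<eta>\<close>. It is thus the
  image under the frame of a straight line with velocity \<open>(0, \<tau> \<eta>)\<close>, and the
  chain rule applies.\<close>

lemma vert_coord:
  fixes \<tau> :: "'e \<Rightarrow> 'f::finite_dim_inner"
  assumes E: "vector_bundle TYPE('f) E" and fr: "smooth_frame E U \<tau> \<rho>"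
    and e: "e \<in> space_of (total E)" and p: "proj E e \<in> U" and \<eta>: "\<eta> \<in> fibre E (proj E e)"
    and k: "k \<in> charts_at (total E) e" and c: "c \<in> charts_at (base E) (proj E e)"
  shows "snd (vert E e \<eta>) k =
    frechet_derivative (snd k \<circ> (\<lambda>z. \<rho> (fst z) (snd z)) \<circ> param (triv_chart c U))
      (at (snd (triv_chart c U) (proj E e, \<tau> e))) (0, \<tau> \<eta>)"
proof -
  let ?p = "proj E e" and ?C = "triv_chart c U :: ('a \<times> 'f, _) chart"
  let ?\<Phi> = "\<lambda>z. \<rho> (fst z) (snd z)"
  let ?H = "snd k \<circ> ?\<Phi> \<circ> param ?C"
  let ?l = "\<lambda>t::real. (snd c ?p, \<tau> e + t *\<^sub>R \<tau> \<eta>)"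
  note lf = smooth_frameD(1)[OF fr]
  have C: "?C \<in> charts_at (triv_atlas E U) (?p, a)" for a by (rule triv_chart_in[OF c p])
  have pC: "param ?C (snd c ?p, u) = (?p, u)" for u
    using param_coord_at[OF inj_triv_atlas[OF vector_bundleD(1)[OF E]] C[of u]]
    by (simp add: triv_chart_def)
  have e0: "?\<Phi> (?p, \<tau> e) = e"
    using local_frameD(3)[OF lf p proj_in_base(2)[OF E e]] by simp
  have "k \<in> charts_at (total E) (?\<Phi> (?p, \<tau> e))" unfolding e0 by (rule k)
  from smooth_at_differentiable[OF smooth_frameD(3)[OF fr p] C this]
  have H: "?H differentiable at (snd ?C (?p, \<tau> e))" .
  have l0: "snd ?C (?p, \<tau> e) = ?l 0" by (simp add: triv_chart_def)
  define L where "L = frechet_derivative ?H (at (snd ?C (?p, \<tau> e)))"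
  have HL: "(?H has_derivative L) (at (?l 0))"
    using has_derivative_frechet[OF H] unfolding L_def l0 .
  have "(?l has_derivative (\<lambda>t. (0, t *\<^sub>R \<tau> \<eta>))) (at 0)"
    by (auto intro!: derivative_eq_intros)
  from has_derivative_compose[OF this HL]
  have "((\<lambda>t. ?H (?l t)) has_derivative (\<lambda>t. L (0, t *\<^sub>R \<tau> \<eta>))) (at 0)" .
  moreover have "linear L" using H unfolding L_def by (rule linear_frechet_derivative)
  then have "L (0, t *\<^sub>R \<tau> \<eta>) = t *\<^sub>R L (0, \<tau> \<eta>)" for t
    using linear_cmul[of L t "(0, \<tau> \<eta>)"] by simp
  moreover have "?H (?l t) = (snd k \<circ> (\<lambda>t. fibre_add E e (fibre_scale E t \<eta>))) t" for t
    by (simp add: pC vertical_line_frame[OF lf p proj_in_base(2)[OF E e] \<eta>])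
  ultimately have "((snd k \<circ> (\<lambda>t. fibre_add E e (fibre_scale E t \<eta>))) has_vector_derivative L (0, \<tau> \<eta>)) (at 0)"
    by (simp add: has_vector_derivative_def comp_def)
  then have "vector_derivative (snd k \<circ> (\<lambda>t. fibre_add E e (fibre_scale E t \<eta>))) (at 0) = L (0, \<tau> \<eta>)"
    by (rule vector_derivative_at)
  then show ?thesis
    using k fst_vert(1)[OF E e \<eta>] by (simp add: vert_def velocity_def L_def)
qed

text \<open>Every representative of the lift is the derivative of the frame map, in the
  corresponding chart, applied to the same vector \<open>(0, \<tau> \<eta>)\<close>; the chain rule
  with the identity of \<open>E\<close> relates any two of them.\<close>

lemma vert_in_tangent_space:
  assumes E: "vector_bundle TYPE('f::finite_dim_inner) E" and e: "e \<in> space_of (total E)"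
    and \<eta>: "\<eta> \<in> fibre E (proj E e)"
  shows "vert E e \<eta> \<in> tangent_space (total E) e"
  unfolding tangent_space_iff
proof (intro conjI allI impI ballI)
  fix k d assume k: "k \<in> charts_at (total E) e" and d: "d \<in> charts_at (total E) e"
  let ?p = "proj E e"
  note T = vector_bundleD(2)[OF E]
  have pb: "?p \<in> space_of (base E)" by (rule proj_in_base(1)[OF E e])
  then obtain c where c: "c \<in> charts_at (base E) ?p" by (auto simp: space_of_charts_at)
  obtain U and \<tau> :: "_ \<Rightarrow> 'f" and \<rho> where p: "?p \<in> U" and fr: "smooth_frame E U \<tau> \<rho>"
    using smooth_frame_exists[OF E pb] by (elim exE conjE)
  let ?\<Phi> = "\<lambda>z. \<rho> (fst z) (snd z)"
  have e0: "?\<Phi> (?p, \<tau> e) = e"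
    using local_frameD(3)[OF smooth_frameD(1)[OF fr] p proj_in_base(2)[OF E e]] by simp
  have id: "smooth_at (total E) (total E) (\<lambda>x. x) (?\<Phi> (?p, \<tau> e))"
    and kd: "k \<in> charts_at (total E) (?\<Phi> (?p, \<tau> e))" "d \<in> charts_at (total E) (?\<Phi> (?p, \<tau> e))"
    unfolding e0 by (rule smooth_at_ident[OF T e] k d)+
  show "snd (vert E e \<eta>) d =
      frechet_derivative (snd d \<circ> param k) (at (snd k e)) (snd (vert E e \<eta>) k)"
    using smooth_at_frechet_chain[OF smooth_frameD(3)[OF fr p] id inj_triv_atlas[OF vector_bundleD(1)[OF E]]
        smooth_atlas_inj[OF T] triv_chart_in[OF c p] kd, of "(0, \<tau> \<eta>)"]
    unfolding vert_coord[OF E fr e p \<eta> k c] vert_coord[OF E fr e p \<eta> d c] e0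
    by (simp only: comp_def)
qed (simp_all add: fst_vert[OF E e \<eta>] vert_outside[OF E e \<eta>])

text \<open>Through the frame the projection becomes the first projection of the product, whose
  derivative kills \<open>(0, \<tau> \<eta>)\<close>.\<close>

lemma tangent_proj_vert:
  fixes E :: "('a, 'm::finite_dim_inner, 'e, 'n::finite_dim_inner) vbundle"
  assumes E: "vector_bundle TYPE('f::finite_dim_inner) E" and e: "e \<in> space_of (total E)"
    and \<eta>: "\<eta> \<in> fibre E (proj E e)"
  shows "tangent_proj E (vert E e \<eta>) = (proj E e, \<lambda>c. 0)"
proof -
  let ?p = "proj E e"
  note B = vector_bundleD(1)[OF E] and T = vector_bundleD(2)[OF E]
  note pr = smooth_map_smooth_at[OF vector_bundleD(3)[OF E] e]
  have pb: "?p \<in> space_of (base E)" by (rule proj_in_base(1)[OF E e])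
  obtain k where k: "k \<in> charts_at (total E) e" using e by (auto simp: space_of_charts_at)
  obtain U and \<tau> :: "'e \<Rightarrow> 'f" and \<rho> where p: "?p \<in> U" and fr: "smooth_frame E U \<tau> \<rho>"
    using smooth_frame_exists[OF E pb] by (elim exE conjE)
  note lf = smooth_frameD(1)[OF fr]
  let ?\<Phi> = "\<lambda>z. \<rho> (fst z) (snd z)"
  have e0: "?\<Phi> (?p, \<tau> e) = e"
    using local_frameD(3)[OF lf p proj_in_base(2)[OF E e]] by simp
  have "snd (tangent_proj E (vert E e \<eta>)) c = 0" if c: "c \<in> charts_at (base E) ?p" for c
  proof -
    let ?C = "triv_chart c U :: ('a \<times> 'f, _) chart"
    have C: "?C \<in> charts_at (triv_atlas E U) (?p, \<tau> e)" by (rule triv_chart_in[OF c p])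
    have pr': "smooth_at (total E) (base E) (proj E) (?\<Phi> (?p, \<tau> e))"
      and k': "k \<in> charts_at (total E) (?\<Phi> (?p, \<tau> e))"
      and c': "c \<in> charts_at (base E) (proj E (?\<Phi> (?p, \<tau> e)))"
      unfolding e0 by (rule pr k c)+
    have "frechet_derivative (snd c \<circ> (\<lambda>z. proj E (?\<Phi> z)) \<circ> param ?C) (at (snd ?C (?p, \<tau> e))) =
        frechet_derivative fst (at (snd ?C (?p, \<tau> e)))"
    proof (rule frechet_derivative_cong_open)
      have "snd ?C ` fst ?C = (snd c ` (U \<inter> fst c)) \<times> UNIV"
        by (auto simp: triv_chart_def image_iff)
      then show "open (snd ?C ` fst ?C)"
        by (simp add: open_Times open_of_chart[OF local_frameD(1)[OF lf] charts_atD(1)[OF c]])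
      show "snd ?C (?p, \<tau> e) \<in> snd ?C ` fst ?C" using charts_atD(2)[OF C] by blast
      fix y assume "y \<in> snd ?C ` fst ?C"
      then obtain z where z: "z \<in> fst ?C" "y = snd ?C z" by blast
      have "param ?C y = z"
        unfolding z(2) by (rule param_coord[OF inj_triv_atlas[OF B] charts_atD(1)[OF C] z(1)])
      moreover have "fst z \<in> U" using z(1) by (auto simp: triv_chart_def)
      then have "proj E (?\<Phi> z) = fst z" using local_frameD(4)[OF lf, of "fst z" "snd z"] by (simp add: fibre_def)
      ultimately show "(snd c \<circ> (\<lambda>z. proj E (?\<Phi> z)) \<circ> param ?C) y = fst y"
        by (simp add: z(2) triv_chart_def)
    qed
    moreover have "frechet_derivative fst (at y) v = fst v" for y v :: "'m \<times> 'f"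
      by (rule frechet_derivative_eqI) (rule has_derivative_fst[OF has_derivative_ident])
    ultimately have "0 = frechet_derivative (snd c \<circ> (\<lambda>z. proj E (?\<Phi> z)) \<circ> param ?C)
        (at (snd ?C (?p, \<tau> e))) (0, \<tau> \<eta>)"
      by simp
    also have "\<dots> = frechet_derivative (snd c \<circ> proj E \<circ> param k) (at (snd k e)) (snd (vert E e \<eta>) k)"
      using smooth_at_frechet_chain[OF smooth_frameD(3)[OF fr p] pr' inj_triv_atlas[OF B]
          smooth_atlas_inj[OF T] C k' c', of "(0, \<tau> \<eta>)"]
      unfolding vert_coord[OF E fr e p \<eta> k c] e0 .
    also have "\<dots> = snd (tangent_proj E (vert E e \<eta>)) c"
      unfolding tangent_proj_def
      by (rule tangent_map_coord[OF T pr vert_in_tangent_space[OF E e \<eta>] k c, symmetric])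
    finally show ?thesis by simp
  qed
  moreover have "snd (tangent_proj E (vert E e \<eta>)) c = 0" if "c \<notin> charts_at (base E) ?p" for c
    unfolding tangent_proj_def by (rule tangent_map_outside) (simp add: that fst_vert[OF E e \<eta>])
  ultimately have "snd (tangent_proj E (vert E e \<eta>)) = (\<lambda>c. 0)" by blast
  then show ?thesis
    by (simp add: prod_eq_iff tangent_proj_def fst_tangent_map fst_vert[OF E e \<eta>])
qed

text \<open>The derivative of the trivialization sends \<open>\<nu>\<close> to
  \<open>(0, \<theta>)\<close>, the image of a vertical lift with fibre coordinate
  \<open>\<theta>\<close>. Applying the derivative of the inverse frame map recovers
  \<open>\<nu>\<close> on one side and, by \<open>vert_coord\<close>, that lift on the
  other.\<close>

lemma tangent_proj_zero_imp_vert: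
  fixes E :: "('a, 'm::finite_dim_inner, 'e, 'n::finite_dim_inner) vbundle"
  assumes E: "vector_bundle TYPE('f::finite_dim_inner) E" and e: "e \<in> space_of (total E)"
    and \<nu>: "\<nu> \<in> tangent_space (total E) e" and ker: "snd (tangent_proj E \<nu>) = (\<lambda>c. 0)"
  shows "\<exists>\<eta>\<in>fibre E (proj E e). vert E e \<eta> = \<nu>"
proof -
  let ?p = "proj E e"
  note B = vector_bundleD(1)[OF E] and T = vector_bundleD(2)[OF E]
  note Ti = smooth_atlas_inj[OF T]
  note pr = smooth_map_smooth_at[OF vector_bundleD(3)[OF E] e]
  have pb: "?p \<in> space_of (base E)" by (rule proj_in_base(1)[OF E e])
  obtain U and \<tau> :: "'e \<Rightarrow> 'f" and \<rho> where p: "?p \<in> U" and fr: "smooth_frame E U \<tau> \<rho>"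
    using smooth_frame_exists[OF E pb] by (elim exE conjE)
  note lf = smooth_frameD(1)[OF fr]
  obtain c where c: "c \<in> charts_at (base E) ?p" using pb by (auto simp: space_of_charts_at)
  let ?C = "triv_chart c U :: ('a \<times> 'f, _) chart"
  have C: "?C \<in> charts_at (triv_atlas E U) (?p, \<tau> e)" by (rule triv_chart_in[OF c p])
  let ?\<Phi> = "\<lambda>z. \<rho> (fst z) (snd z)" and ?\<Psi> = "\<lambda>e. (proj E e, \<tau> e)"
  have sPsi: "smooth_at (total E) (triv_atlas E U) ?\<Psi> e" by (rule smooth_frameD(2)[OF fr e p])
  have sPhi: "smooth_at (triv_atlas E U) (total E) ?\<Phi> (?\<Psi> e)" by (rule smooth_frameD(3)[OF fr p])
  have stau: "smooth_at (total E) model_atlas \<tau> e"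
    using smooth_at_snd_of_product_model[OF sPsi Ti] by simp
  let ?I = "(UNIV, \<lambda>x. x) :: ('f, 'f) chart"
  have I: "?I \<in> charts_at model_atlas (\<tau> e)" by (simp add: charts_at_model_atlas)
  have e0: "?\<Phi> (?\<Psi> e) = e"
    using local_frameD(3)[OF lf p proj_in_base(2)[OF E e]] by simp
  \<comment> \<open>The fibre component of \<open>\<nu>\<close> prescribes the coordinate of the
    vector to be lifted.\<close>
  define \<theta> where "\<theta> = snd (tangent_map (total E) model_atlas \<tau> \<nu>) ?I"
  define \<eta> where "\<eta> = \<rho> ?p \<theta>"
  have \<eta>: "\<eta> \<in> fibre E ?p" unfolding \<eta>_def by (rule local_frameD(4)[OF lf p])
  have tau_eta: "\<tau> \<eta> = \<theta>" unfolding \<eta>_def by (rule local_frameD(5)[OF lf p])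
  have coord: "snd (vert E e \<eta>) k = snd \<nu> k" if k: "k \<in> charts_at (total E) e" for k
  proof -
    let ?n = "snd \<nu> k" and ?x = "snd k e"
    have k': "k \<in> charts_at (total E) (?\<Phi> (?\<Psi> e))" unfolding e0 by (rule k)
    let ?f = "snd c \<circ> proj E \<circ> param k" and ?g = "snd ?I \<circ> \<tau> \<circ> param k"
    have "(?f has_derivative frechet_derivative ?f (at ?x)) (at ?x)"
      "(?g has_derivative frechet_derivative ?g (at ?x)) (at ?x)"
      by (rule has_derivative_frechet, rule smooth_at_differentiable[OF pr k c] smooth_at_differentiable[OF stau k I])+
    from has_derivative_Pair[OF this]
    have "(snd ?C \<circ> ?\<Psi> \<circ> param k has_derivative
        (\<lambda>v. (frechet_derivative ?f (at ?x) v, frechet_derivative ?g (at ?x) v))) (at ?x)"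
      by (simp add: triv_chart_def comp_def)
    then have "frechet_derivative (snd ?C \<circ> ?\<Psi> \<circ> param k) (at ?x) ?n =
        (frechet_derivative ?f (at ?x) ?n, frechet_derivative ?g (at ?x) ?n)"
      by (rule frechet_derivative_eqI)
    also have "frechet_derivative ?f (at ?x) ?n = 0"
      using tangent_map_coord[OF T pr \<nu> k c] ker by (simp add: tangent_proj_def)
    also have "frechet_derivative ?g (at ?x) ?n = \<theta>"
      unfolding \<theta>_def by (rule tangent_map_coord[OF T stau \<nu> k I, symmetric])
    finally have dPsi: "frechet_derivative (snd ?C \<circ> ?\<Psi> \<circ> param k) (at ?x) ?n = (0, \<theta>)" .
    let ?D = "{e \<in> space_of (total E). proj E e \<in> U}"
    have D: "open_of (total E) ?D"
      by (rule open_of_vimage[OF vector_bundleD(3)[OF E] Ti smooth_atlas_inj[OF B] local_frameD(1)[OF lf]])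
    \<comment> \<open>Frame and trivialization cancel only over \<open>U\<close>, so the comparison
      with the identity takes place on the open set \<open>?D\<close>.\<close>
    have "frechet_derivative (snd k \<circ> (\<lambda>q. ?\<Phi> (?\<Psi> q)) \<circ> param k) (at ?x) = frechet_derivative (\<lambda>x. x) (at ?x)"
    proof (rule frechet_derivative_cong_open)
      show "open (snd k ` (?D \<inter> fst k))" by (rule open_of_chart[OF D charts_atD(1)[OF k]])
      show "?x \<in> snd k ` (?D \<inter> fst k)" using e p charts_atD(2)[OF k] by blast
      fix y assume "y \<in> snd k ` (?D \<inter> fst k)"
      then obtain q where q: "q \<in> space_of (total E)" "proj E q \<in> U" "q \<in> fst k" "y = snd k q" by blast
      have "?\<Phi> (?\<Psi> q) = q"
        using local_frameD(3)[OF lf q(2) proj_in_base(2)[OF E q(1)]] by simp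
      then show "(snd k \<circ> (\<lambda>q. ?\<Phi> (?\<Psi> q)) \<circ> param k) y = y"
        using param_coord[OF Ti charts_atD(1)[OF k] q(3)] by (simp add: q(4))
    qed
    then have "?n = frechet_derivative (snd k \<circ> (\<lambda>q. ?\<Phi> (?\<Psi> q)) \<circ> param k) (at ?x) ?n" by simp
    also have "\<dots> = frechet_derivative (snd k \<circ> ?\<Phi> \<circ> param ?C) (at (snd ?C (?\<Psi> e))) (0, \<theta>)"
      using smooth_at_frechet_chain[OF sPsi sPhi Ti inj_triv_atlas[OF B] k C k', of ?n]
      unfolding dPsi .
    also have "\<dots> = snd (vert E e \<eta>) k"
      using vert_coord[OF E fr e p \<eta> k c] unfolding tau_eta by (rule sym)
    finally show ?thesis by (rule sym)
  qed
  have "vert E e \<eta> = \<nu>"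
  proof (intro prod_eqI ext)
    show "fst (vert E e \<eta>) = fst \<nu>" using fst_vert(2)[OF E e \<eta>] tangent_spaceD(1)[OF \<nu>] by simp
    show "snd (vert E e \<eta>) k = snd \<nu> k" for k
      using coord vert_outside[OF E e \<eta>] tangent_spaceD(2)[OF \<nu>] by (cases "k \<in> charts_at (total E) e") simp_all
  qed
  with \<eta> show ?thesis by (intro bexI)
qed

text \<open>The curve stays at \<open>e\<close>, so all its velocities vanish. For a vertical
  \<open>\<nu>\<close> this turns nonvanishing of \<open>\<nu>\<close> into nonvanishing of the
  lifted vector.\<close>

lemma vert_zero:
  assumes E: "vector_bundle TYPE('f::finite_dim_inner) E" and e: "e \<in> space_of (total E)"
  shows "vert E e (zero_section E (proj E e)) = (e, \<lambda>c. 0)"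
proof -
  note vs = vector_bundleD(4)[OF E proj_in_base(1)[OF E e]]
  have "fibre_add E e (fibre_scale E t (zero_section E (proj E e))) = e" for t
    using real_vector_space_onD(4)[OF vs proj_in_base(2)[OF E e]] real_vector_space_onD(6)[OF vs] by simp
  then show ?thesis by (simp add: vert_def velocity_def comp_def fun_eq_iff)
qed

section \<open>The Sasaki metric\<close>

lemma bundle_metric_zero:
  assumes g: "bundle_metric E g" and p: "p \<in> space_of (base E)"
    and vs: "real_vector_space_on (fibre E p) (fibre_add E) (fibre_scale E) (zero_section E p)"
    and y: "y \<in> fibre E p"
  shows "g (zero_section E p) y = 0"
  using bundle_metricD(3)[OF g p y y, of 0] real_vector_space_onD(5)[OF vs y] by simp

lemma bundle_metric_nonneg:
  assumes g: "bundle_metric E g" and p: "p \<in> space_of (base E)"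
    and vs: "real_vector_space_on (fibre E p) (fibre_add E) (fibre_scale E) (zero_section E p)"
    and x: "x \<in> fibre E p"
  shows "0 \<le> g x x"
  using bundle_metricD(4)[OF g p x] bundle_metric_zero[OF g p vs x]
  by (cases "x = zero_section E p") auto

lemma bundle_metric_Cauchy_Schwarz:
  assumes g: "bundle_metric E g" and p: "p \<in> space_of (base E)"
    and vs: "real_vector_space_on (fibre E p) (fibre_add E) (fibre_scale E) (zero_section E p)"
    and x: "x \<in> fibre E p" and y: "y \<in> fibre E p"
  shows "(g x y)\<^sup>2 \<le> g x x * g y y"
proof (cases "y = zero_section E p")
  case True
  then show ?thesis
    using bundle_metricD(1)[OF g p x y] bundle_metric_zero[OF g p vs x] bundle_metric_zero[OF g p vs y]
    by simp
next
  case False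
  then have pos: "0 < g y y" by (rule bundle_metricD(4)[OF g p y])
  \<comment> \<open>The residual of \<open>x\<close> along \<open>y\<close>, multiplied by
    \<open>g y y\<close> to avoid division; its square length is \<open>g y y\<close> times the
    difference in the claim.\<close>
  let ?a = "fibre_scale E (g y y) x" and ?b = "fibre_scale E (- g x y) y"
  note mem = real_vector_space_onD(2,3)[OF vs]
  have a: "?a \<in> fibre E p" and b: "?b \<in> fibre E p" by (rule mem x y)+
  note v = mem(1)[OF a b]
  have expand: "g (fibre_add E ?a ?b) z = g y y * g x z - g x y * g y z" if z: "z \<in> fibre E p" for z
    using bundle_metricD(2)[OF g p a b z] bundle_metricD(3)[OF g p x z] bundle_metricD(3)[OF g p y z]
    by simp
  \<comment> \<open>The expansion works in the first argument, so symmetry brings the combination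
    there before it is expanded a second time.\<close>
  have sym: "g x (fibre_add E ?a ?b) = g (fibre_add E ?a ?b) x"
    "g y (fibre_add E ?a ?b) = g (fibre_add E ?a ?b) y" "g y x = g x y"
    by (rule bundle_metricD(1)[OF g p _ _] x y v)+
  have "0 \<le> g (fibre_add E ?a ?b) (fibre_add E ?a ?b)" by (rule bundle_metric_nonneg[OF g p vs v])
  also have "\<dots> = g y y * (g x x * g y y - (g x y)\<^sup>2)"
    unfolding expand[OF v] sym(1,2) expand[OF x] expand[OF y] sym(3)
    by (simp add: algebra_simps power2_eq_square)
  finally show ?thesis using pos by (simp add: zero_le_mult_iff)
qed

lemma tangent_bundle_simps:
  "base (tangent_bundle A) = A" "total (tangent_bundle A) = tangent_atlas A"
  "proj (tangent_bundle A) = fst" "zero_section (tangent_bundle A) p = (p, \<lambda>c. 0)"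
  by (simp_all add: tangent_bundle_def)

lemma zero_in_tangent_space:
  assumes A: "smooth_atlas A"
  shows "(p, \<lambda>c. 0) \<in> tangent_space A p"
  unfolding tangent_space_iff fst_conv snd_conv
proof (intro conjI allI impI ballI)
  fix c d assume "c \<in> charts_at A p" "d \<in> charts_at A p"
  then show "0 = frechet_derivative (snd d \<circ> param c) (at (snd c p)) 0"
    using linear_0[OF linear_frechet_derivative[OF transition_differentiable[OF A]]] by metis
qed simp_all

lemma riemannian_metric_nonneg:
  assumes A: "smooth_atlas A" and g: "riemannian_metric A g" and p: "p \<in> space_of A" and v: "v \<in> tangent_space A p"
  shows "0 \<le> g v v" "v \<noteq> (p, \<lambda>c. 0) \<Longrightarrow> 0 < g v v" "g (p, \<lambda>c. 0) (p, \<lambda>c. 0) = 0"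
proof -
  have bm: "bundle_metric (tangent_bundle A) g" using g by (simp add: riemannian_metric_def)
  have pb: "p \<in> space_of (base (tangent_bundle A))" using p by (simp add: tangent_bundle_simps)
  note fib = fibre_tangent_bundle[OF p]
  show pos: "v \<noteq> (p, \<lambda>c. 0) \<Longrightarrow> 0 < g v v"
    using bundle_metricD(4)[OF bm pb, of v] v by (simp add: fib tangent_bundle_simps)
  have z: "(p, \<lambda>c. 0) \<in> fibre (tangent_bundle A) p"
    unfolding fib by (rule zero_in_tangent_space[OF A])
  have "fibre_scale (tangent_bundle A) 0 (p, \<lambda>c. 0) = (p, \<lambda>c. 0)" by (simp add: tangent_bundle_def)
  then show zero: "g (p, \<lambda>c. 0) (p, \<lambda>c. 0) = 0"
    using bundle_metricD(3)[OF bm pb z z, of 0] by simp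
  show "0 \<le> g v v" using pos zero by (cases "v = (p, \<lambda>c. 0)") auto
qed

text \<open>Locally the zero section is the frame section with coordinate vector 0, because
  \<open>\<rho> p\<close> respects multiplication by the scalar 0.\<close>

lemma smooth_zero_section:
  assumes E: "vector_bundle TYPE('f::finite_dim_inner) E"
  shows "smooth_map (base E) (total E) (zero_section E)"
  unfolding smooth_map_iff_smooth_at
proof
  fix p assume p: "p \<in> space_of (base E)"
  note B = vector_bundleD(1)[OF E]
  obtain U and \<tau> :: "_ \<Rightarrow> 'f" and \<rho> where pU: "p \<in> U" and fr: "smooth_frame E U \<tau> \<rho>"
    using smooth_frame_exists[OF E p] by (elim exE conjE)
  note lf = smooth_frameD(1)[OF fr]
  note U = local_frameD(1)[OF lf]
  have "smooth_at (restrict_atlas (base E) U) (total E) (\<lambda>p. \<rho> p 0) p"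
    using local_frameD(2)[OF lf, of 0] p pU unfolding smooth_section_def smooth_map_iff_smooth_at
    by (simp add: space_of_restrict_atlas)
  then have "smooth_at (base E) (total E) (\<lambda>p. \<rho> p 0) p"
    using smooth_at_restrict_source[OF smooth_atlas_inj[OF B] U pU] by blast
  moreover have "\<rho> q 0 = zero_section E q" if q: "q \<in> U" for q
  proof -
    have "q \<in> space_of (base E)" using U q by (auto simp: open_of_def)
    then show ?thesis
      using local_frameD(7)[OF lf q, of 0 0]
        real_vector_space_onD(5)[OF vector_bundleD(4)[OF E] local_frameD(4)[OF lf q]] by simp
  qed
  ultimately show "smooth_at (base E) (total E) (zero_section E) p"
    by (rule smooth_at_cong[OF _ smooth_atlas_inj[OF B] U pU])
qed

text \<open>Linearity over \<open>E\<close> will make the Sasaki form bilinear on each tangent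
  space. Homogeneity over \<open>TM\<close>, taken with factor zero, will make \<open>K\<close>
  vanish on horizontal vectors.\<close>

lemma connectionD:
  assumes "connection E K"
  shows "smooth_map (tangent_atlas (total E)) (total E) K"
    and "\<nu> \<in> space_of (tangent_atlas (total E)) \<Longrightarrow> K \<nu> \<in> fibre E (proj E (fst \<nu>))"
    and "e \<in> space_of (total E) \<Longrightarrow> \<nu> \<in> tangent_space (total E) e \<Longrightarrow> \<nu>' \<in> tangent_space (total E) e \<Longrightarrow>
      K (fibre_add (tangent_bundle (total E)) \<nu> \<nu>') = fibre_add E (K \<nu>) (K \<nu>')"
    and "e \<in> space_of (total E) \<Longrightarrow> \<nu> \<in> tangent_space (total E) e \<Longrightarrow>
      K (fibre_scale (tangent_bundle (total E)) r \<nu>) = fibre_scale E r (K \<nu>)"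
    and "tangent_proj E \<nu> \<in> space_of (tangent_atlas (base E)) \<Longrightarrow>
      \<nu> \<in> space_of (tangent_atlas (total E)) \<Longrightarrow>
      K (tangent_map (total E) (total E) (fibre_scale E r) \<nu>) = fibre_scale E r (K \<nu>)"
    and "e \<in> space_of (total E) \<Longrightarrow> \<eta> \<in> fibre E (proj E e) \<Longrightarrow> K (vert E e \<eta>) = \<eta>"
proof -
  have m1: "bundle_morphism (tangent_bundle (total E)) E K (proj E)"
    and m2: "bundle_morphism (tangent_lift E) E K fst"
    using assms by (simp_all add: connection_def)
  show sm: "smooth_map (tangent_atlas (total E)) (total E) K"
    using m1 by (simp add: bundle_morphism_def tangent_bundle_simps)
  show "\<nu> \<in> space_of (tangent_atlas (total E)) \<Longrightarrow> K \<nu> \<in> fibre E (proj E (fst \<nu>))"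
    using m1 smooth_at_space(2)[OF smooth_map_smooth_at[OF sm]]
    by (simp add: bundle_morphism_def tangent_bundle_simps fibre_def)
  have lin: "\<forall>e\<in>space_of (total E). \<forall>\<nu>\<in>fibre (tangent_bundle (total E)) e.
      (\<forall>\<nu>'\<in>fibre (tangent_bundle (total E)) e.
        K (fibre_add (tangent_bundle (total E)) \<nu> \<nu>') = fibre_add E (K \<nu>) (K \<nu>')) \<and>
      (\<forall>r. K (fibre_scale (tangent_bundle (total E)) r \<nu>) = fibre_scale E r (K \<nu>))"
    using m1 unfolding bundle_morphism_def tangent_bundle_simps by (elim conjE)
  show "K (fibre_add (tangent_bundle (total E)) \<nu> \<nu>') = fibre_add E (K \<nu>) (K \<nu>')"
    if "e \<in> space_of (total E)" "\<nu> \<in> tangent_space (total E) e" "\<nu>' \<in> tangent_space (total E) e"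
    using lin that fibre_tangent_bundle[OF that(1)] by simp
  show "K (fibre_scale (tangent_bundle (total E)) r \<nu>) = fibre_scale E r (K \<nu>)"
    if "e \<in> space_of (total E)" "\<nu> \<in> tangent_space (total E) e"
    using lin that fibre_tangent_bundle[OF that(1)] by simp
  show "K (tangent_map (total E) (total E) (fibre_scale E r) \<nu>) = fibre_scale E r (K \<nu>)"
    if "tangent_proj E \<nu> \<in> space_of (tangent_atlas (base E))" "\<nu> \<in> space_of (tangent_atlas (total E))"
  proof -
    have "\<nu> \<in> fibre (tangent_lift E) (tangent_proj E \<nu>)"
      "tangent_proj E \<nu> \<in> space_of (base (tangent_lift E))"
      using that by (simp_all add: fibre_def tangent_lift_def)
    moreover have "\<forall>p\<in>space_of (base (tangent_lift E)). \<forall>x\<in>fibre (tangent_lift E) p.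
        (\<forall>y\<in>fibre (tangent_lift E) p. K (fibre_add (tangent_lift E) x y) = fibre_add E (K x) (K y)) \<and>
        (\<forall>r. K (fibre_scale (tangent_lift E) r x) = fibre_scale E r (K x))"
      using m2 unfolding bundle_morphism_def by (elim conjE)
    ultimately have "K (fibre_scale (tangent_lift E) r \<nu>) = fibre_scale E r (K \<nu>)" by blast
    then show ?thesis by (simp add: tangent_lift_def)
  qed
  show "e \<in> space_of (total E) \<Longrightarrow> \<eta> \<in> fibre E (proj E e) \<Longrightarrow> K (vert E e \<eta>) = \<eta>"
    using assms by (simp add: connection_def)
qed

lemma tangent_proj_in:
  assumes E: "vector_bundle TYPE('f::finite_dim_inner) E" and e: "e \<in> space_of (total E)"
    and \<nu>: "\<nu> \<in> tangent_space (total E) e"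
  shows "tangent_proj E \<nu> \<in> tangent_space (base E) (proj E e)"
  unfolding tangent_proj_def
  by (rule tangent_map_in_tangent_space[OF vector_bundleD(2,1)[OF E]
        smooth_map_smooth_at[OF vector_bundleD(3)[OF E] e] \<nu>])

lemma tangent_atlas_spaceI:
  "e \<in> space_of A \<Longrightarrow> \<nu> \<in> tangent_space A e \<Longrightarrow> \<nu> \<in> space_of (tangent_atlas A)"
  using tangent_spaceD(1) by (metis space_of_tangent_atlas)

lemma connection_in_fibre:
  assumes K: "connection E K" and e: "e \<in> space_of (total E)"
    and \<nu>: "\<nu> \<in> tangent_space (total E) e"
  shows "K \<nu> \<in> fibre E (proj E e)"
  using connectionD(2)[OF K tangent_atlas_spaceI[OF e \<nu>]] tangent_spaceD(1)[OF \<nu>] by simp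

section \<open>The Sasaki metric is Riemannian\<close>

lemma sasaki_metric_smooth:
  fixes E :: "('a, 'm::finite_dim_inner, 'e, 'n::finite_dim_inner) vbundle"
  assumes E: "vector_bundle TYPE('f::finite_dim_inner) E"
    and gM: "riemannian_metric (base E) gM" and gE: "bundle_metric E gE" and K: "connection E K"
    and W: "open_of (total E) W"
    and s: "smooth_section (tangent_bundle (total E)) W s"
    and t: "smooth_section (tangent_bundle (total E)) W t"
  shows "smooth_map (restrict_atlas (total E) W) model_atlas (\<lambda>e. sasaki_metric E gM gE K (s e) (t e))"
  unfolding smooth_map_iff_smooth_at
proof
  fix e assume "e \<in> space_of (restrict_atlas (total E) W)"
  then have e: "e \<in> space_of (total E)" and eW: "e \<in> W" by (simp_all add: space_of_restrict_atlas)
  note B = vector_bundleD(1)[OF E] and T = vector_bundleD(2)[OF E] and pr = vector_bundleD(3)[OF E]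
  note Bi = smooth_atlas_inj[OF B] and Ti = smooth_atlas_inj[OF T]
  have WS: "q \<in> space_of (total E)" if "q \<in> W" for q using W that by (auto simp: open_of_def)
  have sec: "r q \<in> tangent_space (total E) q" "smooth_at (total E) (tangent_atlas (total E)) r q"
    if r: "smooth_section (tangent_bundle (total E)) W r" and q: "q \<in> W" for r q
  proof -
    have "smooth_at (restrict_atlas (total E) W) (tangent_atlas (total E)) r q" and f: "fst (r q) = q"
      using r q WS[OF q] unfolding smooth_section_def smooth_map_iff_smooth_at tangent_bundle_simps
      by (simp_all add: space_of_restrict_atlas)
    then show sr: "smooth_at (total E) (tangent_atlas (total E)) r q"
      using smooth_at_restrict_source[OF Ti W q] by blast
    show "r q \<in> tangent_space (total E) q"
      using smooth_at_space(2)[OF sr] f by (simp add: space_of_tangent_atlas)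
  qed
  have pb: "proj E e \<in> space_of (base E)" by (rule proj_in_base(1)[OF E e])
  then obtain c where c: "c \<in> charts_at (base E) (proj E e)" by (auto simp: space_of_charts_at)
  obtain U and \<tau> :: "'e \<Rightarrow> 'f" and \<rho> where p: "proj E e \<in> U" and fr: "smooth_frame E U \<tau> \<rho>"
    using smooth_frame_exists[OF E pb] by (elim exE conjE)
  note lf = smooth_frameD(1)[OF fr]
  have nbhd: "open_of (total E) (W \<inter> {q \<in> space_of (total E). proj E q \<in> V})" if "open_of (base E) V" for V
    by (intro open_of_Int T W open_of_vimage[OF pr Ti Bi that])

  \<comment> \<open>Base term: the frame is the coordinate frame of \<open>c\<close>, and the
    coordinates of \<open>D\<pi> \<circ> s\<close> are its components in \<open>c\<close>.\<close>
  have "smooth_at (total E) model_atlas (\<lambda>q. gM (tangent_proj E (s q)) (tangent_proj E (t q))) e"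
  proof (rule smooth_at_bundle_metric[OF T, where E="tangent_bundle (base E)" and h="proj E"])
    show "smooth_atlas (base (tangent_bundle (base E)))" unfolding tangent_bundle_simps by (rule B)
    show "bundle_metric (tangent_bundle (base E)) gM" using gM by (simp add: riemannian_metric_def)
    show "local_frame (tangent_bundle (base E)) (fst c) (\<lambda>v. snd v c) (coord_field (base E) c)"
      by (rule local_frame_coord_field[OF B charts_atD(1)[OF c]])
    let ?V = "W \<inter> {q \<in> space_of (total E). proj E q \<in> fst c}"
    show "open_of (total E) ?V" by (intro nbhd open_of_chart_domain B charts_atD(1)[OF c])
    show "e \<in> ?V" using eW e charts_atD(2)[OF c] by simp
    show "smooth_at (total E) (base (tangent_bundle (base E))) (proj E) e"
      unfolding tangent_bundle_simps by (rule smooth_map_smooth_at[OF pr e])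
    show "proj E q \<in> fst c" if "q \<in> ?V" for q using that by simp
    have fib: "tangent_proj E (r q) \<in> fibre (tangent_bundle (base E)) (proj E q)"
      if q: "q \<in> ?V" and r: "smooth_section (tangent_bundle (total E)) W r" for q r
    proof -
      have qW: "q \<in> W" using q by simp
      show ?thesis
        unfolding fibre_tangent_bundle[OF proj_in_base(1)[OF E WS[OF qW]]]
        by (rule tangent_proj_in[OF E WS[OF qW] sec(1)[OF r qW]])
    qed
    show "tangent_proj E (s q) \<in> fibre (tangent_bundle (base E)) (proj E q)" if "q \<in> ?V" for q
      by (rule fib[OF that s])
    show "tangent_proj E (t q) \<in> fibre (tangent_bundle (base E)) (proj E q)" if "q \<in> ?V" for q
      by (rule fib[OF that t])
    show "smooth_at (total E) model_atlas (\<lambda>q. snd (tangent_proj E (s q)) c) e"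
      unfolding tangent_proj_def
      by (rule smooth_at_tangent_map_coord[OF T pr sec(2)[OF s eW] W eW sec(1)[OF s] c])
    show "smooth_at (total E) model_atlas (\<lambda>q. snd (tangent_proj E (t q)) c) e"
      unfolding tangent_proj_def
      by (rule smooth_at_tangent_map_coord[OF T pr sec(2)[OF t eW] W eW sec(1)[OF t] c])
  qed
  \<comment> \<open>Fibre term: the frame comes from a trivialization around
    \<open>proj E e\<close>, and the coordinates are
    \<open>\<tau> \<circ> K \<circ> s\<close>.\<close>
  moreover have "smooth_at (total E) model_atlas (\<lambda>q. gE (K (s q)) (K (t q))) e"
  proof (rule smooth_at_bundle_metric[OF T B gE lf, where h="proj E"])
    let ?V = "W \<inter> {q \<in> space_of (total E). proj E q \<in> U}"
    show "open_of (total E) ?V" by (intro nbhd local_frameD(1)[OF lf])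
    show "e \<in> ?V" using eW e p by simp
    show "smooth_at (total E) (base E) (proj E) e" by (rule smooth_map_smooth_at[OF pr e])
    show "proj E q \<in> U" if "q \<in> ?V" for q using that by simp
    show "K (s q) \<in> fibre E (proj E q)" if q: "q \<in> ?V" for q
      using connection_in_fibre[OF K WS sec(1)[OF s]] q by simp
    show "K (t q) \<in> fibre E (proj E q)" if q: "q \<in> ?V" for q
      using connection_in_fibre[OF K WS sec(1)[OF t]] q by simp
    have "smooth_at (total E) model_atlas (\<lambda>q. \<tau> (K (r q))) e"
      if r: "smooth_section (tangent_bundle (total E)) W r" for r
    proof -
      note sr = sec(2)[OF r eW]
      \<comment> \<open>The point \<open>K (r e)\<close> generally differs from \<open>e\<close> but
        lies in the same fibre, hence over \<open>U\<close>, so \<open>\<tau>\<close> is smooth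
        there too.\<close>
      have Kr: "smooth_at (total E) (total E) (\<lambda>q. K (r q)) e"
        by (rule smooth_at_compose[OF sr _ Ti inj_tangent_atlas[OF Ti]])
          (rule smooth_map_smooth_at[OF connectionD(1)[OF K] smooth_at_space(2)[OF sr]])
      have "K (r e) \<in> fibre E (proj E e)" by (rule connection_in_fibre[OF K e sec(1)[OF r eW]])
      then have "K (r e) \<in> space_of (total E)" "proj E (K (r e)) \<in> U" using p by (simp_all add: fibre_def)
      from smooth_at_snd_of_product_model[OF smooth_frameD(2)[OF fr this] Ti]
      have "smooth_at (total E) model_atlas \<tau> (K (r e))" by simp
      from smooth_at_compose[OF Kr this Ti Ti] show ?thesis .
    qed
    then show "smooth_at (total E) model_atlas (\<lambda>q. \<tau> (K (s q))) e"
      "smooth_at (total E) model_atlas (\<lambda>q. \<tau> (K (t q))) e"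
      using s t by blast+
  qed
  ultimately have "smooth_at (total E) model_atlas (\<lambda>q. sasaki_metric E gM gE K (s q) (t q)) e"
    unfolding sasaki_metric_def by (rule smooth_at_model_add[OF _ _ Ti])
  then show "smooth_at (restrict_atlas (total E) W) model_atlas (\<lambda>q. sasaki_metric E gM gE K (s q) (t q)) e"
    using smooth_at_restrict_source[OF Ti W eW] by blast
qed

lemma sasaki_metric_pos:
  fixes E :: "('a, 'm::finite_dim_inner, 'e, 'n::finite_dim_inner) vbundle"
  assumes E: "vector_bundle TYPE('f::finite_dim_inner) E"
    and gM: "riemannian_metric (base E) gM" and gE: "bundle_metric E gE" and K: "connection E K"
    and e: "e \<in> space_of (total E)" and \<nu>: "\<nu> \<in> tangent_space (total E) e" and nz: "\<nu> \<noteq> (e, \<lambda>c. 0)"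
  shows "0 < sasaki_metric E gM gE K \<nu> \<nu>"
proof -
  note pb = proj_in_base(1)[OF E e]
  note vs = vector_bundleD(4)[OF E pb]
  note h = tangent_proj_in[OF E e \<nu>] and k = connection_in_fibre[OF K e \<nu>]
  have h0: "0 \<le> gM (tangent_proj E \<nu>) (tangent_proj E \<nu>)"
    by (rule riemannian_metric_nonneg(1)[OF vector_bundleD(1)[OF E] gM pb h])
  have k0: "0 \<le> gE (K \<nu>) (K \<nu>)" by (rule bundle_metric_nonneg[OF gE pb vs k])
  show ?thesis
  proof (cases "tangent_proj E \<nu> = (proj E e, \<lambda>c. 0)")
    case False
    then show ?thesis
      using riemannian_metric_nonneg(2)[OF vector_bundleD(1)[OF E] gM pb h] k0
      by (simp add: sasaki_metric_def)
  next
    case True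
    then obtain \<eta> where \<eta>: "\<eta> \<in> fibre E (proj E e)" "vert E e \<eta> = \<nu>"
      using tangent_proj_zero_imp_vert[OF E e \<nu>] by auto
    \<comment> \<open>Otherwise \<open>\<nu>\<close> would be the velocity of a constant curve. As
      \<open>K\<close> returns \<open>\<eta>\<close>, the fibre term is then strictly
      positive.\<close>
    have "\<eta> \<noteq> zero_section E (proj E e)" using nz \<eta>(2) vert_zero[OF E e] by auto
    moreover have "K \<nu> = \<eta>" using connectionD(6)[OF K e \<eta>(1)] \<eta>(2) by simp
    ultimately have "0 < gE (K \<nu>) (K \<nu>)" using bundle_metricD(4)[OF gE pb k] by simp
    then show ?thesis using h0 by (simp add: sasaki_metric_def)
  qed
qed

lemma riemannian_metric_sasaki:
  fixes E :: "('a, 'm::finite_dim_inner, 'e, 'n::finite_dim_inner) vbundle"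
  assumes E: "vector_bundle TYPE('f::finite_dim_inner) E"
    and gM: "riemannian_metric (base E) gM" and gE: "bundle_metric E gE" and K: "connection E K"
  shows "riemannian_metric (total E) (sasaki_metric E gM gE K)"
  unfolding riemannian_metric_def bundle_metric_def tangent_bundle_simps
proof (intro conjI ballI allI impI)
  let ?G = "sasaki_metric E gM gE K"
  note B = vector_bundleD(1)[OF E] and T = vector_bundleD(2)[OF E]
  have gM': "bundle_metric (tangent_bundle (base E)) gM" using gM by (simp add: riemannian_metric_def)
  fix e v assume e: "e \<in> space_of (total E)" and v': "v \<in> fibre (tangent_bundle (total E)) e"
  note fib = fibre_tangent_bundle[OF e]
  have v: "v \<in> tangent_space (total E) e" using v' unfolding fib .
  note pb = proj_in_base(1)[OF E e]
  have pb': "proj E e \<in> space_of (base (tangent_bundle (base E)))" using pb by (simp add: tangent_bundle_simps)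
  note k = connection_in_fibre[OF K e]
  have h: "tangent_proj E u \<in> fibre (tangent_bundle (base E)) (proj E e)"
    if "u \<in> tangent_space (total E) e" for u
    unfolding fibre_tangent_bundle[OF pb] by (rule tangent_proj_in[OF E e that])
  \<comment> \<open>\<open>D\<pi>\<close> and \<open>K\<close> are linear on the tangent space at
    \<open>e\<close>, with values over the single point \<open>proj E e\<close>; pulling
    \<open>gM\<close> and \<open>gE\<close> back along them gives symmetric bilinear forms.\<close>
  note lin = tangent_map_linear[OF smooth_map_smooth_at[OF vector_bundleD(3)[OF E] e],
      folded tangent_proj_def, OF tangent_spaceD(1) tangent_spaceD(1)]
  show "?G v w = ?G w v" if "w \<in> fibre (tangent_bundle (total E)) e" for w
    using bundle_metricD(1)[OF gM' pb' h[OF v] h] bundle_metricD(1)[OF gE pb k[OF v] k] that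
    unfolding fib by (simp add: sasaki_metric_def)
  show "?G (fibre_add (tangent_bundle (total E)) v w) u = ?G v u + ?G w u"
    if "w \<in> fibre (tangent_bundle (total E)) e" "u \<in> fibre (tangent_bundle (total E)) e" for w u
    using bundle_metricD(2)[OF gM' pb' h[OF v] h h] bundle_metricD(2)[OF gE pb k[OF v] k k] that
      lin(1)[OF v] connectionD(3)[OF K e v]
    unfolding fib by (simp add: sasaki_metric_def)
  show "?G (fibre_scale (tangent_bundle (total E)) r v) w = r * ?G v w"
    if "w \<in> fibre (tangent_bundle (total E)) e" for r w
    using bundle_metricD(3)[OF gM' pb' h[OF v] h] bundle_metricD(3)[OF gE pb k[OF v] k] that
      lin(2)[OF v v] connectionD(4)[OF K e v]
    unfolding fib by (simp add: sasaki_metric_def algebra_simps)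
  show "0 < ?G v v" if "v \<noteq> (e, \<lambda>c. 0)"
    by (rule sasaki_metric_pos[OF E gM gE K e v that])
next
  fix W s t
  assume "openin (manifold_topology (total E)) W" "smooth_section (tangent_bundle (total E)) W s"
    "smooth_section (tangent_bundle (total E)) W t"
  then show "smooth_map (restrict_atlas (total E) W) model_atlas (\<lambda>p. sasaki_metric E gM gE K (s p) (t p))"
    using sasaki_metric_smooth[OF E gM gE K] openin_manifold_topology[OF vector_bundleD(2)[OF E]] by blast
qed

text \<open>Scaling by \<open>0\<close> is the zero section composed with the projection, so its derivative is both
  the horizontal vector \<open>D\<pi>(\<nu>)\<close> and a fibrewise multiple by \<open>0\<close>, which every connection kills.\<close>

lemma tangent_zero_proj:
  fixes E :: "('a, 'm::finite_dim_inner, 'e, 'n::finite_dim_inner) vbundle"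
  assumes E: "vector_bundle TYPE('f::finite_dim_inner) E"
    and e: "e \<in> space_of (total E)" and \<nu>: "\<nu> \<in> tangent_space (total E) e"
  shows "tangent_zero E (tangent_proj E \<nu>) = tangent_map (total E) (total E) (fibre_scale E 0) \<nu>"
    and "tangent_proj E (tangent_zero E (tangent_proj E \<nu>)) = tangent_proj E \<nu>"
proof -
  note B = vector_bundleD(1)[OF E] and T = vector_bundleD(2)[OF E] and pr = vector_bundleD(3)[OF E]
  note pb = proj_in_base(1)[OF E e]
  note sp = smooth_map_smooth_at[OF pr e] and sz = smooth_map_smooth_at[OF smooth_zero_section[OF E] pb]
  have fst\<nu>: "fst \<nu> \<in> space_of (total E)" using e tangent_spaceD(1)[OF \<nu>] by simp
  have comp: "tangent_map (total E) (total E) (\<lambda>q. zero_section E (proj E q)) \<nu> =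
      tangent_zero E (tangent_proj E \<nu>)"
    unfolding tangent_zero_def tangent_proj_def by (rule tangent_map_compose[OF T B sp sz \<nu>])
  have scale: "zero_section E (proj E q) = fibre_scale E 0 q" if "q \<in> space_of (total E)" for q
    using real_vector_space_onD(5)[OF vector_bundleD(4)[OF E proj_in_base(1)[OF E that]] proj_in_base(2)[OF E that]]
    by (rule sym)
  show "tangent_zero E (tangent_proj E \<nu>) = tangent_map (total E) (total E) (fibre_scale E 0) \<nu>"
    unfolding comp[symmetric] by (rule tangent_map_cong[OF T scale fst\<nu>])
  have zp: "smooth_at (total E) (total E) (\<lambda>q. zero_section E (proj E q)) e"
    by (rule smooth_at_compose[OF sp sz smooth_atlas_inj[OF T] smooth_atlas_inj[OF B]])
  \<comment> \<open>The zero section preserves base points, so passing to the horizontal vector does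
    not change the image under \<open>D\<pi>\<close>.\<close>
  have "proj E (zero_section E (proj E q)) = proj E q" if "q \<in> space_of (total E)" for q
    using real_vector_space_onD(1)[OF vector_bundleD(4)[OF E proj_in_base(1)[OF E that]]]
    by (simp add: fibre_def)
  then have "tangent_map (total E) (base E) (\<lambda>q. proj E (zero_section E (proj E q))) \<nu> = tangent_proj E \<nu>"
    unfolding tangent_proj_def by (rule tangent_map_cong[OF T _ fst\<nu>])
  moreover have "tangent_map (total E) (base E) (\<lambda>q. proj E (zero_section E (proj E q))) \<nu> =
      tangent_proj E (tangent_zero E (tangent_proj E \<nu>))"
    unfolding comp[symmetric] unfolding tangent_proj_def
    by (rule tangent_map_compose[OF T T zp smooth_map_smooth_at[OF pr smooth_at_space(2)[OF zp]] \<nu>])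
  ultimately show "tangent_proj E (tangent_zero E (tangent_proj E \<nu>)) = tangent_proj E \<nu>" by simp
qed

section \<open>Strong concordance\<close>

theorem proposition4p14:
  fixes M :: "('a, 'm::finite_dim_inner) atlas"
    and gM :: "('a, 'm) tangent \<Rightarrow> ('a, 'm) tangent \<Rightarrow> real"
    and E :: "('a, 'm, 'e, 'n::finite_dim_inner) vbundle"
    and gE :: "'e \<Rightarrow> 'e \<Rightarrow> real"
    and K :: "('e, 'n) tangent \<Rightarrow> 'e"
  assumes "riemannian_manifold M gM"
    and "vector_bundle TYPE('f::finite_dim_inner) E"
    and "base E = M"
    and "bundle_metric E gE"
    and "metric_connection E gE K"
  shows "strongly_concordant E gE (sasaki_metric E gM gE K)"
proof -
  let ?G = "sasaki_metric E gM gE K"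
  note E = assms(2) and gE = assms(4)
  have gM: "riemannian_metric (base E) gM" using assms(1,3) by (simp add: riemannian_manifold_def)
  have K: "connection E K" and metric: "\<And>\<nu>. \<nu> \<in> space_of (tangent_atlas (total E)) \<Longrightarrow>
      derivative_fun (total E) (\<lambda>e. gE e e) \<nu> = 2 * gE (K \<nu>) (fst \<nu>)"
    using assms(5) by (simp_all add: metric_connection_def)
  have point: "\<exists>e. fst \<nu> = e \<and> e \<in> space_of (total E) \<and> \<nu> \<in> tangent_space (total E) e"
    if "\<nu> \<in> space_of (tangent_atlas (total E))" for \<nu>
    using that by (simp add: space_of_tangent_atlas)
  have horizontal: "?G (tangent_zero E (tangent_proj E \<nu>)) (tangent_zero E (tangent_proj E \<nu>)) \<le> ?G \<nu> \<nu>"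
    if \<nu>: "\<nu> \<in> space_of (tangent_atlas (total E))" for \<nu>
  proof -
    obtain e where e: "e \<in> space_of (total E)" "\<nu> \<in> tangent_space (total E) e"
      using point[OF \<nu>] by (elim exE conjE)
    note pb = proj_in_base(1)[OF E e(1)] and k = connection_in_fibre[OF K e]
    note vs = vector_bundleD(4)[OF E pb]
    have "tangent_proj E \<nu> \<in> space_of (tangent_atlas (base E))"
      by (rule tangent_atlas_spaceI[OF pb tangent_proj_in[OF E e]])
    from connectionD(5)[OF K this \<nu>, of 0]
    have "K (tangent_zero E (tangent_proj E \<nu>)) = zero_section E (proj E e)"
      unfolding tangent_zero_proj(1)[OF E e] real_vector_space_onD(5)[OF vs k] .
    \<comment> \<open>The base terms on both sides coincide and the fibre term on the left is zero,
      so what remains is \<open>0 \<le> gE (K \<nu>) (K \<nu>)\<close>.\<close>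
    then show ?thesis
      using tangent_zero_proj(2)[OF E e] bundle_metric_nonneg[OF gE pb vs k]
        bundle_metric_zero[OF gE pb vs real_vector_space_onD(1)[OF vs]]
      by (simp add: sasaki_metric_def)
  qed
  have radial: "(inverse 1 * derivative_fun (total E) (\<lambda>e. gE e e) \<nu>)\<^sup>2 \<le> 4 * gE (fst \<nu>) (fst \<nu>) * ?G \<nu> \<nu>"
    if \<nu>: "\<nu> \<in> space_of (tangent_atlas (total E))" for \<nu>
  proof -
    obtain e where f: "fst \<nu> = e" and e: "e \<in> space_of (total E)" "\<nu> \<in> tangent_space (total E) e"
      using point[OF \<nu>] by (elim exE conjE)
    note pb = proj_in_base(1)[OF E e(1)] and k = connection_in_fibre[OF K e]
      and ef = proj_in_base(2)[OF E e(1)]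
    note vs = vector_bundleD(4)[OF E pb]
    have "(gE (K \<nu>) e)\<^sup>2 \<le> gE (K \<nu>) (K \<nu>) * gE e e"
      by (rule bundle_metric_Cauchy_Schwarz[OF gE pb vs k ef])
    \<comment> \<open>The Sasaki form exceeds its fibre term by the nonnegative base term;
      multiplication by \<open>gE e e \<ge> 0\<close> keeps the order.\<close>
    also have "\<dots> \<le> ?G \<nu> \<nu> * gE e e"
      using riemannian_metric_nonneg(1)[OF vector_bundleD(1)[OF E] gM pb tangent_proj_in[OF E e]]
        bundle_metric_nonneg[OF gE pb vs ef]
      by (intro mult_right_mono) (simp_all add: sasaki_metric_def)
    finally show ?thesis by (simp add: metric[OF \<nu>] f power_mult_distrib mult.commute)
  qed
  \<comment> \<open>This is in fact an equality: the base term vanishes and the fibre term is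
    \<open>gE e e\<close>.\<close>
  have vertical: "?G (vert E e e) (vert E e e) \<le> 1\<^sup>2 * gE e e" if e: "e \<in> space_of (total E)" for e
    using tangent_proj_vert[OF E e proj_in_base(2)[OF E e]] connectionD(6)[OF K e proj_in_base(2)[OF E e]]
      riemannian_metric_nonneg(3)[OF vector_bundleD(1)[OF E] gM proj_in_base(1)[OF E e]
        zero_in_tangent_space[OF vector_bundleD(1)[OF E]]]
    by (simp add: sasaki_metric_def)
  show ?thesis
    unfolding strongly_concordant_def
    using riemannian_metric_sasaki[OF E gM gE K] horizontal radial vertical
    by (intro conjI exI[of _ 1] ballI) simp_all
qed

end
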